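(* Let $\mathcal G$ be an $S^1$-bundle gerbe over a smooth manifold $M$ with connection $\gamma$, let $\tau\in\Omega^2(M)$, let $B$ be a curving for $\gamma$ with resulting 3-curvature $\chi$, and let $B'=B+\pi^*\tau$, a curving for $\gamma$ with resulting 3-curvature $\chi+d\tau$. Let $\mathsf F:\mathbb X(\mathcal G,\gamma)\dashrightarrow\mathbb L(C_\chi)$ and $\mathsf F':\mathbb X(\mathcal G,\gamma)\dashrightarrow\mathbb L(C_{\chi+d\tau})$ be the invertible butterflies determined by $B$ and $B'$ respectively (see context), and let $\mathsf T_\tau:\mathbb L(C_\chi)\to\mathbb L(C_{\chi+d\tau})$ be the strict isomorphism of Lie 2-algebras $(\mathsf T_\tau)_0(u,\alpha)=(u,\alpha+\iota_u\tau)$, $(\mathsf T_\tau)_1=\mathrm{id}$. Then the triangle formed by $\mathsf F$, $\mathsf F'$ and $\mathsf T_\tau$ 2-commutes: there is an isomorphism of butterflies $\mathsf T_\tau\circ\mathsf F\Rightarrow\mathsf F'$.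
   Context: **Lie 2-algebras.** A Lie 2-algebra $V$ consists of a linear map $\partial:V_1\to V_0$ of real vector spaces, a skew bilinear bracket $V_0\times V_0\to V_0$, a bilinear bracket $V_0\times V_1\to V_1$ (with $[a,x]:=-[x,a]$), and an alternating trilinear Jacobiator $J:V_0^3\to V_1$, such that $\partial[x,a]=[x,\partial a]$, $[\partial a,b]=[a,\partial b]$, $\partial J(x,y,z)=[x,[y,z]]+[y,[z,x]]+[z,[x,y]]$, $J(x,y,\partial a)=[x,[y,a]]+[y,[a,x]]+[a,[x,y]]$, and $\sum_i(-1)^{i+1}[x_i,J(\dots\widehat{x_i}\dots)]+\sum_{i<j}(-1)^{i+j}J([x_i,x_j],\dots\widehat{x_i}\dots\widehat{x_j}\dots)=0$ for $x_1,\dots,x_4\in V_0$. It is strict if $J=0$. A strict morphism $f:V\to W$ is a chain map $(f_0,f_1)$ preserving all brackets and Jacobiators. **Butterflies.** A butterfly $V\dashrightarrow W$ is a vector space $E$ with a skew bilinear bracket and linear maps $\kappa:V_1\to E$, $\lambda:W_1\to E$, $\sigma:E\to V_0$, $\rho:E\to W_0$ such that $\sigma\kappa=\partial_V$, $\rho\lambda=\partial_W$, $\rho\kappa=0$, $\sigma\lambda=0$; the sequence $0\to W_1\xrightarrow{\lambda}E\xrightarrow{\sigma}V_0\to0$ is exact; $\sigma$ and $\rho$ preserve brackets; $[e,\lambda(w)]=\lambda[\rho(e),w]$ and $[e,\kappa(v)]=\kappa[\sigma(e),v]$; and $[e_1,[e_2,e_3]]+[e_2,[e_3,e_1]]+[e_3,[e_1,e_2]]=\lambda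 J_W(\rho e_1,\rho e_2,\rho e_3)+\kappa J_V(\sigma e_1,\sigma e_2,\sigma e_3)$. It is invertible if also $0\to V_1\xrightarrow{\kappa}E\xrightarrow{\rho}W_0\to0$ is exact. An isomorphism (2-morphism) of butterflies $E\Rightarrow E'$ is a bracket-preserving linear isomorphism commuting with all structure maps. The composite of $E:V\dashrightarrow W$ and $E':W\dashrightarrow U$ is $E'\circ E=(E\times_{W_0}E')/\{(\lambda_E(w),\kappa_{E'}(w)):w\in W_1\}$ (fibre product of $\rho_E$ and $\sigma_{E'}$), with componentwise bracket, $\kappa(v)=(\kappa_E(v),0)$, $\lambda(u)=(0,\lambda_{E'}(u))$, $\sigma=\sigma_E$, $\rho=\rho_{E'}$. A strict morphism $f:V\to W$ is regarded as the butterfly $W_1\oplus V_0$ with $\kappa(v)=(-f_1(v),\partial v)$, $\lambda(w)=(w,0)$, $\sigma(w,x)=x$, $\rho(w,x)=\partial w+f_0(x)$, and bracket $[(w,x),(w',x')]=([f_0x,w']-[f_0x',w]+[\partial w,w'],[x,x'])$. **Bundle gerbes.** An $S^1$-bundle gerbe $\mathcal G$ over $M$ consists of a surjective submersion $\pi:X\to M$, a Lie groupoid $P\rightrightarrows X$ (source $s$, target $t$; product $p\cdot q$ defined when $s(p)=t(q)$; unit map $\epsilon:X\to P$), a morphism of Lie groupoids over $\mathrm{id}_X$ from $P$ to the submersion groupoid $X\times_MX\rightrightarrows X$, and a left $S^1$-action on $P$ making $P\to X\times_MX$ a principal $S^1$-bundle with $(zp)\cdot(wq)=(zw)(p\cdot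 q)$. The simplicial differential is $\delta\omega=s^*\omega-t^*\omega$ for $\omega\in\Omega^\bullet(X)$ and $\delta\omega=\mathrm{pr}_1^*\omega-m^*\omega+\mathrm{pr}_2^*\omega$ for $\omega\in\Omega^\bullet(P)$, $m$ the multiplication. A connection on $\mathcal G$ is a principal connection 1-form $\gamma\in\Omega^1(P)$ (real-valued) with $\delta\gamma=0$. A curving for $\gamma$ is $B\in\Omega^2(X)$ with $\delta B=d\gamma$. The 3-curvature is the $\chi\in\Omega^3(M)$ with $\pi^*\chi=dB$. **Multiplicative vector fields.** A multiplicative vector field on $P\rightrightarrows X$ is a pair $(\mathbf x,\mathbf p)\in\mathfrak X(X)\times\mathfrak X(P)$ forming a functor from $P\rightrightarrows X$ to $TP\rightrightarrows TX$; such an $\mathbf x$ projects to a vector field $x$ on $M$. Let $A_P=\ker ds|_X$ be the Lie algebroid. For $a\in\Gamma(A_P)$ put $\mathbf a=dt(a)$, $\overrightarrow a(p)=dR_p(a(t(p)))$, $\overleftarrow a(p)=d(L_p\circ i)(a(s(p)))$ ($i$ = inversion), $\bar{\mathbf a}=\overrightarrow a+\overleftarrow a$, and $\mathsf v_a=\epsilon^*(\iota_{\overrightarrow a}\gamma)$. $\mathbb X(\mathcal G,\gamma)$ is the strict Lie 2-algebra with degree-1 part $\Gamma(A_P)$, degree-0 part $\mathbb X(\mathcal G,\gamma)_0=\{(\mathbf x,\mathbf p,\alpha): (\mathbf x,\mathbf p)\text{ multiplicative},\ \alpha\in\Omega^1(X),\ L_{\mathbf p}\gamma=\delta\alpha\}$,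 differential $\mathsf d a=(\mathbf a,\bar{\mathbf a},\iota_{\mathbf a}B-d\mathsf v_a)$ (the same for every curving), brackets $[(\mathbf x,\mathbf p,\alpha),(\mathbf z,\mathbf r,\beta)]=([\mathbf x,\mathbf z],[\mathbf p,\mathbf r],L_{\mathbf x}\beta-L_{\mathbf z}\alpha)$ and $[(\mathbf x,\mathbf p,\alpha),a]=[\mathbf p,\overrightarrow a]|_X$. **The Courant Lie 2-algebra $\mathbb L(C_\chi)$**: complex $C^\infty(M)\to\Gamma(TM\oplus T^*M)$, $\mathsf d f=(0,df)$, brackets $[(u,\alpha),(v,\beta)]=([u,v],L_u\beta-L_v\alpha-\frac12d(\iota_u\beta-\iota_v\alpha)-\iota_v\iota_u\chi)$ and $[(u,\alpha),f]=\frac12\iota_udf$, Jacobiator $-\frac16(\langle[e_1,e_2],e_3\rangle^++\text{cyc.})$ with $\langle(u,\alpha),(v,\beta)\rangle^+=\iota_u\beta+\iota_v\alpha$. **The butterfly $\mathsf F$ determined by a curving $B$**: $F=\{(\mathbf x,\mathbf p,\alpha;g)\in\mathbb X(\mathcal G,\gamma)_0\times C^\infty(X):\delta g=\iota_{\mathbf p}\gamma\}$, with bracket of $(\mathbf x,\mathbf p,\alpha;g)$ and $(\mathbf z,\mathbf r,\beta;h)$ having first part that of $\mathbb X(\mathcal G,\gamma)_0$ and function part $\frac12(\iota_{\mathbf x}(\beta+dh)-\iota_{\mathbf z}(\alpha+dg))$; $\sigma$ is the projection to $\mathbb X(\mathcal G,\gamma)_0$; $\rho(\mathbf x,\mathbf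 p,\alpha;g)=(x,-\varepsilon)$ with $\pi^*\varepsilon=\alpha-\iota_{\mathbf x}B-dg$; $\lambda(f)=(0,0,0;\pi^*f)$; $\kappa(a)=(\mathsf d a;-\mathsf v_a)$. The butterfly $\mathsf F'$ is obtained by replacing $B$ with $B'$ in the definition of $\rho$. *)

theory Defs
  imports "HOL-Analysis.Analysis" "HOL-Library.Function_Algebras"
begin

section \<open>Model spaces\<close>

text \<open>Manifolds are modelled on finite-dimensional Euclidean vector spaces. The library class
  \<open>euclidean_space\<close> demands positive dimension and would exclude zero-dimensional manifolds, hence
  the following class.\<close>

class finite_dim_inner = real_inner +
  assumes finite_spanning: "\<exists>S. finite S \<and> (\<forall>x. \<exists>r. x = (\<Sum>b\<in>S. r b *\<^sub>R b))"

lemma finite_dim_span: "\<exists>S::'a::finite_dim_inner set. finite S \<and> span S = UNIV"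
proof -
  obtain S :: "'a set" where S: "finite S" "\<And>x. \<exists>r. x = (\<Sum>b\<in>S. r b *\<^sub>R b)"
    using finite_spanning by blast
  then have "span S = UNIV" by (auto simp: span_finite)
  with S show ?thesis by blast
qed

instance euclidean_space \<subseteq> finite_dim_inner
proof
  show "\<exists>S. finite S \<and> (\<forall>x::'a. \<exists>r. x = (\<Sum>b\<in>S. r b *\<^sub>R b))"
    by (metis finite_Basis euclidean_representation)
qed

instance prod :: (finite_dim_inner, finite_dim_inner) finite_dim_inner
proof
  obtain S :: "'a set" where S: "finite S" "span S = UNIV"
    using finite_dim_span by blast
  obtain T :: "'b set" where T: "finite T" "span T = UNIV"
    using finite_dim_span by blast
  let ?U = "(\<lambda>x. (x, 0::'b)) ` S \<union> (\<lambda>y. (0::'a, y)) ` T"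
  have l1: "linear (\<lambda>x::'a. (x, 0::'b))" and l2: "linear (\<lambda>y::'b. (0::'a, y))"
    by (auto intro!: linearI)
  have "z \<in> span ?U" for z :: "'a \<times> 'b"
  proof -
    have "(fst z, 0) \<in> span ((\<lambda>x. (x, 0::'b)) ` S)"
      unfolding linear_span_image [OF l1] by (simp add: S)
    moreover have "(0, snd z) \<in> span ((\<lambda>y. (0::'a, y)) ` T)"
      unfolding linear_span_image [OF l2] by (simp add: T)
    ultimately have "(fst z, 0) + (0, snd z) \<in> span ?U"
      by (meson span_add span_mono in_mono sup_ge1 sup_ge2)
    then show ?thesis by simp
  qed
  moreover have "finite ?U" using S T by simp
  ultimately have "\<exists>r. z = (\<Sum>b\<in>?U. r b *\<^sub>R b)" for z :: "'a \<times> 'b"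
    using span_finite [OF \<open>finite ?U\<close>] by (metis (no_types, lifting) imageE)
  with \<open>finite ?U\<close> show "\<exists>S. finite S \<and> (\<forall>z::'a \<times> 'b. \<exists>r. z = (\<Sum>b\<in>S. r b *\<^sub>R b))"
    by blast
qed

instantiation "fun" :: (type, real_vector) real_vector
begin

definition scaleR_fun :: "real \<Rightarrow> ('a \<Rightarrow> 'b) \<Rightarrow> 'a \<Rightarrow> 'b"
  where "scaleR_fun r f = (\<lambda>x. r *\<^sub>R f x)"

instance
  by standard (auto simp: scaleR_fun_def fun_eq_iff scaleR_add_left scaleR_add_right)

end

primrec Ck_on :: "nat \<Rightarrow> 'a::real_normed_vector set \<Rightarrow> ('a \<Rightarrow> 'b::real_normed_vector) \<Rightarrow> bool"
  where
    "Ck_on 0 = (\<lambda>S f. continuous_on S f)"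
  | "Ck_on (Suc k) = (\<lambda>S f. (\<forall>x\<in>S. f differentiable (at x)) \<and>
       (\<forall>v. Ck_on k S (\<lambda>x. frechet_derivative f (at x) v)))"

text \<open>Only used for open \<open>S\<close> in a finite-dimensional space.\<close>

definition smooth_on :: "'a::real_normed_vector set \<Rightarrow> ('a \<Rightarrow> 'b::real_normed_vector) \<Rightarrow> bool"
  where "smooth_on S f \<longleftrightarrow> (\<forall>k. Ck_on k S f)"


section \<open>Manifolds\<close>

type_synonym ('m, 'e) chart = "'m set \<times> ('m \<Rightarrow> 'e)"

definition chart_inv :: "('m, 'e) chart \<Rightarrow> 'e \<Rightarrow> 'm"
  where "chart_inv c = inv_into (fst c) (snd c)"

text \<open>Besides an atlas we record, for each point \<open>p\<close>, one chart \<open>chart_at p\<close> of the atlas around \<open>p\<close>.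
  The tangent space at \<open>p\<close> is the model space \<open>'e\<close>, a vector \<open>v\<close> standing for the tangent vector with
  components \<open>v\<close> in the chart \<open>chart_at p\<close>. Thus vector fields are functions
  \<open>'m \<Rightarrow> 'e\<close>, and \<open>1\<close>-forms are functions \<open>'m \<Rightarrow> 'e \<Rightarrow> real\<close>, and so on. The
  choice of \<open>chart_at\<close> is immaterial: different choices give canonically isomorphic tangent spaces.\<close>

record ('m, 'e) manifold =
  charts :: "('m, 'e) chart set"
  chart_at :: "'m \<Rightarrow> ('m, 'e) chart"

definition smooth_manifold ::
    "('m::{t2_space, second_countable_topology}, 'e::finite_dim_inner) manifold \<Rightarrow> bool"
  where "smooth_manifold M \<longleftrightarrow>
    (\<forall>p. chart_at M p \<in> charts M \<and> p \<in> fst (chart_at M p)) \<and>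
    (\<forall>c\<in>charts M. open (fst c) \<and> open (snd c ` fst c) \<and>
       homeomorphism (fst c) (snd c ` fst c) (snd c) (chart_inv c)) \<and>
    (\<forall>c\<in>charts M. \<forall>d\<in>charts M. smooth_on (snd c ` (fst c \<inter> fst d)) (snd d \<circ> chart_inv c))"

definition vec_manifold :: "('e::finite_dim_inner, 'e) manifold"
  where "vec_manifold = \<lparr>charts = {(UNIV, \<lambda>x. x)}, chart_at = (\<lambda>_. (UNIV, \<lambda>x. x))\<rparr>"

definition prod_chart :: "('m, 'e) chart \<Rightarrow> ('n, 'f) chart \<Rightarrow> ('m \<times> 'n, 'e \<times> 'f) chart"
  where "prod_chart c d = (fst c \<times> fst d, map_prod (snd c) (snd d))"

definition prod_manifold ::
    "('m, 'e) manifold \<Rightarrow> ('n, 'f) manifold \<Rightarrow> ('m \<times> 'n, 'e \<times> 'f) manifold"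
  where "prod_manifold M N =
    \<lparr>charts = {prod_chart c d | c d. c \<in> charts M \<and> d \<in> charts N},
     chart_at = (\<lambda>(p, q). prod_chart (chart_at M p) (chart_at N q))\<rparr>"

definition smooth_map_on ::
    "('n::topological_space, 'f::finite_dim_inner) manifold \<Rightarrow>
     ('m::topological_space, 'e::finite_dim_inner) manifold \<Rightarrow> 'n set \<Rightarrow> ('n \<Rightarrow> 'm) \<Rightarrow> bool"
  where "smooth_map_on N M U f \<longleftrightarrow> open U \<and> continuous_on U f \<and>
    (\<forall>c\<in>charts N. \<forall>d\<in>charts M.
       smooth_on (snd c ` (fst c \<inter> U \<inter> f -` fst d)) (snd d \<circ> f \<circ> chart_inv c))"

abbreviation smooth_map ::
    "('n::topological_space, 'f::finite_dim_inner) manifold \<Rightarrow>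
     ('m::topological_space, 'e::finite_dim_inner) manifold \<Rightarrow> ('n \<Rightarrow> 'm) \<Rightarrow> bool"
  where "smooth_map N M f \<equiv> smooth_map_on N M UNIV f"

definition smooth_funs :: "('m::topological_space, 'e::finite_dim_inner) manifold \<Rightarrow> ('m \<Rightarrow> real) set"
  where "smooth_funs M = {f. smooth_map M vec_manifold f}"

text \<open>The differential of \<open>f\<close> at \<open>p\<close>, from the tangent space at \<open>p\<close> to the one at \<open>f p\<close>.\<close>

definition tmap ::
    "('n, 'f::real_normed_vector) manifold \<Rightarrow> ('m, 'e::real_normed_vector) manifold \<Rightarrow>
     ('n \<Rightarrow> 'm) \<Rightarrow> 'n \<Rightarrow> 'f \<Rightarrow> 'e"
  where "tmap N M f p v =
    frechet_derivative (snd (chart_at M (f p)) \<circ> f \<circ> chart_inv (chart_at N p))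
      (at (snd (chart_at N p) p)) v"

definition surjective_submersion ::
    "('n::topological_space, 'f::finite_dim_inner) manifold \<Rightarrow>
     ('m::topological_space, 'e::finite_dim_inner) manifold \<Rightarrow> ('n \<Rightarrow> 'm) \<Rightarrow> bool"
  where "surjective_submersion N M f \<longleftrightarrow>
    smooth_map N M f \<and> surj f \<and> (\<forall>p. surj (tmap N M f p))"

text \<open>Smooth maps defined on an embedded submanifold \<open>S\<close> are those that extend smoothly to a
  neighbourhood of each point. The value of \<open>tmap_sub\<close> is independent of the extension (and only
  meaningful) for vectors tangent to \<open>S\<close>.\<close>

definition local_extension ::
    "('n::topological_space, 'f::finite_dim_inner) manifold \<Rightarrow>
     ('m::topological_space, 'e::finite_dim_inner) manifold \<Rightarrow>
     'n set \<Rightarrow> ('n \<Rightarrow> 'm) \<Rightarrow> 'n \<Rightarrow> ('n \<Rightarrow> 'm) \<Rightarrow> bool"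
  where "local_extension N M S f p g \<longleftrightarrow>
    (\<exists>U. p \<in> U \<and> smooth_map_on N M U g \<and> (\<forall>q\<in>U \<inter> S. g q = f q))"

definition smooth_map_sub ::
    "('n::topological_space, 'f::finite_dim_inner) manifold \<Rightarrow>
     ('m::topological_space, 'e::finite_dim_inner) manifold \<Rightarrow> 'n set \<Rightarrow> ('n \<Rightarrow> 'm) \<Rightarrow> bool"
  where "smooth_map_sub N M S f \<longleftrightarrow> (\<forall>p\<in>S. \<exists>g. local_extension N M S f p g)"

definition tmap_sub ::
    "('n::topological_space, 'f::finite_dim_inner) manifold \<Rightarrow>
     ('m::topological_space, 'e::finite_dim_inner) manifold \<Rightarrow>
     'n set \<Rightarrow> ('n \<Rightarrow> 'm) \<Rightarrow> 'n \<Rightarrow> 'f \<Rightarrow> 'e"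
  where "tmap_sub N M S f p v =
    (THE w. \<exists>g. local_extension N M S f p g \<and> w = tmap N M g p v)"


section \<open>Vector fields and differential forms\<close>

text \<open>Components of tangent vectors at \<open>p\<close> in the chart \<open>c\<close>, and back.\<close>

definition to_chart ::
    "('m, 'e::real_normed_vector) manifold \<Rightarrow> ('m, 'e) chart \<Rightarrow> 'm \<Rightarrow> 'e \<Rightarrow> 'e"
  where "to_chart M c p v =
    frechet_derivative (snd c \<circ> chart_inv (chart_at M p)) (at (snd (chart_at M p) p)) v"

definition from_chart ::
    "('m, 'e::real_normed_vector) manifold \<Rightarrow> ('m, 'e) chart \<Rightarrow> 'm \<Rightarrow> 'e \<Rightarrow> 'e"
  where "from_chart M c p v =
    frechet_derivative (snd (chart_at M p) \<circ> chart_inv c) (at (snd c p)) v"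

text \<open>Smooth sections of the pullback of \<open>TM\<close> along \<open>f : N \<rightarrow> M\<close>.\<close>

definition vec_fields_along ::
    "('n::topological_space, 'f::finite_dim_inner) manifold \<Rightarrow>
     ('m::topological_space, 'e::finite_dim_inner) manifold \<Rightarrow> ('n \<Rightarrow> 'm) \<Rightarrow> ('n \<Rightarrow> 'e) set"
  where "vec_fields_along N M f = {X. \<forall>c\<in>charts N. \<forall>d\<in>charts M.
    smooth_on (snd c ` (fst c \<inter> f -` fst d))
      (\<lambda>y. to_chart M d (f (chart_inv c y)) (X (chart_inv c y)))}"

definition vec_fields ::
    "('m::topological_space, 'e::finite_dim_inner) manifold \<Rightarrow> ('m \<Rightarrow> 'e) set"
  where "vec_fields M = vec_fields_along M M (\<lambda>p. p)"

definition vec_rep ::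
    "('m, 'e::real_normed_vector) manifold \<Rightarrow> ('m, 'e) chart \<Rightarrow> ('m \<Rightarrow> 'e) \<Rightarrow> 'e \<Rightarrow> 'e"
  where "vec_rep M c X y = to_chart M c (chart_inv c y) (X (chart_inv c y))"

definition form1_rep ::
    "('m, 'e::real_normed_vector) manifold \<Rightarrow> ('m, 'e) chart \<Rightarrow> ('m \<Rightarrow> 'e \<Rightarrow> real) \<Rightarrow>
     'e \<Rightarrow> 'e \<Rightarrow> real"
  where "form1_rep M c \<omega> y v =
    (let p = chart_inv c y; T = from_chart M c p in \<omega> p (T v))"

definition form2_rep ::
    "('m, 'e::real_normed_vector) manifold \<Rightarrow> ('m, 'e) chart \<Rightarrow> ('m \<Rightarrow> 'e \<Rightarrow> 'e \<Rightarrow> real) \<Rightarrow>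
     'e \<Rightarrow> 'e \<Rightarrow> 'e \<Rightarrow> real"
  where "form2_rep M c \<omega> y u v =
    (let p = chart_inv c y; T = from_chart M c p in \<omega> p (T u) (T v))"

definition form3_rep ::
    "('m, 'e::real_normed_vector) manifold \<Rightarrow> ('m, 'e) chart \<Rightarrow>
     ('m \<Rightarrow> 'e \<Rightarrow> 'e \<Rightarrow> 'e \<Rightarrow> real) \<Rightarrow> 'e \<Rightarrow> 'e \<Rightarrow> 'e \<Rightarrow> 'e \<Rightarrow> real"
  where "form3_rep M c \<omega> y u v w =
    (let p = chart_inv c y; T = from_chart M c p in \<omega> p (T u) (T v) (T w))"

definition forms1 :: "('m, 'e::finite_dim_inner) manifold \<Rightarrow> ('m \<Rightarrow> 'e \<Rightarrow> real) set"
  where "forms1 M = {\<omega>. (\<forall>p. linear (\<omega> p)) \<and>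
    (\<forall>c\<in>charts M. \<forall>v. smooth_on (snd c ` fst c) (\<lambda>y. form1_rep M c \<omega> y v))}"

definition forms2 :: "('m, 'e::finite_dim_inner) manifold \<Rightarrow> ('m \<Rightarrow> 'e \<Rightarrow> 'e \<Rightarrow> real) set"
  where "forms2 M = {\<omega>.
    (\<forall>p u. linear (\<lambda>v. \<omega> p v u) \<and> linear (\<lambda>v. \<omega> p u v)) \<and>
    (\<forall>p u. \<omega> p u u = 0) \<and>
    (\<forall>c\<in>charts M. \<forall>u v. smooth_on (snd c ` fst c) (\<lambda>y. form2_rep M c \<omega> y u v))}"

definition forms3 :: "('m, 'e::finite_dim_inner) manifold \<Rightarrow> ('m \<Rightarrow> 'e \<Rightarrow> 'e \<Rightarrow> 'e \<Rightarrow> real) set"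
  where "forms3 M = {\<omega>.
    (\<forall>p u w. linear (\<lambda>v. \<omega> p v u w) \<and> linear (\<lambda>v. \<omega> p u v w) \<and> linear (\<lambda>v. \<omega> p u w v)) \<and>
    (\<forall>p u v. \<omega> p u u v = 0 \<and> \<omega> p u v v = 0 \<and> \<omega> p u v u = 0) \<and>
    (\<forall>c\<in>charts M. \<forall>u v w. smooth_on (snd c ` fst c) (\<lambda>y. form3_rep M c \<omega> y u v w))}"

definition pull1 ::
    "('n, 'f::real_normed_vector) manifold \<Rightarrow> ('m, 'e::real_normed_vector) manifold \<Rightarrow>
     ('n \<Rightarrow> 'm) \<Rightarrow> ('m \<Rightarrow> 'e \<Rightarrow> real) \<Rightarrow> 'n \<Rightarrow> 'f \<Rightarrow> real"
  where "pull1 N M f \<omega> = (\<lambda>p u. \<omega> (f p) (tmap N M f p u))"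

definition pull2 ::
    "('n, 'f::real_normed_vector) manifold \<Rightarrow> ('m, 'e::real_normed_vector) manifold \<Rightarrow>
     ('n \<Rightarrow> 'm) \<Rightarrow> ('m \<Rightarrow> 'e \<Rightarrow> 'e \<Rightarrow> real) \<Rightarrow> 'n \<Rightarrow> 'f \<Rightarrow> 'f \<Rightarrow> real"
  where "pull2 N M f \<omega> = (\<lambda>p u v. \<omega> (f p) (tmap N M f p u) (tmap N M f p v))"

definition pull3 ::
    "('n, 'f::real_normed_vector) manifold \<Rightarrow> ('m, 'e::real_normed_vector) manifold \<Rightarrow>
     ('n \<Rightarrow> 'm) \<Rightarrow> ('m \<Rightarrow> 'e \<Rightarrow> 'e \<Rightarrow> 'e \<Rightarrow> real) \<Rightarrow> 'n \<Rightarrow> 'f \<Rightarrow> 'f \<Rightarrow> 'f \<Rightarrow> real"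
  where "pull3 N M f \<omega> =
    (\<lambda>p u v w. \<omega> (f p) (tmap N M f p u) (tmap N M f p v) (tmap N M f p w))"

text \<open>Contractions \<open>\<iota>\<^sub>X\<close>.\<close>

definition contr1 :: "('m \<Rightarrow> 'e) \<Rightarrow> ('m \<Rightarrow> 'e \<Rightarrow> real) \<Rightarrow> 'm \<Rightarrow> real"
  where "contr1 X \<omega> = (\<lambda>p. \<omega> p (X p))"

definition contr2 :: "('m \<Rightarrow> 'e) \<Rightarrow> ('m \<Rightarrow> 'e \<Rightarrow> 'e \<Rightarrow> real) \<Rightarrow> 'm \<Rightarrow> 'e \<Rightarrow> real"
  where "contr2 X \<omega> = (\<lambda>p. \<omega> p (X p))"

definition contr3 ::
    "('m \<Rightarrow> 'e) \<Rightarrow> ('m \<Rightarrow> 'e \<Rightarrow> 'e \<Rightarrow> 'e \<Rightarrow> real) \<Rightarrow> 'm \<Rightarrow> 'e \<Rightarrow> 'e \<Rightarrow> real"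
  where "contr3 X \<omega> = (\<lambda>p. \<omega> p (X p))"

text \<open>Exterior derivative, Lie bracket and Lie derivative at \<open>p\<close> are given by the usual coordinate
  formulas, evaluated in the chart \<open>c = chart_at p\<close>; in that chart the components of a tangent
  vector \<open>v\<close> at \<open>p\<close> are \<open>v\<close> itself. On vector fields they amount to
  \<open>d\<omega>(X,Y) = X(\<omega>(Y)) - Y(\<omega>(X)) - \<omega>([X,Y])\<close> (no factor \<open>1/2\<close>; similarly for \<open>2\<close>-forms),
  \<open>[X,Y]f = X(Yf) - Y(Xf)\<close> and \<open>(L\<^sub>X\<omega>)(Y) = X(\<omega>(Y)) - \<omega>([X,Y])\<close>.\<close>

definition d0 :: "('m, 'e::real_normed_vector) manifold \<Rightarrow> ('m \<Rightarrow> real) \<Rightarrow> 'm \<Rightarrow> 'e \<Rightarrow> real"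
  where "d0 M f p v = frechet_derivative (f \<circ> chart_inv (chart_at M p)) (at (snd (chart_at M p) p)) v"

definition d1 ::
    "('m, 'e::real_normed_vector) manifold \<Rightarrow> ('m \<Rightarrow> 'e \<Rightarrow> real) \<Rightarrow> 'm \<Rightarrow> 'e \<Rightarrow> 'e \<Rightarrow> real"
  where "d1 M \<omega> p u v =
    (let c = chart_at M p; D = (\<lambda>g. frechet_derivative g (at (snd c p))) in
      D (\<lambda>y. form1_rep M c \<omega> y v) u - D (\<lambda>y. form1_rep M c \<omega> y u) v)"

definition d2 ::
    "('m, 'e::real_normed_vector) manifold \<Rightarrow> ('m \<Rightarrow> 'e \<Rightarrow> 'e \<Rightarrow> real) \<Rightarrow>
     'm \<Rightarrow> 'e \<Rightarrow> 'e \<Rightarrow> 'e \<Rightarrow> real"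
  where "d2 M \<omega> p u v w =
    (let c = chart_at M p; D = (\<lambda>g. frechet_derivative g (at (snd c p))) in
      D (\<lambda>y. form2_rep M c \<omega> y v w) u - D (\<lambda>y. form2_rep M c \<omega> y u w) v
      + D (\<lambda>y. form2_rep M c \<omega> y u v) w)"

definition lie_bracket ::
    "('m, 'e::real_normed_vector) manifold \<Rightarrow> ('m \<Rightarrow> 'e) \<Rightarrow> ('m \<Rightarrow> 'e) \<Rightarrow> 'm \<Rightarrow> 'e"
  where "lie_bracket M X Y p =
    (let c = chart_at M p in
      frechet_derivative (vec_rep M c Y) (at (snd c p)) (X p)
      - frechet_derivative (vec_rep M c X) (at (snd c p)) (Y p))"

definition lie_deriv1 ::
    "('m, 'e::real_normed_vector) manifold \<Rightarrow> ('m \<Rightarrow> 'e) \<Rightarrow> ('m \<Rightarrow> 'e \<Rightarrow> real) \<Rightarrow>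
     'm \<Rightarrow> 'e \<Rightarrow> real"
  where "lie_deriv1 M X \<omega> p v =
    (let c = chart_at M p in
      frechet_derivative (\<lambda>y. form1_rep M c \<omega> y v) (at (snd c p)) (X p)
      + \<omega> p (frechet_derivative (vec_rep M c X) (at (snd c p)) v))"


section \<open>Lie 2-algebras and butterflies\<close>

text \<open>The records below carry the data only; that the concrete data defined later satisfy the axioms
  of Lie 2-algebras and (invertible) butterflies is not assumed anywhere. Vector spaces have explicit
  operations because the composite of butterflies is a quotient.\<close>

record 'v vspace =
  vcarrier :: "'v set"
  vadd :: "'v \<Rightarrow> 'v \<Rightarrow> 'v"
  vscale :: "real \<Rightarrow> 'v \<Rightarrow> 'v"
  vzero :: 'v

definition vsub :: "'v vspace \<Rightarrow> 'v \<Rightarrow> 'v \<Rightarrow> 'v"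
  where "vsub V a b = vadd V a (vscale V (-1) b)"

definition subspace_vspace :: "'v::real_vector set \<Rightarrow> 'v vspace"
  where "subspace_vspace S = \<lparr>vcarrier = S, vadd = (+), vscale = (*\<^sub>R), vzero = 0\<rparr>"

definition dsum_vspace :: "'v vspace \<Rightarrow> 'w vspace \<Rightarrow> ('v \<times> 'w) vspace"
  where "dsum_vspace V W =
    \<lparr>vcarrier = vcarrier V \<times> vcarrier W,
     vadd = (\<lambda>(a, b) (a', b'). (vadd V a a', vadd W b b')),
     vscale = (\<lambda>r (a, b). (vscale V r a, vscale W r b)),
     vzero = (vzero V, vzero W)\<rparr>"

record ('a, 'b) lie2_algebra =
  deg0 :: "'a vspace"
  deg1 :: "'b vspace"
  bd :: "'b \<Rightarrow> 'a"
  br0 :: "'a \<Rightarrow> 'a \<Rightarrow> 'a"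
  br1 :: "'a \<Rightarrow> 'b \<Rightarrow> 'b"
  jac :: "'a \<Rightarrow> 'a \<Rightarrow> 'a \<Rightarrow> 'b"

text \<open>Data of a butterfly from a Lie 2-algebra with parts \<open>'v0\<close>, \<open>'v1\<close> to one with parts
  \<open>'w0\<close>, \<open>'w1\<close>.\<close>

record ('v0, 'v1, 'w0, 'w1, 'k) butterfly =
  total :: "'k vspace"
  brak :: "'k \<Rightarrow> 'k \<Rightarrow> 'k"
  kap :: "'v1 \<Rightarrow> 'k"
  lam :: "'w1 \<Rightarrow> 'k"
  sig :: "'k \<Rightarrow> 'v0"
  rho :: "'k \<Rightarrow> 'w0"

definition butterfly_iso ::
    "('v0, 'v1) lie2_algebra \<Rightarrow> ('w0, 'w1) lie2_algebra \<Rightarrow>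
     ('v0, 'v1, 'w0, 'w1, 'k) butterfly \<Rightarrow> ('v0, 'v1, 'w0, 'w1, 'l) butterfly \<Rightarrow>
     ('k \<Rightarrow> 'l) \<Rightarrow> bool"
  where "butterfly_iso V W E E' \<Phi> \<longleftrightarrow>
    bij_betw \<Phi> (vcarrier (total E)) (vcarrier (total E')) \<and>
    (\<forall>a\<in>vcarrier (total E). \<forall>b\<in>vcarrier (total E).
       \<Phi> (vadd (total E) a b) = vadd (total E') (\<Phi> a) (\<Phi> b)) \<and>
    (\<forall>r. \<forall>a\<in>vcarrier (total E). \<Phi> (vscale (total E) r a) = vscale (total E') r (\<Phi> a)) \<and>
    (\<forall>a\<in>vcarrier (total E). \<forall>b\<in>vcarrier (total E).
       \<Phi> (brak E a b) = brak E' (\<Phi> a) (\<Phi> b)) \<and>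
    (\<forall>v\<in>vcarrier (deg1 V). \<Phi> (kap E v) = kap E' v) \<and>
    (\<forall>w\<in>vcarrier (deg1 W). \<Phi> (lam E w) = lam E' w) \<and>
    (\<forall>a\<in>vcarrier (total E). sig E' (\<Phi> a) = sig E a) \<and>
    (\<forall>a\<in>vcarrier (total E). rho E' (\<Phi> a) = rho E a)"

definition strict_butterfly ::
    "('v0, 'v1) lie2_algebra \<Rightarrow> ('w0, 'w1) lie2_algebra \<Rightarrow> ('v0 \<Rightarrow> 'w0) \<Rightarrow> ('v1 \<Rightarrow> 'w1) \<Rightarrow>
     ('v0, 'v1, 'w0, 'w1, 'w1 \<times> 'v0) butterfly"
  where "strict_butterfly V W f0 f1 =
    \<lparr>total = dsum_vspace (deg1 W) (deg0 V),
     brak = (\<lambda>(w, x) (w', x').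
       (vadd (deg1 W) (vsub (deg1 W) (br1 W (f0 x) w') (br1 W (f0 x') w)) (br1 W (bd W w) w'),
        br0 V x x')),
     kap = (\<lambda>v. (vscale (deg1 W) (-1) (f1 v), bd V v)),
     lam = (\<lambda>w. (w, vzero (deg0 V))),
     sig = (\<lambda>(w, x). x),
     rho = (\<lambda>(w, x). vadd (deg0 W) (bd W w) (f0 x))\<rparr>"

text \<open>The composite of \<open>E : V \<rightarrow> W\<close> and \<open>E' : W \<rightarrow> U\<close>. Elements are cosets; operations and maps
  on cosets are induced by those on representatives.\<close>

definition comp_coset ::
    "('w0, 'w1) lie2_algebra \<Rightarrow> ('v0, 'v1, 'w0, 'w1, 'k) butterfly \<Rightarrow>
     ('w0, 'w1, 'u0, 'u1, 'l) butterfly \<Rightarrow> 'k \<times> 'l \<Rightarrow> ('k \<times> 'l) set"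
  where "comp_coset W E E' a =
    (\<lambda>w. vadd (dsum_vspace (total E) (total E')) a (lam E w, kap E' w)) ` vcarrier (deg1 W)"

definition butterfly_comp ::
    "('w0, 'w1) lie2_algebra \<Rightarrow> ('w0, 'w1, 'u0, 'u1, 'l) butterfly \<Rightarrow>
     ('v0, 'v1, 'w0, 'w1, 'k) butterfly \<Rightarrow> ('v0, 'v1, 'u0, 'u1, ('k \<times> 'l) set) butterfly"
  where "butterfly_comp W E' E =
    (let Q = comp_coset W E E'; S = dsum_vspace (total E) (total E') in
     \<lparr>total =
        \<lparr>vcarrier = Q ` {(e, e') \<in> vcarrier S. rho E e = sig E' e'},
         vadd = (\<lambda>A B. \<Union>a\<in>A. \<Union>b\<in>B. Q (vadd S a b)),
         vscale = (\<lambda>r A. \<Union>a\<in>A. Q (vscale S r a)),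
         vzero = Q (vzero S)\<rparr>,
      brak = (\<lambda>A B. \<Union>(e, e')\<in>A. \<Union>(f, f')\<in>B. Q (brak E e f, brak E' e' f')),
      kap = (\<lambda>v. Q (kap E v, vzero (total E'))),
      lam = (\<lambda>u. Q (vzero (total E), lam E' u)),
      sig = (\<lambda>A. THE x. \<exists>(e, e')\<in>A. x = sig E e),
      rho = (\<lambda>A. THE y. \<exists>(e, e')\<in>A. y = rho E' e')\<rparr>)"


section \<open>Bundle gerbes\<close>

record ('m, 'em, 'x, 'ex, 'p, 'ep) gerbe =
  base :: "('m, 'em) manifold"
  objs :: "('x, 'ex) manifold"
  arrs :: "('p, 'ep) manifold"
  proj :: "'x \<Rightarrow> 'm"
  src :: "'p \<Rightarrow> 'x"
  tgt :: "'p \<Rightarrow> 'x"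
  mult :: "'p \<Rightarrow> 'p \<Rightarrow> 'p"
  unit_map :: "'x \<Rightarrow> 'p"
  invs :: "'p \<Rightarrow> 'p"
  act :: "complex \<Rightarrow> 'p \<Rightarrow> 'p"

definition composable :: "('m, 'em, 'x, 'ex, 'p, 'ep) gerbe \<Rightarrow> ('p \<times> 'p) set"
  where "composable G = {(p, q). src G p = tgt G q}"

definition fibre_prod :: "('m, 'em, 'x, 'ex, 'p, 'ep) gerbe \<Rightarrow> ('x \<times> 'x) set"
  where "fibre_prod G = {(x1, x2). proj G x1 = proj G x2}"

definition lie_groupoid ::
    "('m, 'em, 'x::{t2_space, second_countable_topology}, 'ex::finite_dim_inner,
      'p::{t2_space, second_countable_topology}, 'ep::finite_dim_inner) gerbe \<Rightarrow> bool"
  where "lie_groupoid G \<longleftrightarrow>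
    smooth_manifold (objs G) \<and> smooth_manifold (arrs G) \<and>
    surjective_submersion (arrs G) (objs G) (src G) \<and>
    surjective_submersion (arrs G) (objs G) (tgt G) \<and>
    smooth_map_sub (prod_manifold (arrs G) (arrs G)) (arrs G) (composable G)
      (\<lambda>(p, q). mult G p q) \<and>
    smooth_map (objs G) (arrs G) (unit_map G) \<and>
    smooth_map (arrs G) (arrs G) (invs G) \<and>
    (\<forall>p q. src G p = tgt G q \<longrightarrow>
       src G (mult G p q) = src G q \<and> tgt G (mult G p q) = tgt G p) \<and>
    (\<forall>p q r. src G p = tgt G q \<and> src G q = tgt G r \<longrightarrow>
       mult G (mult G p q) r = mult G p (mult G q r)) \<and>
    (\<forall>x. src G (unit_map G x) = x \<and> tgt G (unit_map G x) = x) \<and>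
    (\<forall>p. mult G p (unit_map G (src G p)) = p \<and> mult G (unit_map G (tgt G p)) p = p) \<and>
    (\<forall>p. src G (invs G p) = tgt G p \<and> tgt G (invs G p) = src G p \<and>
       mult G p (invs G p) = unit_map G (tgt G p) \<and>
       mult G (invs G p) p = unit_map G (src G p))"

text \<open>The circle is the unit circle in \<open>\<complex>\<close>. Smoothness of the action is expressed through the
  covering \<open>cis : \<real> \<rightarrow> S\<^sup>1\<close>. Local trivialisations over \<open>U\<close> are the equivariant diffeomorphisms
  \<open>(b, z) \<mapsto> act z (\<eta> b)\<close> with inverse \<open>p \<mapsto> ((tgt p, src p), \<zeta> p)\<close>.\<close>

definition principal_circle_bundle ::
    "('m, 'em, 'x::{t2_space, second_countable_topology}, 'ex::finite_dim_inner,
      'p::{t2_space, second_countable_topology}, 'ep::finite_dim_inner) gerbe \<Rightarrow> bool"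
  where "principal_circle_bundle G \<longleftrightarrow>
    (\<forall>p. act G 1 p = p) \<and>
    (\<forall>z w p. cmod z = 1 \<and> cmod w = 1 \<longrightarrow> act G (z * w) p = act G z (act G w p)) \<and>
    smooth_map (prod_manifold vec_manifold (arrs G)) (arrs G) (\<lambda>(\<theta>::real, p). act G (cis \<theta>) p) \<and>
    range (\<lambda>p. (tgt G p, src G p)) = fibre_prod G \<and>
    (\<forall>p p'. (tgt G p', src G p') = (tgt G p, src G p) \<longleftrightarrow> (\<exists>z. cmod z = 1 \<and> p' = act G z p)) \<and>
    (\<forall>z p. cmod z = 1 \<and> act G z p = p \<longrightarrow> z = 1) \<and>
    (\<forall>b\<in>fibre_prod G. \<exists>U \<eta> \<zeta>. open U \<and> b \<in> U \<and>
       smooth_map_sub (prod_manifold (objs G) (objs G)) (arrs G) (U \<inter> fibre_prod G) \<eta> \<and>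
       (\<forall>b'\<in>U \<inter> fibre_prod G. (tgt G (\<eta> b'), src G (\<eta> b')) = b') \<and>
       smooth_map_on (arrs G) (vec_manifold :: (complex, complex) manifold)
         {p. (tgt G p, src G p) \<in> U} \<zeta> \<and>
       (\<forall>p. (tgt G p, src G p) \<in> U \<longrightarrow>
          cmod (\<zeta> p) = 1 \<and> p = act G (\<zeta> p) (\<eta> (tgt G p, src G p))))"

text \<open>A morphism over the identity from \<open>P\<close> to the submersion groupoid is necessarily
  \<open>p \<mapsto> (tgt p, src p)\<close>; it exists iff \<open>P\<close> lies over the fibre product, which is part of
  \<open>principal_circle_bundle\<close>.\<close>

definition bundle_gerbe ::
    "('m::{t2_space, second_countable_topology}, 'em::finite_dim_inner,
      'x::{t2_space, second_countable_topology}, 'ex::finite_dim_inner,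
      'p::{t2_space, second_countable_topology}, 'ep::finite_dim_inner) gerbe \<Rightarrow> bool"
  where "bundle_gerbe G \<longleftrightarrow>
    smooth_manifold (base G) \<and> lie_groupoid G \<and>
    surjective_submersion (objs G) (base G) (proj G) \<and>
    principal_circle_bundle G \<and>
    (\<forall>z w p q. cmod z = 1 \<and> cmod w = 1 \<and> src G p = tgt G q \<longrightarrow>
       mult G (act G z p) (act G w q) = act G (z * w) (mult G p q))"

text \<open>The multiplication of the tangent groupoid \<open>TP \<rightrightarrows> TX\<close>, at \<open>(p, q)\<close>, for
  \<open>ds v = dt w\<close>.\<close>

definition tmult ::
    "('m, 'em, 'x, 'ex, 'p::topological_space, 'ep::finite_dim_inner) gerbe \<Rightarrow>
     'p \<Rightarrow> 'p \<Rightarrow> 'ep \<Rightarrow> 'ep \<Rightarrow> 'ep"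
  where "tmult G p q v w =
    tmap_sub (prod_manifold (arrs G) (arrs G)) (arrs G) (composable G)
      (\<lambda>(p, q). mult G p q) (p, q) (v, w)"

definition tsrc ::
    "('m, 'em, 'x, 'ex::real_normed_vector, 'p, 'ep::real_normed_vector) gerbe \<Rightarrow>
     'p \<Rightarrow> 'ep \<Rightarrow> 'ex"
  where "tsrc G = tmap (arrs G) (objs G) (src G)"

definition ttgt ::
    "('m, 'em, 'x, 'ex::real_normed_vector, 'p, 'ep::real_normed_vector) gerbe \<Rightarrow>
     'p \<Rightarrow> 'ep \<Rightarrow> 'ex"
  where "ttgt G = tmap (arrs G) (objs G) (tgt G)"

text \<open>The simplicial differential on functions, \<open>1\<close>-forms and \<open>2\<close>-forms on \<open>X\<close>.\<close>

definition delta0 :: "('m, 'em, 'x, 'ex, 'p, 'ep) gerbe \<Rightarrow> ('x \<Rightarrow> real) \<Rightarrow> 'p \<Rightarrow> real"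
  where "delta0 G g = (g \<circ> src G) - (g \<circ> tgt G)"

definition delta1 ::
    "('m, 'em, 'x, 'ex::real_normed_vector, 'p, 'ep::real_normed_vector) gerbe \<Rightarrow>
     ('x \<Rightarrow> 'ex \<Rightarrow> real) \<Rightarrow> 'p \<Rightarrow> 'ep \<Rightarrow> real"
  where "delta1 G \<alpha> = pull1 (arrs G) (objs G) (src G) \<alpha> - pull1 (arrs G) (objs G) (tgt G) \<alpha>"

definition delta2 ::
    "('m, 'em, 'x, 'ex::real_normed_vector, 'p, 'ep::real_normed_vector) gerbe \<Rightarrow>
     ('x \<Rightarrow> 'ex \<Rightarrow> 'ex \<Rightarrow> real) \<Rightarrow> 'p \<Rightarrow> 'ep \<Rightarrow> 'ep \<Rightarrow> real"
  where "delta2 G B = pull2 (arrs G) (objs G) (src G) B - pull2 (arrs G) (objs G) (tgt G) B"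

text \<open>A principal connection form is invariant and takes the value \<open>1\<close> on the generator
  \<open>d/d\<theta>\<close> of the action of \<open>e\<^sup>i\<^sup>\<theta>\<close>. The last condition is \<open>\<delta>\<gamma> = 0\<close> on \<open>P \<times>\<^sub>X P\<close>, evaluated on its
  tangent vectors \<open>(v, w)\<close>.\<close>

definition gerbe_connection ::
    "('m, 'em, 'x::topological_space, 'ex::finite_dim_inner, 'p::topological_space,
      'ep::finite_dim_inner) gerbe \<Rightarrow> ('p \<Rightarrow> 'ep \<Rightarrow> real) \<Rightarrow> bool"
  where "gerbe_connection G \<gamma> \<longleftrightarrow>
    \<gamma> \<in> forms1 (arrs G) \<and>
    (\<forall>z. cmod z = 1 \<longrightarrow> pull1 (arrs G) (arrs G) (act G z) \<gamma> = \<gamma>) \<and>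
    (\<forall>p. pull1 vec_manifold (arrs G) (\<lambda>\<theta>::real. act G (cis \<theta>) p) \<gamma> 0 1 = 1) \<and>
    (\<forall>p q v w. src G p = tgt G q \<and> tsrc G p v = ttgt G q w \<longrightarrow>
       \<gamma> p v - \<gamma> (mult G p q) (tmult G p q v w) + \<gamma> q w = 0)"

definition curving ::
    "('m, 'em, 'x, 'ex::finite_dim_inner, 'p, 'ep::finite_dim_inner) gerbe \<Rightarrow>
     ('p \<Rightarrow> 'ep \<Rightarrow> real) \<Rightarrow> ('x \<Rightarrow> 'ex \<Rightarrow> 'ex \<Rightarrow> real) \<Rightarrow> bool"
  where "curving G \<gamma> B \<longleftrightarrow> B \<in> forms2 (objs G) \<and> delta2 G B = d1 (arrs G) \<gamma>"

definition three_curvature ::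
    "('m, 'em::finite_dim_inner, 'x, 'ex::finite_dim_inner, 'p, 'ep) gerbe \<Rightarrow>
     ('x \<Rightarrow> 'ex \<Rightarrow> 'ex \<Rightarrow> real) \<Rightarrow> ('m \<Rightarrow> 'em \<Rightarrow> 'em \<Rightarrow> 'em \<Rightarrow> real) \<Rightarrow> bool"
  where "three_curvature G B chi \<longleftrightarrow>
    chi \<in> forms3 (base G) \<and> pull3 (objs G) (base G) (proj G) chi = d2 (objs G) B"


section \<open>The Lie 2-algebra of multiplicative vector fields\<close>

definition multiplicative ::
    "('m, 'em, 'x::topological_space, 'ex::finite_dim_inner, 'p::topological_space,
      'ep::finite_dim_inner) gerbe \<Rightarrow> ('x \<Rightarrow> 'ex) \<Rightarrow> ('p \<Rightarrow> 'ep) \<Rightarrow> bool"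
  where "multiplicative G X P \<longleftrightarrow>
    X \<in> vec_fields (objs G) \<and> P \<in> vec_fields (arrs G) \<and>
    (\<forall>p. tsrc G p (P p) = X (src G p)) \<and>
    (\<forall>p. ttgt G p (P p) = X (tgt G p)) \<and>
    (\<forall>x. tmap (objs G) (arrs G) (unit_map G) x (X x) = P (unit_map G x)) \<and>
    (\<forall>p q. src G p = tgt G q \<longrightarrow> tmult G p q (P p) (P q) = P (mult G p q))"

text \<open>Sections of the Lie algebroid \<open>A\<^sub>P\<close>, whose fibre at \<open>x\<close> is the kernel of \<open>ds\<close> at the unit
  of \<open>x\<close>.\<close>

definition algebroid_sections ::
    "('m, 'em, 'x::topological_space, 'ex::finite_dim_inner, 'p::topological_space,
      'ep::finite_dim_inner) gerbe \<Rightarrow> ('x \<Rightarrow> 'ep) set"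
  where "algebroid_sections G =
    {a \<in> vec_fields_along (objs G) (arrs G) (unit_map G). \<forall>x. tsrc G (unit_map G x) (a x) = 0}"

definition anchor ::
    "('m, 'em, 'x, 'ex::real_normed_vector, 'p, 'ep::real_normed_vector) gerbe \<Rightarrow>
     ('x \<Rightarrow> 'ep) \<Rightarrow> 'x \<Rightarrow> 'ex"
  where "anchor G a = (\<lambda>x. ttgt G (unit_map G x) (a x))"

definition right_field ::
    "('m, 'em, 'x, 'ex, 'p::topological_space, 'ep::finite_dim_inner) gerbe \<Rightarrow>
     ('x \<Rightarrow> 'ep) \<Rightarrow> 'p \<Rightarrow> 'ep"
  where "right_field G a p =
    tmap_sub (arrs G) (arrs G) {q. src G q = tgt G p} (\<lambda>q. mult G q p)
      (unit_map G (tgt G p)) (a (tgt G p))"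

definition left_field ::
    "('m, 'em, 'x, 'ex, 'p::topological_space, 'ep::finite_dim_inner) gerbe \<Rightarrow>
     ('x \<Rightarrow> 'ep) \<Rightarrow> 'p \<Rightarrow> 'ep"
  where "left_field G a p =
    tmap_sub (arrs G) (arrs G) {q. src G q = src G p} (\<lambda>q. mult G p (invs G q))
      (unit_map G (src G p)) (a (src G p))"

text \<open>The function \<open>v\<^sub>a\<close>.\<close>

definition vert ::
    "('m, 'em, 'x, 'ex, 'p::topological_space, 'ep::finite_dim_inner) gerbe \<Rightarrow>
     ('p \<Rightarrow> 'ep \<Rightarrow> real) \<Rightarrow> ('x \<Rightarrow> 'ep) \<Rightarrow> 'x \<Rightarrow> real"
  where "vert G \<gamma> a = contr1 (right_field G a) \<gamma> \<circ> unit_map G"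

type_synonym ('x, 'ex, 'p, 'ep) sym0 = "('x \<Rightarrow> 'ex) \<times> ('p \<Rightarrow> 'ep) \<times> ('x \<Rightarrow> 'ex \<Rightarrow> real)"

definition sym0_carrier ::
    "('m, 'em, 'x::topological_space, 'ex::finite_dim_inner, 'p::topological_space,
      'ep::finite_dim_inner) gerbe \<Rightarrow> ('p \<Rightarrow> 'ep \<Rightarrow> real) \<Rightarrow> ('x, 'ex, 'p, 'ep) sym0 set"
  where "sym0_carrier G \<gamma> = {(X, P, \<alpha>). multiplicative G X P \<and> \<alpha> \<in> forms1 (objs G) \<and>
    lie_deriv1 (arrs G) P \<gamma> = delta1 G \<alpha>}"

definition sym0_bracket ::
    "('m, 'em, 'x, 'ex::real_normed_vector, 'p, 'ep::real_normed_vector) gerbe \<Rightarrow>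
     ('x, 'ex, 'p, 'ep) sym0 \<Rightarrow> ('x, 'ex, 'p, 'ep) sym0 \<Rightarrow> ('x, 'ex, 'p, 'ep) sym0"
  where "sym0_bracket G = (\<lambda>(X, P, \<alpha>) (Z, R, \<beta>).
    (lie_bracket (objs G) X Z, lie_bracket (arrs G) P R,
     lie_deriv1 (objs G) X \<beta> - lie_deriv1 (objs G) Z \<alpha>))"

text \<open>The differential is the same for every curving, so we may use an arbitrary one.\<close>

definition sym_bd ::
    "('m, 'em, 'x::topological_space, 'ex::finite_dim_inner, 'p::topological_space,
      'ep::finite_dim_inner) gerbe \<Rightarrow> ('p \<Rightarrow> 'ep \<Rightarrow> real) \<Rightarrow> ('x \<Rightarrow> 'ep) \<Rightarrow>
     ('x, 'ex, 'p, 'ep) sym0"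
  where "sym_bd G \<gamma> a =
    (anchor G a, right_field G a + left_field G a,
     contr2 (anchor G a) (SOME B. curving G \<gamma> B) - d0 (objs G) (vert G \<gamma> a))"

definition sym_lie2 ::
    "('m, 'em, 'x::topological_space, 'ex::finite_dim_inner, 'p::topological_space,
      'ep::finite_dim_inner) gerbe \<Rightarrow> ('p \<Rightarrow> 'ep \<Rightarrow> real) \<Rightarrow>
     (('x, 'ex, 'p, 'ep) sym0, 'x \<Rightarrow> 'ep) lie2_algebra"
  where "sym_lie2 G \<gamma> =
    \<lparr>deg0 = subspace_vspace (sym0_carrier G \<gamma>),
     deg1 = subspace_vspace (algebroid_sections G),
     bd = sym_bd G \<gamma>,
     br0 = sym0_bracket G,
     br1 = (\<lambda>(X, P, \<alpha>) a. lie_bracket (arrs G) P (right_field G a) \<circ> unit_map G),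
     jac = (\<lambda>_ _ _. 0)\<rparr>"


section \<open>The Courant Lie 2-algebra\<close>

type_synonym ('m, 'e) courant0 = "('m \<Rightarrow> 'e) \<times> ('m \<Rightarrow> 'e \<Rightarrow> real)"

definition pairing :: "('m, 'e) courant0 \<Rightarrow> ('m, 'e) courant0 \<Rightarrow> 'm \<Rightarrow> real"
  where "pairing = (\<lambda>(u, \<alpha>) (v, \<beta>). contr1 u \<beta> + contr1 v \<alpha>)"

definition courant_bracket ::
    "('m, 'e::real_normed_vector) manifold \<Rightarrow> ('m \<Rightarrow> 'e \<Rightarrow> 'e \<Rightarrow> 'e \<Rightarrow> real) \<Rightarrow>
     ('m, 'e) courant0 \<Rightarrow> ('m, 'e) courant0 \<Rightarrow> ('m, 'e) courant0"
  where "courant_bracket M chi = (\<lambda>(u, \<alpha>) (v, \<beta>).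
    (lie_bracket M u v,
     lie_deriv1 M u \<beta> - lie_deriv1 M v \<alpha> - (1/2) *\<^sub>R d0 M (contr1 u \<beta> - contr1 v \<alpha>)
     - contr2 v (contr3 u chi)))"

definition courant_lie2 ::
    "('m::topological_space, 'e::finite_dim_inner) manifold \<Rightarrow>
     ('m \<Rightarrow> 'e \<Rightarrow> 'e \<Rightarrow> 'e \<Rightarrow> real) \<Rightarrow> (('m, 'e) courant0, 'm \<Rightarrow> real) lie2_algebra"
  where "courant_lie2 M chi =
    (let br = courant_bracket M chi in
     \<lparr>deg0 = subspace_vspace (vec_fields M \<times> forms1 M),
      deg1 = subspace_vspace (smooth_funs M),
      bd = (\<lambda>f. (0, d0 M f)),
      br0 = br,
      br1 = (\<lambda>(u, \<alpha>) f. (1/2) *\<^sub>R contr1 u (d0 M f)),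
      jac = (\<lambda>e1 e2 e3. (- 1/6) *\<^sub>R
        (pairing (br e1 e2) e3 + pairing (br e2 e3) e1 + pairing (br e3 e1) e2))\<rparr>)"

text \<open>The butterfly of the strict morphism \<open>T\<^sub>\<tau>\<close>.\<close>

definition courant_shift ::
    "('m \<Rightarrow> 'e \<Rightarrow> 'e \<Rightarrow> real) \<Rightarrow> ('m, 'e) courant0 \<Rightarrow> ('m, 'e) courant0"
  where "courant_shift \<tau> = (\<lambda>(u, \<alpha>). (u, \<alpha> + contr2 u \<tau>))"

definition shift_butterfly ::
    "('m::topological_space, 'e::finite_dim_inner) manifold \<Rightarrow>
     ('m \<Rightarrow> 'e \<Rightarrow> 'e \<Rightarrow> 'e \<Rightarrow> real) \<Rightarrow> ('m \<Rightarrow> 'e \<Rightarrow> 'e \<Rightarrow> real) \<Rightarrow>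
     (('m, 'e) courant0, 'm \<Rightarrow> real, ('m, 'e) courant0, 'm \<Rightarrow> real,
      ('m \<Rightarrow> real) \<times> ('m, 'e) courant0) butterfly"
  where "shift_butterfly M chi \<tau> =
    strict_butterfly (courant_lie2 M chi) (courant_lie2 M (chi + d2 M \<tau>)) (courant_shift \<tau>) (\<lambda>f. f)"


section \<open>The butterfly determined by a curving\<close>

definition gerbe_rho ::
    "('m::topological_space, 'em::finite_dim_inner, 'x::topological_space, 'ex::finite_dim_inner,
      'p, 'ep) gerbe \<Rightarrow> ('x \<Rightarrow> 'ex \<Rightarrow> 'ex \<Rightarrow> real) \<Rightarrow>
     ('x, 'ex, 'p, 'ep) sym0 \<times> ('x \<Rightarrow> real) \<Rightarrow> ('m, 'em) courant0"
  where "gerbe_rho G B = (\<lambda>((X, P, \<alpha>), g).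
    (THE x. x \<in> vec_fields (base G) \<and>
       (\<forall>q. tmap (objs G) (base G) (proj G) q (X q) = x (proj G q)),
     - (THE \<epsilon>. \<epsilon> \<in> forms1 (base G) \<and>
         pull1 (objs G) (base G) (proj G) \<epsilon> = \<alpha> - contr2 X B - d0 (objs G) g)))"

definition gerbe_butterfly ::
    "('m::topological_space, 'em::finite_dim_inner, 'x::topological_space, 'ex::finite_dim_inner,
      'p::topological_space, 'ep::finite_dim_inner) gerbe \<Rightarrow> ('p \<Rightarrow> 'ep \<Rightarrow> real) \<Rightarrow>
     ('x \<Rightarrow> 'ex \<Rightarrow> 'ex \<Rightarrow> real) \<Rightarrow>
     (('x, 'ex, 'p, 'ep) sym0, 'x \<Rightarrow> 'ep, ('m, 'em) courant0, 'm \<Rightarrow> real,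
      ('x, 'ex, 'p, 'ep) sym0 \<times> ('x \<Rightarrow> real)) butterfly"
  where "gerbe_butterfly G \<gamma> B =
    \<lparr>total = subspace_vspace {((X, P, \<alpha>), g).
        (X, P, \<alpha>) \<in> sym0_carrier G \<gamma> \<and> g \<in> smooth_funs (objs G) \<and> delta0 G g = contr1 P \<gamma>},
     brak = (\<lambda>((X, P, \<alpha>), g) ((Z, R, \<beta>), h).
        (sym0_bracket G (X, P, \<alpha>) (Z, R, \<beta>),
         (1/2) *\<^sub>R (contr1 X (\<beta> + d0 (objs G) h) - contr1 Z (\<alpha> + d0 (objs G) g)))),
     kap = (\<lambda>a. (sym_bd G \<gamma> a, - vert G \<gamma> a)),
     lam = (\<lambda>f. (0, f \<circ> proj G)),
     sig = fst,
     rho = gerbe_rho G B\<rparr>"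

end

theory Submission
  imports Defs
begin

text \<open>The isomorphism sends the class of \<open>((\<xi>; g), (f, w))\<close> to \<open>(\<xi>; g + \<pi>\<^sup>* f)\<close>. Elements of the
  fibre product satisfy \<open>w = \<rho>(\<xi>; g)\<close>, so the second component is recovered from the first and from
  \<open>f\<close>, and the divided-out pairs \<open>((0; \<pi>\<^sup>* h), (- h, (0, dh)))\<close> are exactly what the sum
  \<open>g + \<pi>\<^sup>* f\<close> forgets. The choice of \<open>\<tau>\<close> enters only in \<open>\<rho>\<close>, where \<open>\<iota>\<^sub>x \<tau>\<close> compensates the change
  of the curving. The analytic content is that \<open>\<rho>\<close> takes values in smooth sections: multiplicative
  vector fields and the forms \<open>\<alpha> - \<iota>\<^sub>x B - dg\<close> descend to \<open>M\<close>. The latter are killed by \<open>\<delta>\<close> by Cartan's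
  formula, tangent vectors of \<open>X \<times>\<^sub>M X\<close> lift to \<open>P\<close>, and smoothness downstairs is seen along
  local sections, which the inverse function theorem provides.\<close>

section \<open>Finite-dimensional spaces\<close>

text \<open>The signs and factors are forced by matching. In the strict butterfly
  \<open>kap h\<close> is \<open>(- h, (0, dh))\<close>, hence the plus sign in the sum of
  functions. Adding the pullback of \<open>h\<close> to \<open>g\<close> changes the form in \<rho>
  by \<open>+ dh\<close>, because \<rho> carries \<open>- \<epsilon>\<close> and \<epsilon> contains
  \<open>- dg\<close>. Brackets agree because contracting X with the differential of a pulled-back
  function gives the pullback of the contraction downstairs, and because exactly half of
  \<open>L_x dk = d(\<iota>_x dk)\<close> survives in the Courant bracket. The term with
  \<open>chi\<close> sees only vector fields, which the divided-out pairs leave alone. Two encodings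
  shape the work. \<rho> is a definite description, so nothing is known about it until smooth values
  are shown to exist. The operations of the composite are unions over representatives, so each must
  be shown well defined before it can be evaluated. Calculus is carried out over
  \<open>finite_dim_inner\<close> with a chosen orthonormal basis; the inverse function theorem is
  obtained from Banach's fixed point theorem.\<close>

lemma finite_orthonormal_basis:
  obtains B :: "'a::finite_dim_inner set"
  where "finite B" "\<And>b. b \<in> B \<Longrightarrow> norm b = 1" "\<And>x. (\<Sum>b\<in>B. (x \<bullet> b) *\<^sub>R b) = x"
proof -
  obtain S :: "'a set" where S: "finite S" "span S = UNIV"
    using finite_dim_span by blast
  obtain C :: "'a set" where C: "finite C" "span C = UNIV" "pairwise orthogonal C"
    using basis_orthogonal [OF S(1)] S(2) by auto
  define c where "c b = b /\<^sub>R norm b" for b :: 'a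
  \<comment> \<open>The orthogonal spanning set may contain 0, which cannot be normalised.\<close>
  define B where "B = c ` (C - {0})"
  have "norm (c b) = 1" if "b \<noteq> 0" for b using that by (simp add: c_def)
  then have B: "finite B" "\<And>b. b \<in> B \<Longrightarrow> norm b = 1"
    using C(1) by (auto simp: B_def)
  have orth: "b \<bullet> b' = (if b = b' then 1 else 0)" if bb: "b \<in> B" "b' \<in> B" for b b'
  proof (cases "b = b'")
    case True
    then show ?thesis using B(2) [OF bb(1)] norm_eq_1 [of b] by metis
  next
    case False
    obtain x y where xy: "x \<in> C" "y \<in> C" "b = c x" "b' = c y"
      using bb unfolding B_def by blast
    with False have "x \<bullet> y = 0"
      using C(3) by (metis orthogonal_def pairwiseD)
    with False xy show ?thesis by (simp add: c_def)
  qed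
  have "C \<subseteq> span B"
  proof
    fix x assume "x \<in> C"
    show "x \<in> span B"
    proof (cases "x = 0")
      case False
      then have "x = norm x *\<^sub>R c x" by (simp add: c_def)
      moreover have "c x \<in> B" using False \<open>x \<in> C\<close> by (auto simp: B_def)
      ultimately show ?thesis using span_scale [OF span_base, of "c x" B "norm x"] by argo
    qed (simp add: span_zero)
  qed
  then have spB: "span B = UNIV"
    using span_minimal [OF _ subspace_span, of C B] C(2) by auto
  have "(\<Sum>b\<in>B. (x \<bullet> b) *\<^sub>R b) = x" for x
  proof -
    have "x \<in> range (\<lambda>u. \<Sum>b\<in>B. u b *\<^sub>R b)"
      using span_finite [OF B(1)] spB by simp
    then obtain r where r: "x = (\<Sum>b\<in>B. r b *\<^sub>R b)"
      by blast
    have "x \<bullet> b = r b" if "b \<in> B" for b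
    proof -
      have "x \<bullet> b = (\<Sum>b'\<in>B. r b' *\<^sub>R b') \<bullet> b"
        by (rule arg_cong [OF r, of "\<lambda>y. y \<bullet> b"])
      also have "\<dots> = (\<Sum>b'\<in>B. r b' * (b' \<bullet> b))"
        by (simp add: inner_sum_left)
      also have "\<dots> = (\<Sum>b'\<in>B. if b = b' then r b' else 0)"
        by (rule sum.cong) (use that orth in auto)
      finally show ?thesis using that B(1) by simp
    qed
    then have "(\<Sum>b\<in>B. (x \<bullet> b) *\<^sub>R b) = (\<Sum>b\<in>B. r b *\<^sub>R b)"
      by (intro sum.cong) auto
    with r show ?thesis by metis
  qed
  from that [OF B this] show thesis .
qed

text \<open>One basis is fixed per type, so that a linear map depending on a point can be written as
  a finite sum over the same vectors everywhere.\<close>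

definition onb :: "'a::finite_dim_inner set"
  where "onb = (SOME B. finite B \<and> (\<forall>b\<in>B. norm b = 1) \<and> (\<forall>x. (\<Sum>b\<in>B. (x \<bullet> b) *\<^sub>R b) = x))"

lemma onb:
  shows finite_onb [simp]: "finite (onb :: 'a::finite_dim_inner set)"
    and norm_onb: "b \<in> (onb :: 'a set) \<Longrightarrow> norm b = 1"
    and onb_expand: "(\<Sum>b\<in>onb. (x \<bullet> b) *\<^sub>R b) = (x :: 'a)"
proof -
  have "\<exists>B :: 'a set. finite B \<and> (\<forall>b\<in>B. norm b = 1) \<and> (\<forall>x. (\<Sum>b\<in>B. (x \<bullet> b) *\<^sub>R b) = x)"
    by (rule finite_orthonormal_basis) blast
  from someI_ex [OF this]
  show "finite (onb :: 'a set)" "b \<in> (onb :: 'a set) \<Longrightarrow> norm b = 1"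
    "(\<Sum>b\<in>onb. (x \<bullet> b) *\<^sub>R b) = (x :: 'a)"
    unfolding onb_def by auto
qed

lemma linear_onb_expand:
  fixes f :: "'a::finite_dim_inner \<Rightarrow> 'b::real_vector"
  assumes "linear f"
  shows "f x = (\<Sum>b\<in>onb. (x \<bullet> b) *\<^sub>R f b)"
proof -
  have "f x = f (\<Sum>b\<in>onb. (x \<bullet> b) *\<^sub>R b)" by (simp add: onb_expand)
  then show ?thesis by (simp add: linear_sum [OF assms] linear_scale [OF assms])
qed

lemma linear_imp_bounded_linear:
  fixes f :: "'a::finite_dim_inner \<Rightarrow> 'b::real_normed_vector"
  assumes "linear f"
  shows "bounded_linear f"
proof -
  have "bounded_linear (\<lambda>x. \<Sum>b\<in>onb. (x \<bullet> b) *\<^sub>R f b)"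
    by (intro bounded_linear_sum bounded_linear_scaleR_const bounded_linear_inner_left)
  then show ?thesis by (simp add: linear_onb_expand [OF assms, symmetric])
qed

text \<open>A crude substitute for the operator norm. Its merit is that the bound depends
  continuously on the values of \<open>f\<close> on the basis, which is all that is known about
  families of linear maps below.\<close>

lemma norm_linear_le_sum_onb:
  fixes f :: "'a::finite_dim_inner \<Rightarrow> 'b::real_normed_vector"
  assumes "linear f"
  shows "norm (f x) \<le> (\<Sum>b\<in>onb. norm (f b)) * norm x"
proof -
  have "norm (f x) \<le> (\<Sum>b\<in>onb. norm ((x \<bullet> b) *\<^sub>R f b))"
    unfolding linear_onb_expand [OF assms, of x] by (rule norm_sum)
  also have "\<dots> \<le> (\<Sum>b\<in>onb. norm (f b) * norm x)"
  proof (rule sum_mono)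
    fix b :: 'a assume "b \<in> onb"
    then have "\<bar>x \<bullet> b\<bar> \<le> norm x"
      using Cauchy_Schwarz_ineq2 [of x b] by (simp add: norm_onb)
    then show "norm ((x \<bullet> b) *\<^sub>R f b) \<le> norm (f b) * norm x"
      by (metis mult.commute mult_right_mono norm_ge_zero norm_scaleR)
  qed
  finally show ?thesis by (simp add: sum_distrib_right)
qed

text \<open>Coordinates of a Cauchy sequence converge in the reals. Completeness is what Banach's
  fixed point theorem asks for.\<close>

lemma complete_UNIV_finite_dim: "complete (UNIV :: 'a::finite_dim_inner set)"
proof (rule completeI)
  fix X :: "nat \<Rightarrow> 'a" assume "Cauchy X"
  then have "Cauchy (\<lambda>n. X n \<bullet> b)" for b
    by (rule bounded_linear.Cauchy [OF bounded_linear_inner_left])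
  then have "\<exists>l. (\<lambda>n. X n \<bullet> b) \<longlonglongrightarrow> l" for b
    using Cauchy_convergent_iff convergent_def by blast
  then obtain l where "(\<lambda>n. X n \<bullet> b) \<longlonglongrightarrow> l b" for b by metis
  then have "(\<lambda>n. \<Sum>b\<in>onb. (X n \<bullet> b) *\<^sub>R b) \<longlonglongrightarrow> (\<Sum>b\<in>onb. l b *\<^sub>R b)"
    by (intro tendsto_intros)
  then show "\<exists>l\<in>UNIV. X \<longlonglongrightarrow> l" by (auto simp: onb_expand)
qed

section \<open>Smooth functions on open sets\<close>

lemma frechet_derivative_transform:
  assumes "open S" "x \<in> S" "\<And>y. y \<in> S \<Longrightarrow> f y = g y"
  shows "frechet_derivative f (at x) = frechet_derivative g (at x)"
    and "f differentiable (at x) \<longleftrightarrow> g differentiable (at x)"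
proof -
  have "(f has_derivative D) (at x) \<longleftrightarrow> (g has_derivative D) (at x)" for D
    using has_derivative_transform_within_open [OF _ assms(1,2), of f D UNIV g]
      has_derivative_transform_within_open [OF _ assms(1,2), of g D UNIV f] assms(3)
    by metis
  then show "frechet_derivative f (at x) = frechet_derivative g (at x)"
    and "f differentiable (at x) \<longleftrightarrow> g differentiable (at x)"
    by (simp_all add: frechet_derivative_def differentiable_def)
qed

lemma Ck_on_cong:
  assumes "open S" "\<And>x. x \<in> S \<Longrightarrow> f x = g x"
  shows "Ck_on k S f \<longleftrightarrow> Ck_on k S g"
  using assms(2)
proof (induction k arbitrary: f g)
  case 0
  then show ?case by (auto cong: continuous_on_cong)
next
  case (Suc k)
  note * = frechet_derivative_transform [OF assms(1) _ Suc.prems]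
  have "Ck_on k S (\<lambda>x. frechet_derivative f (at x) v) =
    Ck_on k S (\<lambda>x. frechet_derivative g (at x) v)" for v
    by (rule Suc.IH) (simp add: *)
  with * show ?case by auto
qed

lemma Ck_on_local:
  assumes "\<And>x. x \<in> S \<Longrightarrow> \<exists>T. open T \<and> x \<in> T \<and> Ck_on k T f"
  shows "Ck_on k S f"
  using assms
proof (induction k arbitrary: f)
  case 0
  have "isCont f x" if "x \<in> S" for x
    using 0 [OF that] by (auto simp: continuous_on_eq_continuous_at)
  then show ?case by (simp add: continuous_at_imp_continuous_on)
next
  case (Suc k)
  have "Ck_on k S (\<lambda>x. frechet_derivative f (at x) v)" for v
    by (rule Suc.IH) (use Suc.prems in fastforce)
  moreover have "f differentiable (at x)" if "x \<in> S" for x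
    using Suc.prems [OF that] by auto
  ultimately show ?case by simp
qed

lemma Ck_on_SucD: "Ck_on (Suc k) S f \<Longrightarrow> Ck_on k S f"
proof (induction k arbitrary: f)
  case 0
  then show ?case
    by (auto intro!: continuous_at_imp_continuous_on differentiable_imp_continuous_within)
qed (auto simp del: Ck_on.simps(1))

text \<open>Lets the closure proofs exhibit a derivative explicitly; on an open set it agrees with
  the one that \<open>frechet_derivative\<close> picks.\<close>

lemma Ck_on_SucI:
  assumes "open S" "\<And>x. x \<in> S \<Longrightarrow> (f has_derivative f' x) (at x)"
    and "\<And>v. Ck_on k S (\<lambda>x. f' x v)"
  shows "Ck_on (Suc k) S f"
proof -
  have "Ck_on k S (\<lambda>x. frechet_derivative f (at x) v)" for v
    using Ck_on_cong [OF assms(1), of "\<lambda>x. frechet_derivative f (at x) v" "\<lambda>x. f' x v" k]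
      frechet_derivative_at [OF assms(2)] assms(3) by metis
  with assms(2) show ?thesis by (auto simp: differentiable_def)
qed

lemma Ck_on_has_derivative:
  "Ck_on (Suc k) S f \<Longrightarrow> x \<in> S \<Longrightarrow> (f has_derivative frechet_derivative f (at x)) (at x)"
  by (simp add: frechet_derivative_works)

lemma Ck_on_const: "open S \<Longrightarrow> Ck_on k S (\<lambda>_. c)"
  by (induction k arbitrary: c) (auto simp: frechet_derivative_const)

lemma Ck_on_bounded_linear:
  assumes "open S" "bounded_linear h"
  shows "Ck_on k S h"
proof (cases k)
  case 0
  with assms(2) show ?thesis by (simp add: linear_continuous_on)
next
  case (Suc n)
  show ?thesis unfolding Suc
    by (rule Ck_on_SucI [OF assms(1) bounded_linear_imp_has_derivative [OF assms(2)]])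
      (rule Ck_on_const [OF assms(1)])
qed

lemma Ck_on_linear_comp:
  assumes "open S" "bounded_linear h" "Ck_on k S f"
  shows "Ck_on k S (\<lambda>x. h (f x))"
  using assms(3)
proof (induction k arbitrary: f)
  case 0
  then show ?case using assms(2) by (simp add: bounded_linear.continuous_on)
next
  case (Suc k)
  show ?case
  proof (rule Ck_on_SucI [OF assms(1)])
    show "((\<lambda>x. h (f x)) has_derivative (\<lambda>v. h (frechet_derivative f (at x) v))) (at x)"
      if "x \<in> S" for x
      by (rule bounded_linear.has_derivative [OF assms(2) Ck_on_has_derivative [OF Suc.prems that]])
  qed (use Suc in auto)
qed

lemma Ck_on_Pair:
  assumes "open S" "Ck_on k S f" "Ck_on k S g"
  shows "Ck_on k S (\<lambda>x. (f x, g x))"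
  using assms(2,3)
proof (induction k arbitrary: f g)
  case 0
  then show ?case by (simp add: continuous_on_Pair)
next
  case (Suc k)
  show ?case
  proof (rule Ck_on_SucI [OF assms(1)])
    show "((\<lambda>x. (f x, g x)) has_derivative
        (\<lambda>v. (frechet_derivative f (at x) v, frechet_derivative g (at x) v))) (at x)"
      if "x \<in> S" for x
      by (intro has_derivative_Pair Ck_on_has_derivative [OF _ that, of k] Suc.prems)
  qed (use Suc in auto)
qed

lemma Ck_on_add:
  assumes "open S" "Ck_on k S f" "Ck_on k S g"
  shows "Ck_on k S (\<lambda>x. f x + g x)"
  using Ck_on_linear_comp [OF assms(1) bounded_linear_add [OF bounded_linear_fst bounded_linear_snd]
      Ck_on_Pair [OF assms]] by simp

lemma Ck_on_sum:
  assumes "open S" "\<And>i. i \<in> I \<Longrightarrow> Ck_on k S (f i)"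
  shows "Ck_on k S (\<lambda>x. \<Sum>i\<in>I. f i x)"
  using assms(2)
  by (induction I rule: infinite_finite_induct) (simp_all add: Ck_on_const Ck_on_add assms(1))

lemma Ck_on_scaleR:
  assumes "open S" "Ck_on k S a" "Ck_on k S f"
  shows "Ck_on k S (\<lambda>x. a x *\<^sub>R f x)"
  using assms(2,3)
proof (induction k arbitrary: a f)
  case 0
  then show ?case by (simp add: continuous_on_scaleR)
next
  case (Suc k)
  show ?case
  proof (rule Ck_on_SucI [OF assms(1)])
    show "((\<lambda>x. a x *\<^sub>R f x) has_derivative
       (\<lambda>v. a x *\<^sub>R frechet_derivative f (at x) v + frechet_derivative a (at x) v *\<^sub>R f x)) (at x)"
      if "x \<in> S" for x
      by (intro has_derivative_scaleR Ck_on_has_derivative [OF _ that, of k] Suc.prems)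
    show "Ck_on k S (\<lambda>x. a x *\<^sub>R frechet_derivative f (at x) v
        + frechet_derivative a (at x) v *\<^sub>R f x)" for v
      by (intro Ck_on_add assms(1) Suc.IH)
        (use Suc.prems Ck_on_SucD [OF Suc.prems(1)] Ck_on_SucD [OF Suc.prems(2)] in auto)
  qed
qed

text \<open>Expanding \<open>w x\<close> in the basis reduces a family of linear maps applied to a
  moving vector to finitely many products, so regularity of \<open>A\<close> is needed on fixed
  vectors only.\<close>

lemma Ck_on_linear_apply:
  fixes w :: "'a::real_normed_vector \<Rightarrow> 'b::finite_dim_inner"
  assumes "open S" "\<And>x. x \<in> S \<Longrightarrow> linear (A x)" "\<And>b. Ck_on k S (\<lambda>x. A x b)" "Ck_on k S w"
  shows "Ck_on k S (\<lambda>x. A x (w x))"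
proof -
  have "Ck_on k S (\<lambda>x. \<Sum>b\<in>onb. (w x \<bullet> b) *\<^sub>R A x b)"
    by (intro Ck_on_sum Ck_on_scaleR assms Ck_on_linear_comp [OF _ bounded_linear_inner_left])
  moreover have "A x (w x) = (\<Sum>b\<in>onb. (w x \<bullet> b) *\<^sub>R A x b)" if "x \<in> S" for x
    by (rule linear_onb_expand [OF assms(2) [OF that]])
  ultimately show ?thesis
    using Ck_on_cong [OF assms(1), of "\<lambda>x. A x (w x)"] by simp
qed

lemma Ck_on_compose:
  fixes f :: "'a::real_normed_vector \<Rightarrow> 'b::finite_dim_inner"
  assumes "open S" "open T" "f ` S \<subseteq> T" "Ck_on k S f" "Ck_on k T g"
  shows "Ck_on k S (\<lambda>x. g (f x))"
  using assms(4,5)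
proof (induction k arbitrary: g)
  case 0
  then show ?case using assms(3) continuous_on_compose2 by auto
next
  case (Suc k)
  have fT: "f x \<in> T" if "x \<in> S" for x using that assms(3) by auto
  show ?case
  proof (rule Ck_on_SucI [OF assms(1)])
    show "((\<lambda>x. g (f x)) has_derivative
       (\<lambda>v. frechet_derivative g (at (f x)) (frechet_derivative f (at x) v))) (at x)"
      if "x \<in> S" for x
      by (rule has_derivative_compose [OF Ck_on_has_derivative Ck_on_has_derivative])
        (use Suc.prems that fT in auto)
    \<comment> \<open>By the chain rule the derivative is a varying linear map applied to a varying
      vector; the induction hypothesis is used for the directional derivatives of
      \<open>g\<close>.\<close>
    show "Ck_on k S (\<lambda>x. frechet_derivative g (at (f x)) (frechet_derivative f (at x) v))" for v
    proof (rule Ck_on_linear_apply [OF assms(1)])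
      show "linear (frechet_derivative g (at (f x)))" if "x \<in> S" for x
        using Suc.prems(2) fT [OF that] by (auto intro: linear_frechet_derivative)
      show "Ck_on k S (\<lambda>x. frechet_derivative g (at (f x)) b)" for b
        using Suc.IH [OF Ck_on_SucD [OF Suc.prems(1)]] Suc.prems(2) by auto
    qed (use Suc.prems in auto)
  qed
qed

text \<open>A product rule in which the scalar factor is merely continuous: since \<open>f\<close>
  vanishes to first order at the point, a factor tending to 0 makes the product negligible. It
  serves to differentiate an inverse that is so far only known to be continuous.\<close>

lemma has_derivative_scaleR_zero:
  fixes a :: "'a::real_normed_vector \<Rightarrow> real" and f :: "'a \<Rightarrow> 'b::real_normed_vector"
  assumes a: "(a \<longlongrightarrow> 0) (at x)" and f: "(f has_derivative D) (at x)" and "f x = 0"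
  shows "((\<lambda>y. a y *\<^sub>R f y) has_derivative (\<lambda>_. 0)) (at x)"
proof -
  obtain K where K: "\<And>v. norm (D v) \<le> norm v * K"
    using has_derivative_bounded_linear [OF f] bounded_linear.bounded by blast
  define q where "q y = norm (f y - f x - D (y - x)) / norm (y - x)" for y
  have "(q \<longlongrightarrow> 0) (at x)"
    using f unfolding has_derivative_iff_norm q_def by blast
  then have "((\<lambda>y. \<bar>a y\<bar> * (q y + K)) \<longlongrightarrow> \<bar>0\<bar> * (0 + K)) (at x)"
    by (intro tendsto_intros a)
  then have lim: "((\<lambda>y. \<bar>a y\<bar> * (q y + K)) \<longlongrightarrow> 0) (at x)" by simp
  have "norm (norm (a y *\<^sub>R f y) / norm (y - x)) \<le> \<bar>a y\<bar> * (q y + K)" if "y \<noteq> x" for y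
  proof -
    have "norm (f y) \<le> norm (f y - D (y - x)) + norm (D (y - x))"
      by (metis norm_triangle_sub add.commute)
    also have "\<dots> \<le> norm (f y - D (y - x)) + norm (y - x) * K"
      using K by simp
    finally have "norm (f y) / norm (y - x) \<le> q y + K"
      using that assms(3) by (simp add: q_def field_simps)
    then show ?thesis
      by (simp add: mult_left_mono flip: times_divide_eq_right)
  qed
  then have "((\<lambda>y. norm (a y *\<^sub>R f y) / norm (y - x)) \<longlongrightarrow> 0) (at x)"
    by (intro Lim_null_comparison [OF _ lim]) (auto simp: eventually_at_filter)
  then show ?thesis
    using assms(3) by (simp add: has_derivative_iff_norm)
qed

text \<open>Differentiating \<open>A C v = v\<close> gives the derivative \<open>- C (DA) C v\<close> of \<open>C v\<close>.\<close>

lemma Ck_on_inverse: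
  fixes A C :: "'a::real_normed_vector \<Rightarrow> 'b::finite_dim_inner \<Rightarrow> 'b"
  assumes "open S" "\<And>x. x \<in> S \<Longrightarrow> linear (A x)" "\<And>x. x \<in> S \<Longrightarrow> linear (C x)"
    and AC: "\<And>x v. x \<in> S \<Longrightarrow> A x (C x v) = v" and CA: "\<And>x v. x \<in> S \<Longrightarrow> C x (A x v) = v"
    and "\<And>b. Ck_on k S (\<lambda>x. A x b)"
  shows "Ck_on k S (\<lambda>x. C x v)"
proof -
  \<comment> \<open>The resolvent identity C(y) - C(x) = - C(x) (A(y) - A(x)) C(y), with the middle
    factor expanded in the basis.\<close>
  have diff: "C y v - C x v = - C x (\<Sum>b\<in>onb. (C y v \<bullet> b) *\<^sub>R (A y b - A x b))"
    if "x \<in> S" "y \<in> S" for x y v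
  proof -
    have "(\<Sum>b\<in>onb. (C y v \<bullet> b) *\<^sub>R (A y b - A x b)) = A y (C y v) - A x (C y v)"
      unfolding linear_onb_expand [OF assms(2) [OF that(1)], of "C y v"]
        linear_onb_expand [OF assms(2) [OF that(2)], of "C y v"]
      by (simp add: scaleR_diff_right sum_subtractf)
    also have "\<dots> = v - A x (C y v)" using AC [OF that(2)] by simp
    finally show ?thesis
      using CA [OF that(1)] by (simp add: linear_diff [OF assms(3) [OF that(1)]])
  qed
  have cont: "continuous_on S (\<lambda>x. C x v)" if Ac: "\<And>b. continuous_on S (\<lambda>x. A x b)" for v
    unfolding continuous_on_eq_continuous_at [OF assms(1)]
  proof
    fix x assume x: "x \<in> S"
    define K where "K = (\<Sum>b\<in>onb. norm (C x b)) + 1"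
    have K: "norm (C x w) \<le> K * norm w" for w
      using norm_linear_le_sum_onb [OF assms(3) [OF x], of w] norm_ge_zero [of w]
      unfolding K_def distrib_right by linarith
    have Kp: "K > 0" by (simp add: K_def add_nonneg_pos sum_nonneg)
    define \<epsilon> where "\<epsilon> y = K * (\<Sum>b\<in>onb. norm (A y b - A x b))" for y
    have "((\<lambda>y. A y b) \<longlongrightarrow> A x b) (at x)" for b
      using Ac x assms(1) continuous_on_eq_continuous_at isCont_def by blast
    then have "(\<epsilon> \<longlongrightarrow> K * (\<Sum>b\<in>(onb::'b set). norm (A x b - A x b))) (at x)"
      unfolding \<epsilon>_def by (intro tendsto_intros)
    then have \<epsilon>0: "(\<epsilon> \<longlongrightarrow> 0) (at x)" by simp
    \<comment> \<open>The resolvent identity bounds the difference d by \<open>\<epsilon> y\<close>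
      times d plus the norm of \<open>C x v\<close>; as \<open>\<epsilon> y\<close> is below 1/2,
      half of d can be absorbed on the left.\<close>
    have est: "norm (C y v - C x v) \<le> 2 * \<epsilon> y * norm (C x v)" if "y \<in> S" "\<epsilon> y < 1/2" for y
    proof -
      let ?d = "norm (C y v - C x v)"
      have "norm (\<Sum>b\<in>onb. (C y v \<bullet> b) *\<^sub>R (A y b - A x b))
          \<le> (\<Sum>b\<in>onb. norm (A y b - A x b)) * norm (C y v)"
        using norm_linear_le_sum_onb [of "\<lambda>w. A y w - A x w" "C y v"]
          linear_onb_expand [of "\<lambda>w. A y w - A x w" "C y v"]
          linear_compose_sub [OF assms(2) assms(2)] that x by metis
      then have "?d \<le> \<epsilon> y * norm (C y v)"
        using K Kp unfolding diff [OF x that(1), of v] \<epsilon>_def norm_minus_cancel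
        by (smt (verit, ccfv_SIG) mult.assoc mult_left_mono)
      also have "\<dots> \<le> \<epsilon> y * (?d + norm (C x v))"
        by (rule mult_left_mono) (use Kp in \<open>auto simp: \<epsilon>_def norm_triangle_sub add.commute sum_nonneg\<close>)
      finally have "?d \<le> \<epsilon> y * ?d + \<epsilon> y * norm (C x v)" by (simp add: algebra_simps)
      moreover have "\<epsilon> y * ?d \<le> 1/2 * ?d"
        using that(2) by (intro mult_right_mono) auto
      ultimately show ?thesis by simp
    qed
    have "((\<lambda>y. C y v - C x v) \<longlongrightarrow> 0) (at x)"
    proof (rule Lim_null_comparison)
      have "\<forall>\<^sub>F y in at x. y \<in> S" using assms(1) x eventually_at_in_open' by blast
      moreover have "\<forall>\<^sub>F y in at x. \<epsilon> y < 1/2" using order_tendstoD(2) [OF \<epsilon>0, of "1/2"] by simp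
      ultimately show "\<forall>\<^sub>F y in at x. norm (C y v - C x v) \<le> 2 * \<epsilon> y * norm (C x v)"
        by eventually_elim (rule est)
      show "((\<lambda>y. 2 * \<epsilon> y * norm (C x v)) \<longlongrightarrow> 0) (at x)"
        using \<epsilon>0 by (auto intro!: tendsto_eq_intros)
    qed
    then show "isCont (\<lambda>x. C x v) x" by (simp add: isCont_def LIM_zero_iff)
  qed
  show ?thesis using assms(6)
  proof (induction k arbitrary: v)
    case 0
    then show ?case using cont by simp
  next
    case (Suc k)
    have C: "Ck_on k S (\<lambda>x. C x v)" for v by (rule Suc.IH) (rule Ck_on_SucD [OF Suc.prems])
    have "Ck_on 0 S (\<lambda>x. A x b)" for b
      using Suc.prems by (auto intro!: continuous_at_imp_continuous_on differentiable_imp_continuous_within)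
    then have cont': "continuous_on S (\<lambda>x. C x v)" for v using cont by simp
    define D where "D x b = frechet_derivative (\<lambda>x. A x b) (at x)" for x b
    show ?case
    proof (rule Ck_on_SucI [OF assms(1)])
      fix x assume x: "x \<in> S"
      \<comment> \<open>The coefficient is split into its value at \<open>x\<close> and a rest
        tending to 0. The first part is differentiated with a constant coefficient, the second
        contributes nothing.\<close>
      have 1: "((\<lambda>y. (C y v \<bullet> b) *\<^sub>R (A y b - A x b)) has_derivative (\<lambda>u. (C x v \<bullet> b) *\<^sub>R D x b u)) (at x)"
        for b
      proof -
        have d: "((\<lambda>y. A y b) has_derivative D x b) (at x)"
          unfolding D_def by (rule Ck_on_has_derivative [OF Suc.prems x])
        have "((\<lambda>y. (C y v \<bullet> b) - (C x v \<bullet> b)) \<longlongrightarrow> 0) (at x)"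
          using cont' [of v] x assms(1)
          by (auto simp: continuous_on_eq_continuous_at isCont_def LIM_zero_iff intro!: tendsto_intros)
        then have 2: "((\<lambda>y. ((C y v \<bullet> b) - (C x v \<bullet> b)) *\<^sub>R (A y b - A x b)) has_derivative (\<lambda>_. 0)) (at x)"
          by (rule has_derivative_scaleR_zero) (auto intro!: derivative_eq_intros d)
        have "((\<lambda>y. (C x v \<bullet> b) *\<^sub>R (A y b - A x b)) has_derivative (\<lambda>u. (C x v \<bullet> b) *\<^sub>R (D x b u - 0))) (at x)"
          by (intro derivative_intros d)
        from has_derivative_add [OF this 2] show ?thesis
          by (simp add: scaleR_diff_left)
      qed
      have "((\<lambda>y. C x v - C x (\<Sum>b\<in>onb. (C y v \<bullet> b) *\<^sub>R (A y b - A x b))) has_derivative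
          (\<lambda>u. 0 - C x (\<Sum>b\<in>onb. (C x v \<bullet> b) *\<^sub>R D x b u))) (at x)"
        by (intro has_derivative_diff has_derivative_const has_derivative_sum 1
            bounded_linear.has_derivative [OF linear_imp_bounded_linear [OF assms(3) [OF x]]])
      moreover have "C x v - C x (\<Sum>b\<in>onb. (C y v \<bullet> b) *\<^sub>R (A y b - A x b)) = C y v" if "y \<in> S" for y
        using diff [OF x that, of v] by (simp add: algebra_simps)
      ultimately show "((\<lambda>y. C y v) has_derivative
          (\<lambda>u. 0 - C x (\<Sum>b\<in>onb. (C x v \<bullet> b) *\<^sub>R D x b u))) (at x)"
        by (rule has_derivative_transform_within_open [OF _ assms(1) x])
    next
      fix u
      have DD: "Ck_on k S (\<lambda>x. D x b u)" for b using Suc.prems [of b] by (simp add: D_def)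
      have "Ck_on k S (\<lambda>x. - C x (\<Sum>b\<in>onb. (C x v \<bullet> b) *\<^sub>R D x b u))"
        by (intro Ck_on_linear_comp [OF assms(1) bounded_linear_minus [OF bounded_linear_ident]] 
           Ck_on_linear_apply [OF assms(1,3) C] Ck_on_sum Ck_on_scaleR DD assms(1)
           Ck_on_linear_comp [OF assms(1) bounded_linear_inner_left] C)
      then show "Ck_on k S (\<lambda>x. 0 - C x (\<Sum>b\<in>onb. (C x v \<bullet> b) *\<^sub>R D x b u))" by simp
    qed
  qed
qed

section \<open>Rules for smooth functions\<close>

lemma smooth_on_cong:
  "open S \<Longrightarrow> (\<And>x. x \<in> S \<Longrightarrow> f x = g x) \<Longrightarrow> smooth_on S f \<longleftrightarrow> smooth_on S g"
  unfolding smooth_on_def using Ck_on_cong by blast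

lemma smooth_on_local:
  "(\<And>x. x \<in> S \<Longrightarrow> \<exists>T. open T \<and> x \<in> T \<and> smooth_on T f) \<Longrightarrow> smooth_on S f"
  unfolding smooth_on_def by (meson Ck_on_local)

lemma smooth_on_has_derivative:
  "smooth_on S f \<Longrightarrow> x \<in> S \<Longrightarrow> (f has_derivative frechet_derivative f (at x)) (at x)"
  unfolding smooth_on_def using Ck_on_has_derivative by blast

lemma smooth_on_imp_differentiable: "smooth_on S f \<Longrightarrow> x \<in> S \<Longrightarrow> f differentiable (at x)"
  using smooth_on_has_derivative differentiable_def by blast

lemma smooth_on_linear: "smooth_on S f \<Longrightarrow> x \<in> S \<Longrightarrow> linear (frechet_derivative f (at x))"
  by (simp add: linear_frechet_derivative smooth_on_imp_differentiable)

lemma smooth_on_imp_continuous_on: "smooth_on S f \<Longrightarrow> continuous_on S f"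
  by (metis Ck_on.simps(1) smooth_on_def)

lemma smooth_on_frechet_derivative:
  "smooth_on S f \<Longrightarrow> smooth_on S (\<lambda>x. frechet_derivative f (at x) v)"
  unfolding smooth_on_def by (metis Ck_on.simps(2))

lemma smooth_on_const: "open S \<Longrightarrow> smooth_on S (\<lambda>_. c)"
  by (simp add: smooth_on_def Ck_on_const)

lemma smooth_on_bounded_linear: "open S \<Longrightarrow> bounded_linear h \<Longrightarrow> smooth_on S h"
  by (simp add: smooth_on_def Ck_on_bounded_linear)

lemma smooth_on_linear_comp:
  "open S \<Longrightarrow> bounded_linear h \<Longrightarrow> smooth_on S f \<Longrightarrow> smooth_on S (\<lambda>x. h (f x))"
  by (simp add: smooth_on_def Ck_on_linear_comp)

lemma smooth_on_Pair:
  "open S \<Longrightarrow> smooth_on S f \<Longrightarrow> smooth_on S g \<Longrightarrow> smooth_on S (\<lambda>x. (f x, g x))"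
  by (simp add: smooth_on_def Ck_on_Pair)

lemma smooth_on_add:
  "open S \<Longrightarrow> smooth_on S f \<Longrightarrow> smooth_on S g \<Longrightarrow> smooth_on S (\<lambda>x. f x + g x)"
  by (simp add: smooth_on_def Ck_on_add)

lemma smooth_on_scaleR:
  "open S \<Longrightarrow> smooth_on S a \<Longrightarrow> smooth_on S f \<Longrightarrow> smooth_on S (\<lambda>x. a x *\<^sub>R f x)"
  by (simp add: smooth_on_def Ck_on_scaleR)

lemma smooth_on_scaleR_const: "open S \<Longrightarrow> smooth_on S f \<Longrightarrow> smooth_on S (\<lambda>x. c *\<^sub>R f x)"
  by (simp add: smooth_on_scaleR smooth_on_const)

lemma smooth_on_minus: "open S \<Longrightarrow> smooth_on S f \<Longrightarrow> smooth_on S (\<lambda>x. - f x)"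
  by (rule smooth_on_linear_comp [OF _ bounded_linear_minus [OF bounded_linear_ident]])

lemma smooth_on_diff:
  "open S \<Longrightarrow> smooth_on S f \<Longrightarrow> smooth_on S g \<Longrightarrow> smooth_on S (\<lambda>x. f x - g x)"
  using smooth_on_add [OF _ _ smooth_on_minus] by force

lemma smooth_on_linear_apply:
  fixes w :: "'a::real_normed_vector \<Rightarrow> 'b::finite_dim_inner"
  shows "open S \<Longrightarrow> (\<And>x. x \<in> S \<Longrightarrow> linear (A x)) \<Longrightarrow> (\<And>b. smooth_on S (\<lambda>x. A x b)) \<Longrightarrow>
    smooth_on S w \<Longrightarrow> smooth_on S (\<lambda>x. A x (w x))"
  by (simp add: smooth_on_def Ck_on_linear_apply)

lemma smooth_on_compose:
  fixes f :: "'a::real_normed_vector \<Rightarrow> 'b::finite_dim_inner"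
  shows "open S \<Longrightarrow> open T \<Longrightarrow> f ` S \<subseteq> T \<Longrightarrow> smooth_on S f \<Longrightarrow> smooth_on T g \<Longrightarrow>
    smooth_on S (\<lambda>x. g (f x))"
  by (simp add: smooth_on_def Ck_on_compose)

section \<open>Symmetry of second derivatives\<close>

lemma second_difference_mean_value:
  fixes f :: "'a::real_normed_vector \<Rightarrow> real"
  assumes "open S" "x \<in> S" "smooth_on S f"
  obtains r where "r > 0" "\<And>t. 0 < t \<Longrightarrow> t < r \<Longrightarrow>
    \<exists>y. norm (y - x) \<le> t * (norm u + norm v) \<and>
      f (x + t *\<^sub>R u + t *\<^sub>R v) - f (x + t *\<^sub>R u) - f (x + t *\<^sub>R v) + f x =
      t * (t * frechet_derivative (\<lambda>z. frechet_derivative f (at z) u) (at y) v)"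
proof -
  obtain \<rho> where \<rho>: "\<rho> > 0" "ball x \<rho> \<subseteq> S"
    using assms openE by blast
  \<comment> \<open>Small enough for the whole parallelogram spanned by \<open>t u\<close> and
    \<open>t v\<close> at \<open>x\<close> to stay in the ball; the 1 keeps the denominator
    positive.\<close>
  define r where "r = \<rho> / (norm u + norm v + 1)"
  have np: "norm u + norm v + 1 > 0" by (simp add: add_nonneg_pos)
  define D where "D z = frechet_derivative f (at z)" for z
  define E where "E z = frechet_derivative (\<lambda>z. D z u) (at z)" for z
  show thesis
  proof (rule that)
    show "r > 0" using \<rho>(1) np by (simp add: r_def)
    fix t :: real assume t: "0 < t" "t < r"
    have bound: "norm (a *\<^sub>R u + b *\<^sub>R v) \<le> t * (norm u + norm v)"
      if "0 \<le> a" "a \<le> t" "0 \<le> b" "b \<le> t" for a b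
    proof -
      have "norm (a *\<^sub>R u + b *\<^sub>R v) \<le> a * norm u + b * norm v"
        using norm_triangle_ineq [of "a *\<^sub>R u" "b *\<^sub>R v"] that by simp
      also have "\<dots> \<le> t * norm u + t * norm v"
        using that by (intro add_mono mult_right_mono) auto
      finally show ?thesis by (simp add: distrib_left)
    qed
    have "t * (norm u + norm v + 1) < \<rho>"
      using t(2) np by (simp add: r_def field_simps)
    then have "t * (norm u + norm v) < \<rho>" using t(1) by (simp add: distrib_left)
    then have inS: "x + a *\<^sub>R u + b *\<^sub>R v \<in> S" if "0 \<le> a" "a \<le> t" "0 \<le> b" "b \<le> t" for a b
      using bound [OF that] \<rho>(2) by (auto simp: dist_norm add.assoc subset_iff norm_minus_commute
          intro!: order.strict_trans1)
    have df: "(f has_derivative D z) (at z)" if "z \<in> S" for z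
      unfolding D_def by (rule smooth_on_has_derivative [OF assms(3) that])
    have dD: "((\<lambda>z. D z u) has_derivative E z) (at z)" if "z \<in> S" for z
      unfolding D_def E_def
      by (rule smooth_on_has_derivative [OF smooth_on_frechet_derivative [OF assms(3)] that])
    \<comment> \<open>The second difference is \<open>G t - G 0\<close>. One mean value step in
      direction \<open>u\<close> and one in direction \<open>v\<close> turn it into a second
      derivative at an intermediate point. The summand with factor 0 gives both terms the shape
      covered by \<open>inS\<close>.\<close>
    define G where "G s = f (x + s *\<^sub>R u + t *\<^sub>R v) - f (x + s *\<^sub>R u + 0 *\<^sub>R v)" for s
    have dG: "(G has_derivative (\<lambda>h. D (x + s *\<^sub>R u + t *\<^sub>R v) (h *\<^sub>R u) - D (x + s *\<^sub>R u + 0 *\<^sub>R v) (h *\<^sub>R u)))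
        (at s)" if "0 \<le> s" "s \<le> t" for s
      unfolding G_def
      by (intro has_derivative_diff has_derivative_compose [OF _ df])
        (use inS [OF that, of t] inS [OF that, of 0] t in \<open>auto intro!: derivative_eq_intros\<close>)
    have contG: "continuous_on {0..t} G"
      by (auto intro!: continuous_at_imp_continuous_on intro: has_derivative_continuous [OF dG])
    obtain \<xi> where \<xi>: "0 < \<xi>" "\<xi> < t" "G t - G 0 =
        D (x + \<xi> *\<^sub>R u + t *\<^sub>R v) ((t - 0) *\<^sub>R u) - D (x + \<xi> *\<^sub>R u + 0 *\<^sub>R v) ((t - 0) *\<^sub>R u)"
      by (rule mvt [OF t(1) contG dG]) simp_all
    define H where "H s = D (x + \<xi> *\<^sub>R u + s *\<^sub>R v) u" for s
    have dH: "(H has_derivative (\<lambda>h. E (x + \<xi> *\<^sub>R u + s *\<^sub>R v) (h *\<^sub>R v))) (at s)"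
      if "0 \<le> s" "s \<le> t" for s
      unfolding H_def
      by (rule has_derivative_compose [OF _ dD])
        (use inS [OF _ _ that, of \<xi>] \<xi> in \<open>auto intro!: derivative_eq_intros\<close>)
    have contH: "continuous_on {0..t} H"
      by (auto intro!: continuous_at_imp_continuous_on intro: has_derivative_continuous [OF dH])
    obtain \<eta> where \<eta>: "0 < \<eta>" "\<eta> < t" "H t - H 0 = E (x + \<xi> *\<^sub>R u + \<eta> *\<^sub>R v) ((t - 0) *\<^sub>R v)"
      by (rule mvt [OF t(1) contH dH]) simp_all
    have lD: "D z (c *\<^sub>R w) = c * D z w" if "z \<in> S" for z c w
      using linear_scale [OF smooth_on_linear [OF assms(3) that]] by (simp add: D_def)
    have lE: "E z (c *\<^sub>R w) = c * E z w" if "z \<in> S" for z c w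
      using linear_scale [OF smooth_on_linear [OF smooth_on_frechet_derivative [OF assms(3)] that]]
      by (simp add: D_def E_def)
    have S: "x + \<xi> *\<^sub>R u + t *\<^sub>R v \<in> S" "x + \<xi> *\<^sub>R u + 0 *\<^sub>R v \<in> S" "x + \<xi> *\<^sub>R u + \<eta> *\<^sub>R v \<in> S"
      using inS [of \<xi> t] inS [of \<xi> 0] inS [of \<xi> \<eta>] \<xi> \<eta> t by simp_all
    have "G t - G 0 = t * (H t - H 0)"
      unfolding \<xi>(3) lD [OF S(1)] lD [OF S(2)] H_def by (simp add: right_diff_distrib)
    also have "\<dots> = t * (t * E (x + \<xi> *\<^sub>R u + \<eta> *\<^sub>R v) v)"
      unfolding \<eta>(3) lE [OF S(3)] by simp
    finally have "f (x + t *\<^sub>R u + t *\<^sub>R v) - f (x + t *\<^sub>R u) - f (x + t *\<^sub>R v) + f x =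
        t * (t * E (x + \<xi> *\<^sub>R u + \<eta> *\<^sub>R v) v)"
      by (simp add: G_def)
    moreover have "norm ((x + \<xi> *\<^sub>R u + \<eta> *\<^sub>R v) - x) \<le> t * (norm u + norm v)"
      using bound [of \<xi> \<eta>] \<xi> \<eta> by (simp add: add.assoc)
    ultimately show "\<exists>y. norm (y - x) \<le> t * (norm u + norm v) \<and>
      f (x + t *\<^sub>R u + t *\<^sub>R v) - f (x + t *\<^sub>R u) - f (x + t *\<^sub>R v) + f x =
      t * (t * frechet_derivative (\<lambda>z. frechet_derivative f (at z) u) (at y) v)"
      unfolding E_def D_def by blast
  qed
qed

text \<open>The second difference does not change when \<open>u\<close> and \<open>v\<close> are
  exchanged. Hence the two mixed derivatives agree at suitable points arbitrarily near
  \<open>x\<close>, and continuity carries this over to \<open>x\<close>.\<close>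

lemma frechet_derivative_symmetric:
  fixes f :: "'a::real_normed_vector \<Rightarrow> real"
  assumes "open S" "x \<in> S" "smooth_on S f"
  shows "frechet_derivative (\<lambda>z. frechet_derivative f (at z) u) (at x) v =
    frechet_derivative (\<lambda>z. frechet_derivative f (at z) v) (at x) u"
proof (rule ccontr)
  define E where "E u v y = frechet_derivative (\<lambda>z. frechet_derivative f (at z) u) (at y) v" for u v y
  assume "\<not> ?thesis"
  then have "\<bar>E u v x - E v u x\<bar> > 0" (is "?e > 0") by (simp add: E_def)
  have "isCont (E a b) x" for a b
    using smooth_on_imp_continuous_on [OF smooth_on_frechet_derivative
      [OF smooth_on_frechet_derivative [OF assms(3)]]] assms(1,2)
    by (simp add: E_def [abs_def] continuous_on_eq_continuous_at)
  then have cont: "\<forall>\<epsilon>>0. \<exists>d>0. \<forall>y. norm (y - x) < d \<longrightarrow> \<bar>E a b y - E a b x\<bar> < \<epsilon>" for a b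
    unfolding continuous_at_eps_delta dist_norm by simp
  have "?e / 2 > 0" using \<open>?e > 0\<close> by simp
  then have "\<exists>d>0. \<forall>y. norm (y - x) < d \<longrightarrow> \<bar>E a b y - E a b x\<bar> < ?e / 2" for a b
    by (rule cont [THEN spec, THEN mp])
  then obtain d where d: "d a b > 0" "\<And>y. norm (y - x) < d a b \<Longrightarrow> \<bar>E a b y - E a b x\<bar> < ?e / 2" for a b
    by metis
  obtain r1 where r1: "r1 > 0" "\<And>t. 0 < t \<Longrightarrow> t < r1 \<Longrightarrow>
    \<exists>y. norm (y - x) \<le> t * (norm u + norm v) \<and>
      f (x + t *\<^sub>R u + t *\<^sub>R v) - f (x + t *\<^sub>R u) - f (x + t *\<^sub>R v) + f x = t * (t * E u v y)"
    unfolding E_def using second_difference_mean_value [OF assms, of u v] by blast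
  obtain r2 where r2: "r2 > 0" "\<And>t. 0 < t \<Longrightarrow> t < r2 \<Longrightarrow>
    \<exists>y. norm (y - x) \<le> t * (norm v + norm u) \<and>
      f (x + t *\<^sub>R v + t *\<^sub>R u) - f (x + t *\<^sub>R v) - f (x + t *\<^sub>R u) + f x = t * (t * E v u y)"
    unfolding E_def using second_difference_mean_value [OF assms, of v u] by blast
  define K where "K = norm u + norm v + 1"
  have K: "K > 0" by (simp add: K_def add_nonneg_pos)
  \<comment> \<open>Below both radii and small enough that both intermediate points fall within the
    continuity radii for half of the supposed gap.\<close>
  define t where "t = min (min r1 r2) (min (d u v) (d v u) / K) / 2"
  have t: "0 < t" "t < r1" "t < r2" using r1(1) r2(1) d(1) K by (auto simp: t_def)
  have "t < min (d u v) (d v u) / K"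
    using r1(1) r2(1) d(1) [of u v] d(1) [of v u] K by (auto simp: t_def min_def field_simps)
  then have "t * K < min (d u v) (d v u)" using K by (simp add: pos_less_divide_eq)
  then have tK: "t * (norm u + norm v) < d u v" "t * (norm u + norm v) < d v u"
    using t(1) by (auto simp: K_def distrib_left)
  obtain y1 where y1: "norm (y1 - x) \<le> t * (norm u + norm v)"
      "f (x + t *\<^sub>R u + t *\<^sub>R v) - f (x + t *\<^sub>R u) - f (x + t *\<^sub>R v) + f x = t * (t * E u v y1)"
    using r1(2) t by blast
  obtain y2 where y2: "norm (y2 - x) \<le> t * (norm u + norm v)"
      "f (x + t *\<^sub>R v + t *\<^sub>R u) - f (x + t *\<^sub>R v) - f (x + t *\<^sub>R u) + f x = t * (t * E v u y2)"
    using r2(2) t by (metis add.commute)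
  have "x + t *\<^sub>R v + t *\<^sub>R u = x + t *\<^sub>R u + t *\<^sub>R v" by (simp add: ac_simps)
  then have "f (x + t *\<^sub>R v + t *\<^sub>R u) = f (x + t *\<^sub>R u + t *\<^sub>R v)" by (rule arg_cong)
  then have "t * (t * E u v y1) = t * (t * E v u y2)" using y1(2) y2(2) by linarith
  then have "E u v y1 = E v u y2" using t(1) by simp
  moreover have "\<bar>E u v y1 - E u v x\<bar> < ?e / 2" "\<bar>E v u y2 - E v u x\<bar> < ?e / 2"
    using d(2) y1(1) y2(1) tK by (meson order.strict_trans1)+
  ultimately show False by (simp add: abs_if split: if_splits)
qed

section \<open>Smooth local sections\<close>

text \<open>Solving \<open>f x = y\<close> means finding a fixed point of x - C (f x - y), where
  \<open>C\<close> inverts the derivative at \<open>x0\<close>. On a small closed ball this map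
  contracts by 1/2, and the solution is then differentiated.\<close>

lemma smooth_inverse_function:
  fixes f :: "'a::finite_dim_inner \<Rightarrow> 'a"
  assumes "open U" "x0 \<in> U" "smooth_on U f"
    and C: "linear C" "\<And>v. C (frechet_derivative f (at x0) v) = v"
      "\<And>v. frechet_derivative f (at x0) (C v) = v"
  obtains W g where "open W" "f x0 \<in> W" "smooth_on W g" "g (f x0) = x0"
    "\<And>y. y \<in> W \<Longrightarrow> g y \<in> U" "\<And>y. y \<in> W \<Longrightarrow> f (g y) = y"
proof -
  define A where "A x = frechet_derivative f (at x)" for x
  have df: "(f has_derivative A x) (at x)" if "x \<in> U" for x
    unfolding A_def by (rule smooth_on_has_derivative [OF assms(3) that])
  have lA: "linear (A x)" if "x \<in> U" for x
    unfolding A_def by (rule smooth_on_linear [OF assms(3) that])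
  have bC: "bounded_linear C" by (rule linear_imp_bounded_linear [OF C(1)])
  \<comment> \<open>A continuous upper bound for the operator norm of \<open>id - C (A x)\<close>;
    it vanishes at \<open>x0\<close>, so it stays below 1/2 on a closed ball.\<close>
  define E where "E x = (\<Sum>b\<in>onb. norm (b - C (A x b)))" for x
  have "continuous_on U E"
    unfolding E_def A_def
    by (intro continuous_intros bounded_linear.continuous_on [OF bC]
        smooth_on_imp_continuous_on [OF smooth_on_frechet_derivative] assms(3))
  then have "open (U \<inter> E -` {..<1/2})"
    by (rule continuous_open_preimage [OF _ assms(1)]) simp
  moreover have "x0 \<in> U \<inter> E -` {..<1/2}"
    using assms(2) C(2) by (simp add: E_def A_def)
  ultimately obtain r where "r > 0" "cball x0 r \<subseteq> U \<inter> E -` {..<1/2}"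
    using open_contains_cball by blast
  then have r: "r > 0" "cball x0 r \<subseteq> U" "\<And>x. x \<in> cball x0 r \<Longrightarrow> E x < 1/2"
    by auto
  define B where "B = cball x0 r"
  have x0B: "x0 \<in> B" and BU: "\<And>x. x \<in> B \<Longrightarrow> x \<in> U" using r by (auto simp: B_def)
  have near: "norm (v - C (A x v)) \<le> 1/2 * norm v" if "x \<in> B" for x v
  proof -
    have "linear (\<lambda>v. v - C (A x v))"
      using linear_compose_sub [OF linear_id linear_compose [OF lA [OF BU [OF that]] C(1)]]
      by (simp add: id_def o_def)
    from norm_linear_le_sum_onb [OF this, of v]
    have "norm (v - C (A x v)) \<le> E x * norm v" by (simp add: E_def)
    also have "\<dots> \<le> 1/2 * norm v"
      using r(3) [of x] that by (intro mult_right_mono) (auto simp: B_def)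
    finally show ?thesis .
  qed
  define h where "h x = x - C (f x)" for x
  have lip: "norm (h x - h x') \<le> 1/2 * norm (x - x')" if "x \<in> B" "x' \<in> B" for x x'
  proof (rule differentiable_bound [OF _ _ _ that])
    show "convex B" by (simp add: B_def)
    fix z assume z: "z \<in> B"
    have "(h has_derivative (\<lambda>v. v - C (A z v))) (at z)"
      unfolding h_def
      by (intro has_derivative_diff has_derivative_ident bounded_linear.has_derivative [OF bC] df BU z)
    then show "(h has_derivative (\<lambda>v. v - C (A z v))) (at z within B)"
      by (rule has_derivative_at_withinI)
    show "onorm (\<lambda>v. v - C (A z v)) \<le> 1/2"
      by (rule onorm_bound) (use near [OF z] in auto)
  qed
  \<comment> \<open>The contraction moves points of the ball to within r/2 of \<open>h x0\<close>,
    which leaves r/2 for the displacement by \<open>y\<close>.\<close>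
  define W where "W = {y. norm (C (y - f x0)) < r / 2}"
  have "open W"
    unfolding W_def
    by (intro open_Collect_less continuous_intros bounded_linear.continuous_on [OF bC])
  have C0: "C v = 0 \<longleftrightarrow> v = 0" for v
    using C(3) [of v] linear_0 [OF C(1)] linear_0 [OF lA [OF assms(2)]] by (auto simp: A_def)
  have fp: "h x + C y = x \<longleftrightarrow> f x = y" for x y
    using C0 [of "y - f x"] by (auto simp: h_def linear_diff [OF C(1)] algebra_simps)
  have "\<exists>!x. x \<in> B \<and> h x + C y = x" if "y \<in> W" for y
  proof (rule Banach_fix [of B "1/2"])
    show "complete B"
      unfolding B_def by (rule complete_closed_subset [OF _ _ complete_UNIV_finite_dim]) auto
    show "(\<lambda>x. h x + C y) ` B \<subseteq> B"
    proof clarify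
      fix x assume x: "x \<in> B"
      have "h x + C y - x0 = (h x - h x0) + C (y - f x0)"
        by (simp add: h_def linear_diff [OF C(1)])
      then have "norm (h x + C y - x0) \<le> norm (h x - h x0) + norm (C (y - f x0))"
        by (metis norm_triangle_ineq)
      also have "\<dots> \<le> 1/2 * r + r/2"
        using lip [OF x x0B] that x
        by (intro add_mono) (auto simp: W_def B_def dist_norm norm_minus_commute intro: order.trans)
      finally show "h x + C y \<in> B" by (simp add: B_def dist_norm norm_minus_commute)
    qed
  qed (use x0B lip in \<open>auto simp: dist_norm\<close>)
  then have ex1: "\<exists>!x. x \<in> B \<and> f x = y" if "y \<in> W" for y
    using that by (simp add: fp)
  define g where "g y = (THE x. x \<in> B \<and> f x = y)" for y
  have g: "g y \<in> B" "f (g y) = y" if "y \<in> W" for y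
    using theI' [OF ex1 [OF that]] by (auto simp: g_def)
  have fx0: "f x0 \<in> W" using r(1) by (simp add: W_def linear_0 [OF C(1)])
  have gx0: "g (f x0) = x0" using g [OF fx0] ex1 [OF fx0] x0B by blast
  have glip: "norm (g y - g y') \<le> 2 * norm (C (y - y'))" if "y \<in> W" "y' \<in> W" for y y'
  proof -
    have "g y - g y' = (h (g y) - h (g y')) + C (y - y')"
      using g(2) that by (simp add: h_def linear_diff [OF C(1)])
    then have "norm (g y - g y') \<le> norm (h (g y) - h (g y')) + norm (C (y - y'))"
      by (metis norm_triangle_ineq)
    then show ?thesis using lip [OF g(1) g(1), OF that] by simp
  qed
  have cg: "isCont g y" if "y \<in> W" for y
  proof -
    have "((\<lambda>z. 2 * norm (C (z - y))) \<longlongrightarrow> 2 * norm (C (y - y))) (at y)"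
      by (intro tendsto_intros bounded_linear.tendsto [OF bC])
    then have lim: "((\<lambda>z. 2 * norm (C (z - y))) \<longlongrightarrow> 0) (at y)" by (simp add: linear_0 [OF C(1)])
    have "\<forall>\<^sub>F z in at y. z \<in> W" using \<open>open W\<close> that eventually_at_in_open' by blast
    then have "\<forall>\<^sub>F z in at y. norm (g z - g y) \<le> 2 * norm (C (z - y))"
      by eventually_elim (rule glip [OF _ that])
    from Lim_null_comparison [OF this lim] show ?thesis by (simp add: isCont_def LIM_zero_iff)
  qed
  \<comment> \<open>The derivative is invertible on all of \<open>B\<close>, not just at
    \<open>x0\<close>. Injectivity is immediate from \<open>near\<close>; surjectivity comes from
    the same contraction applied to the linear equation.\<close>
  have "\<exists>I. linear I \<and> (\<forall>v. I (A x v) = v) \<and> (\<forall>v. A x (I v) = v)" if x: "x \<in> B" for x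
  proof -
    note l = lA [OF BU [OF x]]
    have "v = 0" if "A x v = 0" for v
      using near [OF x, of v] that by (simp add: linear_0 [OF C(1)])
    then have "inj (A x)" using linear_injective_0 [OF l] by blast
    then obtain I where I: "linear I" "I \<circ> A x = id"
      using linear_injective_left_inverse [OF l] by blast
    have "\<exists>w. A x w = v" for v
    proof -
      have "\<exists>!w. w \<in> UNIV \<and> w - C (A x w) + C v = w"
      proof (rule Banach_fix [of UNIV "1/2"])
        fix w w' :: 'a
        have "(w - C (A x w) + C v) - (w' - C (A x w') + C v) = (w - w') - C (A x (w - w'))"
          by (simp add: linear_diff [OF l] linear_diff [OF C(1)])
        then show "dist (w - C (A x w) + C v) (w' - C (A x w') + C v) \<le> 1/2 * dist w w'"
          using near [OF x, of "w - w'"] by (simp only: dist_norm)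
      qed (auto simp: complete_UNIV_finite_dim)
      then obtain w where "w - C (A x w) + C v = w" by blast
      then have "C (v - A x w) = 0" by (simp add: linear_diff [OF C(1)] algebra_simps)
      then show ?thesis using C0 [of "v - A x w"] by auto
    qed
    then have "A x (I v) = v" for v using I(2) by (metis comp_apply id_apply)
    then show ?thesis using I by (metis comp_apply id_apply)
  qed
  then have "\<exists>I. \<forall>x\<in>B. linear (I x) \<and> (\<forall>v. I x (A x v) = v) \<and> (\<forall>v. A x (I x v) = v)"
    by (intro bchoice) blast
  then obtain I where I: "\<And>x. x \<in> B \<Longrightarrow> linear (I x)"
    "\<And>x v. x \<in> B \<Longrightarrow> I x (A x v) = v" "\<And>x v. x \<in> B \<Longrightarrow> A x (I x v) = v"
    by blast
  have dg: "(g has_derivative I (g y)) (at y)" if "y \<in> W" for y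
  proof (rule has_derivative_inverse_basic [OF df _ _ cg \<open>open W\<close>])
    show "g y \<in> U" by (rule BU [OF g(1) [OF that]])
    show "bounded_linear (I (g y))" by (rule linear_imp_bounded_linear [OF I(1) [OF g(1) [OF that]]])
    show "I (g y) \<circ> A (g y) = id" using I(2) [OF g(1) [OF that]] by auto
  qed (use that g in auto)
  \<comment> \<open>Bootstrapping: the derivative of \<open>g\<close> at \<open>y\<close> is the
    inverse of \<open>A (g y)\<close>, hence as regular as \<open>g\<close> itself, and so
    \<open>g\<close> gains one order.\<close>
  have "Ck_on k W g" for k
  proof (induction k)
    case 0
    then show ?case using cg by (simp add: continuous_at_imp_continuous_on)
  next
    case (Suc k)
    show ?case
    proof (rule Ck_on_SucI [OF \<open>open W\<close> dg])
      show "Ck_on k W (\<lambda>y. I (g y) v)" for v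
      proof (rule Ck_on_inverse [OF \<open>open W\<close>, where A = "\<lambda>y. A (g y)"])
        show "Ck_on k W (\<lambda>y. A (g y) b)" for b
          using smooth_on_frechet_derivative [OF assms(3), of b] g(1) BU
          by (intro Ck_on_compose [OF \<open>open W\<close> assms(1) _ Suc]) (auto simp: smooth_on_def A_def)
      qed (use g(1) BU lA I in auto)
    qed
  qed
  then have "smooth_on W g" by (simp add: smooth_on_def)
  from that [OF \<open>open W\<close> fx0 this gx0 BU [OF g(1)] g(2)] show thesis by simp
qed

text \<open>Applying the inverse function theorem to \<open>(e, y) \<mapsto> (e, F (e\<^sub>0 + e + R y))\<close> for a right inverse
  \<open>R\<close> of the differential yields a family of local sections of \<open>F\<close> through all points near \<open>e\<^sub>0\<close>.\<close>

lemma smooth_submersion_sections: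
  fixes F :: "'a::finite_dim_inner \<Rightarrow> 'b::finite_dim_inner"
  assumes "open U" "e0 \<in> U" "smooth_on U F" "surj (frechet_derivative F (at e0))"
  obtains W S R where "open W" "(0, F e0) \<in> W" "smooth_on W S" "S (0, F e0) = e0"
    "\<And>z. z \<in> W \<Longrightarrow> S z \<in> U" "\<And>z. z \<in> W \<Longrightarrow> F (S z) = snd z" "linear R"
    "(S has_derivative (\<lambda>z. fst z + R (snd z - frechet_derivative F (at e0) (fst z)))) (at (0, F e0))"
proof -
  define D where "D = frechet_derivative F (at e0)"
  have lD: "linear D" unfolding D_def by (rule smooth_on_linear [OF assms(3,2)])
  obtain R where R: "linear R" "\<And>v. D (R v) = v"
    using linear_surjective_right_inverse [OF lD] assms(4)
    by (metis D_def comp_apply id_apply)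
  have bR: "bounded_linear (\<lambda>z::'a \<times> 'b. R (snd z))"
    by (rule bounded_linear_compose [OF linear_imp_bounded_linear [OF R(1)] bounded_linear_snd])
  define p where "p z = e0 + (fst z + R (snd z))" for z
  have dp: "(p has_derivative (\<lambda>z. fst z + R (snd z))) (at z)" for z
    unfolding p_def by (auto intro!: derivative_eq_intros bounded_linear_imp_has_derivative bR)
  have sp: "smooth_on V p" if "open V" for V
    unfolding p_def by (intro smooth_on_add smooth_on_const smooth_on_bounded_linear bR bounded_linear_fst that)
  define V where "V = p -` U"
  have "open V"
    unfolding V_def by (intro open_vimage assms(1) smooth_on_imp_continuous_on sp) simp
  define \<Psi> where "\<Psi> z = (fst z, F (p z))" for z
  have s\<Psi>: "smooth_on V \<Psi>"
    unfolding \<Psi>_def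
    by (intro smooth_on_Pair smooth_on_bounded_linear bounded_linear_fst \<open>open V\<close>
        smooth_on_compose [OF \<open>open V\<close> assms(1) _ sp assms(3)]) (auto simp: V_def)
  have p0: "p (0, 0) = e0" by (simp add: p_def linear_0 [OF R(1)])
  have dF: "(F has_derivative D) (at (p (0, 0)))"
    unfolding p0 D_def by (rule smooth_on_has_derivative [OF assms(3,2)])
  have d\<Psi>: "(\<Psi> has_derivative (\<lambda>z. (fst z, D (fst z) + snd z))) (at (0, 0))"
    unfolding \<Psi>_def
    using has_derivative_Pair [OF bounded_linear_imp_has_derivative [OF bounded_linear_fst]
        has_derivative_compose [OF dp dF]]
    by (simp add: linear_add [OF lD] R(2))
  have f\<Psi>: "frechet_derivative \<Psi> (at (0, 0)) = (\<lambda>z. (fst z, D (fst z) + snd z))"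
    using frechet_derivative_at [OF d\<Psi>] by simp
  have \<Psi>0: "\<Psi> (0, 0) = (0, F e0)" by (simp add: \<Psi>_def p0)
  obtain W g where W: "open W" "\<Psi> (0, 0) \<in> W" "smooth_on W g" "g (\<Psi> (0, 0)) = (0, 0)"
    "\<And>y. y \<in> W \<Longrightarrow> g y \<in> V" "\<And>y. y \<in> W \<Longrightarrow> \<Psi> (g y) = y"
  proof (rule smooth_inverse_function [OF \<open>open V\<close> _ s\<Psi>, of "(0, 0)" "\<lambda>z. (fst z, snd z - D (fst z))"])
    show "linear (\<lambda>z. (fst z, snd z - D (fst z)))"
      by (rule linearI) (auto simp: linear_add [OF lD] linear_scale [OF lD] algebra_simps)
  qed (auto simp: f\<Psi> V_def p0 assms(2))
  \<comment> \<open>Differentiating \<open>\<Psi> (g y) = y\<close> determines the derivative of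
    \<open>g\<close>. This yields the explicit derivative of the family of sections, from which the
    velocity of a lifted curve is computed later.\<close>
  define L where "L = frechet_derivative g (at (0, F e0))"
  have dg: "(g has_derivative L) (at (0, F e0))"
    unfolding L_def by (rule smooth_on_has_derivative [OF W(3)]) (use W(2) \<Psi>0 in simp)
  have "((\<lambda>y. \<Psi> (g y)) has_derivative (\<lambda>z. (fst (L z), D (fst (L z)) + snd (L z)))) (at (0, F e0))"
    by (rule has_derivative_compose [OF dg]) (use W(4) \<Psi>0 d\<Psi> in simp)
  then have "((\<lambda>y. y) has_derivative (\<lambda>z. (fst (L z), D (fst (L z)) + snd (L z)))) (at (0, F e0))"
    by (rule has_derivative_transform_within_open [OF _ W(1)]) (use W \<Psi>0 in auto)
  then have "(\<lambda>z. (fst (L z), D (fst (L z)) + snd (L z))) = (\<lambda>z. z)"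
    using has_derivative_unique has_derivative_ident by blast
  then have L: "fst (L z) = fst z" "snd (L z) = snd z - D (fst z)" for z
    by (metis fst_conv, metis fst_conv snd_conv add_diff_cancel_left')
  show thesis
  proof (rule that [of W "\<lambda>z. p (g z)" R])
    show "smooth_on W (\<lambda>z. p (g z))"
      by (rule smooth_on_compose [OF W(1) open_UNIV _ W(3) sp]) auto
    show "((\<lambda>z. p (g z)) has_derivative
        (\<lambda>z. fst z + R (snd z - frechet_derivative F (at e0) (fst z)))) (at (0, F e0))"
      using has_derivative_compose [OF dg dp] by (simp add: L D_def)
    show "F (p (g z)) = snd z" if "z \<in> W" for z
      using W(6) [OF that] by (metis \<Psi>_def snd_conv)
  qed (use W \<Psi>0 p0 R V_def in auto)
qed

section \<open>Charts and derivatives of maps in charts\<close>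

lemma smooth_on_eq:
  "open S \<Longrightarrow> smooth_on S f \<Longrightarrow> (\<And>x. x \<in> S \<Longrightarrow> f x = g x) \<Longrightarrow> smooth_on S g"
  using smooth_on_cong by blast

definition wf_chart :: "('m::topological_space, 'e::finite_dim_inner) chart \<Rightarrow> bool"
  where "wf_chart c \<longleftrightarrow> open (fst c) \<and> open (snd c ` fst c) \<and>
    homeomorphism (fst c) (snd c ` fst c) (snd c) (chart_inv c)"

lemma wf_chart_at:
  "smooth_manifold M \<Longrightarrow> chart_at M p \<in> charts M"
  "smooth_manifold M \<Longrightarrow> p \<in> fst (chart_at M p)"
  by (auto simp: smooth_manifold_def)

lemma smooth_manifold_wf_chart: "smooth_manifold M \<Longrightarrow> c \<in> charts M \<Longrightarrow> wf_chart c"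
  by (auto simp: smooth_manifold_def wf_chart_def)

lemma chart_inv_chart: "wf_chart c \<Longrightarrow> p \<in> fst c \<Longrightarrow> chart_inv c (snd c p) = p"
  by (auto simp: wf_chart_def homeomorphism_def)

lemma chart_chart_inv: "wf_chart c \<Longrightarrow> y \<in> snd c ` fst c \<Longrightarrow> snd c (chart_inv c y) = y"
  by (auto simp: wf_chart_def homeomorphism_def)

lemma chart_inv_in: "wf_chart c \<Longrightarrow> y \<in> snd c ` fst c \<Longrightarrow> chart_inv c y \<in> fst c"
  by (auto simp: wf_chart_def homeomorphism_def)

lemma chart_image_Int:
  assumes "wf_chart c"
  shows "snd c ` (fst c \<inter> A) = snd c ` fst c \<inter> chart_inv c -` A"
  using assms by (auto simp: chart_inv_chart image_iff intro!: bexI [of _ "chart_inv c _"])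

lemma open_chart_image:
  assumes "wf_chart c" "open A"
  shows "open (snd c ` (fst c \<inter> A))"
  unfolding chart_image_Int [OF assms(1)]
  using assms by (intro continuous_open_preimage) (auto simp: wf_chart_def homeomorphism_def)

lemma isCont_chart_inv:
  assumes "wf_chart c" "y \<in> snd c ` fst c"
  shows "isCont (chart_inv c) y"
  using assms by (auto simp: wf_chart_def homeomorphism_def continuous_on_eq_continuous_at)

text \<open>\<open>tmap\<close>, \<open>to_chart\<close>, \<open>from_chart\<close> and
  \<open>d0\<close> are all instances, with \<open>f\<close> the identity or with the trivial chart
  of the reals as target. One chain rule therefore covers all changes of coordinates.\<close>

definition mderiv ::
    "('n, 'f::real_normed_vector) chart \<Rightarrow> ('m, 'e::real_normed_vector) chart \<Rightarrow> ('n \<Rightarrow> 'm) \<Rightarrow>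
     'n \<Rightarrow> 'f \<Rightarrow> 'e"
  where "mderiv c d f p = frechet_derivative (snd d \<circ> f \<circ> chart_inv c) (at (snd c p))"

text \<open>Continuity of \<open>f\<close> is demanded separately: differentiability of the chart
  expression alone does not ensure that \<open>f\<close> maps a neighbourhood of \<open>p\<close>
  into the domain of \<open>d\<close>.\<close>

definition mdiff ::
    "('n::t2_space, 'f::real_normed_vector) chart \<Rightarrow>
     ('m::t2_space, 'e::real_normed_vector) chart \<Rightarrow> ('n \<Rightarrow> 'm) \<Rightarrow> 'n \<Rightarrow> bool"
  where "mdiff c d f p \<longleftrightarrow> p \<in> fst c \<and> f p \<in> fst d \<and> isCont f p \<and>
    (snd d \<circ> f \<circ> chart_inv c) differentiable (at (snd c p))"

lemma mdiff_has_derivative: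
  "mdiff c d f p \<Longrightarrow> ((snd d \<circ> f \<circ> chart_inv c) has_derivative mderiv c d f p) (at (snd c p))"
  by (simp add: mdiff_def mderiv_def frechet_derivative_works)

lemma linear_mderiv: "mdiff c d f p \<Longrightarrow> linear (mderiv c d f p)"
  by (simp add: mdiff_def mderiv_def linear_frechet_derivative)

lemma mdiff_compose:
  assumes "wf_chart c" "wf_chart d" "mdiff c d f p" "mdiff d e g (f p)"
  shows "mdiff c e (g \<circ> f) p" and "mderiv c e (g \<circ> f) p v = mderiv d e g (f p) (mderiv c d f p v)"
proof -
  have p: "p \<in> fst c" "f p \<in> fst d" "isCont f p" and gp: "g (f p) \<in> fst e" "isCont g (f p)"
    using assms(3,4) by (auto simp: mdiff_def)
  let ?y = "snd c p"
  have y: "?y \<in> snd c ` fst c" using p(1) by simp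
  have ci: "chart_inv c ?y = p" by (rule chart_inv_chart [OF assms(1) p(1)])
  have "isCont (\<lambda>y. f (chart_inv c y)) ?y"
    using isCont_o2 [OF isCont_chart_inv [OF assms(1) y]] p(3) ci by simp
  then have "((\<lambda>y. f (chart_inv c y)) \<longlongrightarrow> f p) (at ?y)"
    by (simp add: isCont_def ci)
  \<comment> \<open>The middle chart cancels against its inverse only where \<open>f\<close> stays
    in the domain of \<open>d\<close>, that is, near the point.\<close>
  then have ev: "\<forall>\<^sub>F y in at ?y. f (chart_inv c y) \<in> fst d"
    by (rule topological_tendstoD) (use assms(2) p in \<open>auto simp: wf_chart_def\<close>)
  have "((\<lambda>y. (snd e \<circ> g \<circ> chart_inv d) ((snd d \<circ> f \<circ> chart_inv c) y)) has_derivative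
      (\<lambda>v. mderiv d e g (f p) (mderiv c d f p v))) (at ?y)"
    by (rule has_derivative_compose [OF mdiff_has_derivative [OF assms(3)]])
      (use mdiff_has_derivative [OF assms(4)] ci in \<open>simp add: comp_def\<close>)
  then have der: "((snd e \<circ> (g \<circ> f) \<circ> chart_inv c) has_derivative
      (\<lambda>v. mderiv d e g (f p) (mderiv c d f p v))) (at ?y)"
  proof (rule has_derivative_transform_eventually)
    show "\<forall>\<^sub>F y in at ?y. (snd e \<circ> g \<circ> chart_inv d) ((snd d \<circ> f \<circ> chart_inv c) y) =
        (snd e \<circ> (g \<circ> f) \<circ> chart_inv c) y"
      using ev by eventually_elim (simp add: chart_inv_chart [OF assms(2)])
  qed (use p ci chart_inv_chart [OF assms(2)] in auto)
  then show "mderiv c e (g \<circ> f) p v = mderiv d e g (f p) (mderiv c d f p v)"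
    unfolding mderiv_def [of c e] using frechet_derivative_at by metis
  show "mdiff c e (g \<circ> f) p"
    unfolding mdiff_def
    using p gp der by (auto simp: continuous_at_compose differentiable_def)
qed

lemma smooth_map_on_rep:
  assumes "smooth_map_on N M U f" "c \<in> charts N" "d \<in> charts M"
  shows "smooth_on (snd c ` (fst c \<inter> (U \<inter> f -` fst d))) (snd d \<circ> f \<circ> chart_inv c)"
  using assms by (simp add: smooth_map_on_def Int_assoc)

lemma smooth_map_rep:
  assumes "smooth_map N M f" "c \<in> charts N" "d \<in> charts M"
  shows "smooth_on (snd c ` (fst c \<inter> f -` fst d)) (snd d \<circ> f \<circ> chart_inv c)"
  using smooth_map_on_rep [OF assms] by simp

lemma smooth_map_on_mdiff:
  assumes "smooth_map_on N M U f" "c \<in> charts N" "d \<in> charts M" "p \<in> U" "p \<in> fst c" "f p \<in> fst d"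
  shows "mdiff c d f p"
proof -
  have "isCont f p"
    using assms(1,4) by (auto simp: smooth_map_on_def continuous_on_eq_continuous_at)
  moreover have "(snd d \<circ> f \<circ> chart_inv c) differentiable (at (snd c p))"
    by (rule smooth_on_imp_differentiable [OF smooth_map_on_rep [OF assms(1-3)]]) (use assms in auto)
  ultimately show ?thesis using assms by (simp add: mdiff_def)
qed

lemma smooth_map_open_vimage: "smooth_map N M f \<Longrightarrow> open A \<Longrightarrow> open (f -` A)"
  by (rule open_vimage) (auto simp: smooth_map_on_def)

lemma smooth_transition:
  assumes "smooth_manifold M" "c \<in> charts M" "d \<in> charts M"
  shows "smooth_on (snd c ` (fst c \<inter> fst d)) (snd d \<circ> chart_inv c)"
  using assms by (simp add: smooth_manifold_def)

lemma mdiff_id: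
  assumes "smooth_manifold M" "c \<in> charts M" "d \<in> charts M" "p \<in> fst c" "p \<in> fst d"
  shows "mdiff c d id p"
proof -
  have "(snd d \<circ> chart_inv c) differentiable (at (snd c p))"
    by (rule smooth_on_imp_differentiable [OF smooth_transition [OF assms(1-3)]]) (use assms in auto)
  then show ?thesis
    using assms by (simp add: mdiff_def id_def comp_def)
qed

lemma mderiv_id_same:
  assumes "wf_chart c" "p \<in> fst c"
  shows "mderiv c c id p v = v"
proof -
  have "((\<lambda>y. y) has_derivative (\<lambda>v. v)) (at (snd c p))" by (rule has_derivative_ident)
  then have "((snd c \<circ> id \<circ> chart_inv c) has_derivative (\<lambda>v. v)) (at (snd c p))"
    by (rule has_derivative_transform_within_open [of _ _ _ _ "snd c ` fst c"])
      (use assms in \<open>auto simp: wf_chart_def chart_inv_chart [OF assms(1)]\<close>)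
  then show ?thesis unfolding mderiv_def using frechet_derivative_at by metis
qed

lemma mderiv_id_id:
  assumes "smooth_manifold M" "c \<in> charts M" "d \<in> charts M" "p \<in> fst c" "p \<in> fst d"
  shows "mderiv d c id p (mderiv c d id p v) = v"
  using mdiff_compose(2) [of c d id p c id v] assms mdiff_id [OF assms(1)]
  by (simp add: smooth_manifold_wf_chart mderiv_id_same)

lemma to_chart_eq: "to_chart M c p = mderiv (chart_at M p) c id p"
  by (simp add: fun_eq_iff to_chart_def mderiv_def)

lemma from_chart_eq: "from_chart M c p = mderiv c (chart_at M p) id p"
  by (simp add: fun_eq_iff from_chart_def mderiv_def)

lemma tmap_eq: "tmap N M f p = mderiv (chart_at N p) (chart_at M (f p)) f p"
  by (simp add: fun_eq_iff tmap_def mderiv_def)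

lemma smooth_map_mdiff:
  assumes "smooth_map N M f" "c \<in> charts N" "d \<in> charts M" "p \<in> fst c" "f p \<in> fst d"
  shows "mdiff c d f p"
  by (rule smooth_map_on_mdiff [OF assms(1-3)]) (use assms in auto)

lemma d0_eq: "d0 M f p = mderiv (chart_at M p) (UNIV, \<lambda>x. x) f p"
  by (simp add: d0_def mderiv_def fun_eq_iff comp_def)

lemma vec_fieldsD: 
  assumes "X \<in> vec_fields M" "c \<in> charts M"
  shows "smooth_on (snd c ` fst c) (vec_rep M c X)"
proof -
  have "smooth_on (snd c ` (fst c \<inter> (\<lambda>p. p) -` fst c))
      (\<lambda>y. to_chart M c (chart_inv c y) (X (chart_inv c y)))"
    using assms unfolding vec_fields_def vec_fields_along_def by blast
  then show ?thesis by (simp add: vec_rep_def [abs_def])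
qed

lemma forms1D:
  assumes "\<omega> \<in> forms1 M"
  shows "linear (\<omega> p)" and "c \<in> charts M \<Longrightarrow> smooth_on (snd c ` fst c) (\<lambda>y. form1_rep M c \<omega> y v)"
  using assms by (auto simp: forms1_def)

lemma smooth_funs_mdiff:
  assumes "f \<in> smooth_funs M" "c \<in> charts M" "p \<in> fst c"
  shows "mdiff c (UNIV, \<lambda>x. x) f p"
proof (rule smooth_map_on_mdiff)
  show "smooth_map M vec_manifold f" using assms(1) by (simp add: smooth_funs_def)
qed (use assms in \<open>auto simp: vec_manifold_def\<close>)

context
  fixes M :: "('m::{t2_space, second_countable_topology}, 'e::finite_dim_inner) manifold"
  assumes M: "smooth_manifold M"
begin

lemma from_chart_to_chart: "c \<in> charts M \<Longrightarrow> p \<in> fst c \<Longrightarrow> from_chart M c p (to_chart M c p v) = v"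
  unfolding to_chart_eq from_chart_eq by (rule mderiv_id_id [OF M]) (auto simp: wf_chart_at [OF M])

lemma to_chart_from_chart: "c \<in> charts M \<Longrightarrow> p \<in> fst c \<Longrightarrow> to_chart M c p (from_chart M c p v) = v"
  unfolding to_chart_eq from_chart_eq by (rule mderiv_id_id [OF M]) (auto simp: wf_chart_at [OF M])

lemma linear_from_chart: "c \<in> charts M \<Longrightarrow> p \<in> fst c \<Longrightarrow> linear (from_chart M c p)"
  unfolding from_chart_eq by (rule linear_mderiv [OF mdiff_id [OF M]]) (auto simp: wf_chart_at [OF M])

lemma to_chart_chart_at: "to_chart M (chart_at M p) p v = v"
  unfolding to_chart_eq
  by (rule mderiv_id_same [OF smooth_manifold_wf_chart [OF M]]) (auto simp: wf_chart_at [OF M])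

lemma from_chart_chart_at: "from_chart M (chart_at M p) p v = v"
  unfolding from_chart_eq
  by (rule mderiv_id_same [OF smooth_manifold_wf_chart [OF M]]) (auto simp: wf_chart_at [OF M])

lemma smooth_map_mdiff_chart_at:
  assumes "smooth_map N M f" "smooth_manifold N"
  shows "mdiff (chart_at N p) (chart_at M (f p)) f p"
  by (rule smooth_map_mdiff [OF assms(1)]) (auto simp: wf_chart_at [OF M] wf_chart_at [OF assms(2)])

lemma linear_tmap:
  assumes "smooth_map N M f" "smooth_manifold N"
  shows "linear (tmap N M f p)"
  unfolding tmap_eq by (rule linear_mderiv [OF smooth_map_mdiff_chart_at [OF assms]])

text \<open>Both sides are the derivative of \<open>f\<close> from \<open>chart_at N p\<close> to
  \<open>d\<close>, computed once through \<open>id \<circ> f\<close> and once through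
  \<open>f \<circ> id\<close>.\<close>

lemma to_chart_tmap:
  assumes "smooth_map N M f" "smooth_manifold N" "c \<in> charts N" "d \<in> charts M" "p \<in> fst c" "f p \<in> fst d"
  shows "to_chart M d (f p) (tmap N M f p v) = mderiv c d f p (to_chart N c p v)"
proof -
  note wf = smooth_manifold_wf_chart [OF M] smooth_manifold_wf_chart [OF assms(2)]
  note at = wf_chart_at [OF M] wf_chart_at [OF assms(2)]
  have "mderiv (chart_at N p) d (id \<circ> f) p v = to_chart M d (f p) (tmap N M f p v)"
    unfolding to_chart_eq tmap_eq
    by (rule mdiff_compose(2) [OF wf(2,1) smooth_map_mdiff mdiff_id]) (use assms at M in auto)
  moreover have "mderiv (chart_at N p) d (f \<circ> id) p v = mderiv c d f (id p) (to_chart N c p v)"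
    unfolding to_chart_eq
    by (rule mdiff_compose(2) [OF wf(2,2) mdiff_id smooth_map_mdiff]) (use assms at M in auto)
  ultimately show ?thesis by simp
qed

lemma tmap_from_chart:
  assumes "smooth_map N M f" "smooth_manifold N" "c \<in> charts N" "d \<in> charts M" "p \<in> fst c" "f p \<in> fst d"
  shows "tmap N M f p (from_chart N c p v) = from_chart M d (f p) (mderiv c d f p v)"
proof -
  note wf = smooth_manifold_wf_chart [OF M] smooth_manifold_wf_chart [OF assms(2)]
  note at = wf_chart_at [OF M] wf_chart_at [OF assms(2)]
  have "mderiv c (chart_at M (f p)) (id \<circ> f) p v = from_chart M d (f p) (mderiv c d f p v)"
    unfolding from_chart_eq
    by (rule mdiff_compose(2) [OF wf(2,1) smooth_map_mdiff mdiff_id]) (use assms at M in auto)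
  moreover have "mderiv c (chart_at M (f p)) (f \<circ> id) p v =
      tmap N M f (id p) (from_chart N c p v)"
    unfolding from_chart_eq tmap_eq id_apply
    by (rule mdiff_compose(2) [OF wf(2,2) mdiff_id smooth_map_mdiff, unfolded id_apply])
      (use assms at M in auto)
  ultimately show ?thesis by simp
qed

section \<open>Functions, vector fields and forms in charts\<close>

text \<open>Continuity is a separate clause of \<open>smooth_map_on\<close>; for real functions it
  is recovered from the chart expressions, because charts are homeomorphisms.\<close>

lemma smooth_funs_iff:
  "f \<in> smooth_funs M \<longleftrightarrow> (\<forall>c\<in>charts M. smooth_on (snd c ` fst c) (f \<circ> chart_inv c))"
proof -
  have "continuous_on UNIV f" if *: "\<forall>c\<in>charts M. smooth_on (snd c ` fst c) (f \<circ> chart_inv c)"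
  proof -
    have "isCont f p" for p
    proof -
      define c where "c = chart_at M p"
      have c: "c \<in> charts M" "p \<in> fst c" using wf_chart_at [OF M] by (auto simp: c_def)
      note wf = smooth_manifold_wf_chart [OF M c(1)]
      have "continuous_on (snd c ` fst c) (f \<circ> chart_inv c)"
        using * c(1) smooth_on_imp_continuous_on by blast
      then have "continuous_on (fst c) (\<lambda>q. (f \<circ> chart_inv c) (snd c q))"
        by (rule continuous_on_compose2) (use wf in \<open>auto simp: wf_chart_def homeomorphism_def\<close>)
      then have "continuous_on (fst c) f"
        by (rule continuous_on_eq) (simp add: chart_inv_chart [OF wf])
      then show ?thesis
        using c(2) wf by (simp add: wf_chart_def continuous_on_eq_continuous_at)
    qed
    then show ?thesis by (simp add: continuous_at_imp_continuous_on)
  qed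
  then show ?thesis
    by (auto simp: smooth_funs_def smooth_map_on_def vec_manifold_def comp_def)
qed

lemma open_chart_dom: "c \<in> charts M \<Longrightarrow> open (snd c ` fst c)"
  using smooth_manifold_wf_chart [OF M] by (auto simp: wf_chart_def)

lemma smooth_funs_add: "f \<in> smooth_funs M \<Longrightarrow> g \<in> smooth_funs M \<Longrightarrow> f + g \<in> smooth_funs M"
  by (simp add: smooth_funs_iff comp_def smooth_on_add open_chart_dom)

lemma smooth_funs_diff: "f \<in> smooth_funs M \<Longrightarrow> g \<in> smooth_funs M \<Longrightarrow> f - g \<in> smooth_funs M"
  by (simp add: smooth_funs_iff comp_def smooth_on_diff open_chart_dom)

lemma smooth_funs_scaleR: "f \<in> smooth_funs M \<Longrightarrow> r *\<^sub>R f \<in> smooth_funs M"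
  using smooth_on_scaleR_const [OF open_chart_dom, where 'b = real]
  by (simp add: smooth_funs_iff comp_def scaleR_fun_def)

lemma smooth_funs_zero: "0 \<in> smooth_funs M"
  by (simp add: smooth_funs_iff comp_def smooth_on_const open_chart_dom)

lemma linear_d0: "f \<in> smooth_funs M \<Longrightarrow> linear (d0 M f p)"
  unfolding d0_eq by (rule linear_mderiv [OF smooth_funs_mdiff]) (auto simp: wf_chart_at [OF M])

lemma d0_from_chart:
  assumes "f \<in> smooth_funs M" "c \<in> charts M" "p \<in> fst c"
  shows "d0 M f p (from_chart M c p v) = frechet_derivative (f \<circ> chart_inv c) (at (snd c p)) v"
proof -
  note wf = smooth_manifold_wf_chart [OF M] and at = wf_chart_at [OF M]
  have "mderiv c (UNIV, \<lambda>x. x) (f \<circ> id) p v =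
      mderiv (chart_at M p) (UNIV, \<lambda>x. x) f (id p) (mderiv c (chart_at M p) id p v)"
    by (rule mdiff_compose(2) [OF wf wf mdiff_id smooth_funs_mdiff]) (use assms at M in auto)
  then show ?thesis by (simp add: from_chart_eq d0_eq mderiv_def comp_def)
qed

lemma d0_add: "f \<in> smooth_funs M \<Longrightarrow> g \<in> smooth_funs M \<Longrightarrow> d0 M (f + g) = d0 M f + d0 M g"
proof (intro ext)
  fix p v assume "f \<in> smooth_funs M" "g \<in> smooth_funs M"
  from this [THEN smooth_funs_mdiff, THEN mdiff_has_derivative, OF wf_chart_at [OF M]]
  have "((f \<circ> chart_inv (chart_at M p)) has_derivative d0 M f p) (at (snd (chart_at M p) p))"
    "((g \<circ> chart_inv (chart_at M p)) has_derivative d0 M g p) (at (snd (chart_at M p) p))"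
    by (simp_all add: d0_eq comp_def)
  from has_derivative_add [OF this]
  have "((f + g \<circ> chart_inv (chart_at M p)) has_derivative (\<lambda>v. d0 M f p v + d0 M g p v))
      (at (snd (chart_at M p) p))" by (simp add: comp_def)
  from frechet_derivative_at [OF this]
  show "d0 M (f + g) p v = (d0 M f + d0 M g) p v"
    unfolding d0_def [of M "f + g"] by (simp add: fun_eq_iff)
qed

lemma d0_scaleR: "f \<in> smooth_funs M \<Longrightarrow> d0 M (r *\<^sub>R f) = r *\<^sub>R d0 M f"
proof (intro ext)
  fix p v assume "f \<in> smooth_funs M"
  from this [THEN smooth_funs_mdiff, THEN mdiff_has_derivative, OF wf_chart_at [OF M]]
  have "((f \<circ> chart_inv (chart_at M p)) has_derivative d0 M f p) (at (snd (chart_at M p) p))"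
    by (simp_all add: d0_eq comp_def)
  from has_derivative_scaleR_right [OF this, of r]
  have "((r *\<^sub>R f \<circ> chart_inv (chart_at M p)) has_derivative (\<lambda>v. r *\<^sub>R d0 M f p v))
      (at (snd (chart_at M p) p))" by (simp add: comp_def scaleR_fun_def)
  from frechet_derivative_at [OF this]
  show "d0 M (r *\<^sub>R f) p v = (r *\<^sub>R d0 M f) p v"
    unfolding d0_def [of M "r *\<^sub>R f"] by (simp add: fun_eq_iff scaleR_fun_def)
qed

lemma d0_diff: "f \<in> smooth_funs M \<Longrightarrow> g \<in> smooth_funs M \<Longrightarrow> d0 M (f - g) = d0 M f - d0 M g"
  using d0_add [of f "(-1) *\<^sub>R g"] d0_scaleR [of g "-1"] smooth_funs_scaleR [of g "-1"] by simp

text \<open>Membership quantifies over two independent charts. Diagonal pairs suffice: the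
  expression for \<open>c\<close> and \<open>d\<close> is the one for \<open>d\<close> alone,
  precomposed with the transition map.\<close>

lemma vec_fieldsI:
  assumes "\<And>c. c \<in> charts M \<Longrightarrow> smooth_on (snd c ` fst c) (vec_rep M c X)"
  shows "X \<in> vec_fields M"
  unfolding vec_fields_def vec_fields_along_def
proof (intro CollectI ballI)
  fix c d assume cd: "c \<in> charts M" "d \<in> charts M"
  note wf = smooth_manifold_wf_chart [OF M]
  let ?S = "snd c ` (fst c \<inter> fst d)"
  have S: "open ?S" by (rule open_chart_image) (use wf cd in \<open>auto simp: wf_chart_def\<close>)
  have "smooth_on ?S (\<lambda>y. vec_rep M d X ((snd d \<circ> chart_inv c) y))"
    by (rule smooth_on_compose [OF S open_chart_dom [OF cd(2)] _ smooth_transition [OF M cd] assms [OF cd(2)]])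
      (auto simp: chart_inv_chart [OF wf [OF cd(1)]])
  moreover have "vec_rep M d X ((snd d \<circ> chart_inv c) y) = to_chart M d (chart_inv c y) (X (chart_inv c y))"
    if "y \<in> ?S" for y
    using that by (auto simp: vec_rep_def chart_inv_chart [OF wf [OF cd(1)]] chart_inv_chart [OF wf [OF cd(2)]])
  ultimately show "smooth_on (snd c ` (fst c \<inter> (\<lambda>p. p) -` fst d))
      (\<lambda>y. to_chart M d (chart_inv c y) (X (chart_inv c y)))"
    by (auto intro: smooth_on_eq [OF S])
qed

lemma linear_form1_rep:
  assumes "\<And>p. linear (\<omega> p)" "c \<in> charts M" "y \<in> snd c ` fst c"
  shows "linear (form1_rep M c \<omega> y)"
proof -
  have "linear (\<omega> p \<circ> from_chart M c p)" if "p \<in> fst c" for p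
    by (rule linear_compose [OF linear_from_chart [OF assms(2) that] assms(1)])
  then show ?thesis
    using chart_inv_in [OF smooth_manifold_wf_chart [OF M assms(2)] assms(3)]
    by (simp add: form1_rep_def [abs_def] comp_def Let_def)
qed

lemma smooth_form1_rep_apply:
  assumes "\<omega> \<in> forms1 M" "c \<in> charts M" "smooth_on (snd c ` fst c) w"
  shows "smooth_on (snd c ` fst c) (\<lambda>y. form1_rep M c \<omega> y (w y))"
  by (rule smooth_on_linear_apply [OF open_chart_dom [OF assms(2)], where A = "form1_rep M c \<omega>"])
    (use assms forms1D [OF assms(1)] linear_form1_rep in auto)

lemma forms1_add: "\<omega> \<in> forms1 M \<Longrightarrow> \<eta> \<in> forms1 M \<Longrightarrow> \<omega> + \<eta> \<in> forms1 M"
  by (auto simp: forms1_def form1_rep_def Let_def linear_compose_add smooth_on_add open_chart_dom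
      plus_fun_def)

lemma forms1_scaleR: "\<omega> \<in> forms1 M \<Longrightarrow> r *\<^sub>R \<omega> \<in> forms1 M"
  using smooth_on_scaleR_const [OF open_chart_dom, where 'b = real]
    linear_compose_scale_right [of "\<omega> _" r]
  by (auto simp: forms1_def form1_rep_def Let_def scaleR_fun_def)

lemma forms1_minus: "\<omega> \<in> forms1 M \<Longrightarrow> - \<omega> \<in> forms1 M"
  using forms1_scaleR [of \<omega> "-1"] by simp

lemma forms1_diff: "\<omega> \<in> forms1 M \<Longrightarrow> \<eta> \<in> forms1 M \<Longrightarrow> \<omega> - \<eta> \<in> forms1 M"
  using forms1_add [of \<omega> "-\<eta>"] forms1_minus [of \<eta>] by simp

lemma form1_rep_d0:
  assumes "f \<in> smooth_funs M" "c \<in> charts M" "y \<in> snd c ` fst c"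
  shows "form1_rep M c (d0 M f) y v = frechet_derivative (f \<circ> chart_inv c) (at y) v"
  using d0_from_chart [OF assms(1,2), of "chart_inv c y" v] assms(3)
    chart_inv_in [OF smooth_manifold_wf_chart [OF M assms(2)] assms(3)]
    chart_chart_inv [OF smooth_manifold_wf_chart [OF M assms(2)] assms(3)]
  by (simp add: form1_rep_def Let_def)

lemma d0_forms1:
  assumes "f \<in> smooth_funs M"
  shows "d0 M f \<in> forms1 M"
  unfolding forms1_def
proof (intro CollectI conjI allI ballI)
  fix c v assume c: "c \<in> charts M"
  have "smooth_on (snd c ` fst c) (\<lambda>y. frechet_derivative (f \<circ> chart_inv c) (at y) v)"
    using assms c by (intro smooth_on_frechet_derivative) (auto simp: smooth_funs_iff)
  then show "smooth_on (snd c ` fst c) (\<lambda>y. form1_rep M c (d0 M f) y v)"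
    by (rule smooth_on_eq [OF open_chart_dom [OF c]]) (simp add: form1_rep_d0 [OF assms c])
qed (rule linear_d0 [OF assms])

lemma contr1_chart:
  assumes "c \<in> charts M" "y \<in> snd c ` fst c"
  shows "contr1 X \<omega> (chart_inv c y) = form1_rep M c \<omega> y (vec_rep M c X y)"
  using from_chart_to_chart [OF assms(1)]
    chart_inv_in [OF smooth_manifold_wf_chart [OF M assms(1)] assms(2)]
  by (simp add: contr1_def form1_rep_def vec_rep_def Let_def)

lemma contr1_smooth:
  assumes "X \<in> vec_fields M" "\<omega> \<in> forms1 M"
  shows "contr1 X \<omega> \<in> smooth_funs M"
  unfolding smooth_funs_iff
proof
  fix c assume c: "c \<in> charts M"
  show "smooth_on (snd c ` fst c) (contr1 X \<omega> \<circ> chart_inv c)"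
    by (rule smooth_on_eq [OF open_chart_dom [OF c]
          smooth_form1_rep_apply [OF assms(2) c vec_fieldsD [OF assms(1) c]]])
      (simp add: contr1_chart [OF c])
qed

lemma contr2_forms1:
  assumes "X \<in> vec_fields M" "B \<in> forms2 M"
  shows "contr2 X B \<in> forms1 M"
  unfolding forms1_def
proof (intro CollectI conjI allI ballI)
  show "linear (contr2 X B p)" for p
    using assms(2) by (simp add: forms2_def contr2_def)
  fix c v assume c: "c \<in> charts M"
  note wf = smooth_manifold_wf_chart [OF M c] and S = open_chart_dom [OF c]
  have "smooth_on (snd c ` fst c) (\<lambda>y. form2_rep M c B y (vec_rep M c X y) v)"
  proof (rule smooth_on_linear_apply [OF S, where A = "\<lambda>y u. form2_rep M c B y u v"])
    fix y assume y: "y \<in> snd c ` fst c"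
    show "linear (\<lambda>u. form2_rep M c B y u v)"
      using linear_compose [OF linear_from_chart [OF c chart_inv_in [OF wf y]],
          of "\<lambda>u. B (chart_inv c y) u (from_chart M c (chart_inv c y) v)"] assms(2)
      by (simp add: forms2_def form2_rep_def comp_def Let_def)
  next
    show "smooth_on (snd c ` fst c) (\<lambda>y. form2_rep M c B y b v)" for b
      using assms(2) c by (simp add: forms2_def)
  qed (rule vec_fieldsD [OF assms(1) c])
  moreover have "form1_rep M c (contr2 X B) y v = form2_rep M c B y (vec_rep M c X y) v"
    if "y \<in> snd c ` fst c" for y
    using from_chart_to_chart [OF c chart_inv_in [OF wf that]]
    by (simp add: form1_rep_def form2_rep_def contr2_def vec_rep_def Let_def)
  ultimately show "smooth_on (snd c ` fst c) (\<lambda>y. form1_rep M c (contr2 X B) y v)"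
    by (auto intro: smooth_on_eq [OF S])
qed

section \<open>Lie derivatives of one-forms\<close>

lemma has_derivative_form1_rep:
  assumes "\<omega> \<in> forms1 M"
  shows "((\<lambda>y. form1_rep M (chart_at M p) \<omega> y v) has_derivative
    frechet_derivative (\<lambda>y. form1_rep M (chart_at M p) \<omega> y v) (at (snd (chart_at M p) p)))
    (at (snd (chart_at M p) p))"
  by (rule smooth_on_has_derivative [OF forms1D(2) [OF assms wf_chart_at(1) [OF M]]])
    (auto simp: wf_chart_at [OF M])

lemma has_derivative_vec_rep:
  assumes "X \<in> vec_fields M"
  shows "(vec_rep M (chart_at M p) X has_derivative
    frechet_derivative (vec_rep M (chart_at M p) X) (at (snd (chart_at M p) p)))
    (at (snd (chart_at M p) p))"
  by (rule smooth_on_has_derivative [OF vec_fieldsD [OF assms wf_chart_at(1) [OF M]]])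
    (auto simp: wf_chart_at [OF M])

lemma chart_inv_chart_at: "chart_inv (chart_at M p) (snd (chart_at M p) p) = p"
  by (rule chart_inv_chart [OF smooth_manifold_wf_chart [OF M]]) (auto simp: wf_chart_at [OF M])

lemma form1_rep_chart_at: "form1_rep M (chart_at M p) \<omega> (snd (chart_at M p) p) v = \<omega> p v"
  by (simp add: form1_rep_def chart_inv_chart_at from_chart_chart_at Let_def)

lemma vec_rep_chart_at: "vec_rep M (chart_at M p) X (snd (chart_at M p) p) = X p"
  by (simp add: vec_rep_def chart_inv_chart_at to_chart_chart_at)

lemma d0_contr1:
  assumes "X \<in> vec_fields M" "\<omega> \<in> forms1 M"
  shows "d0 M (contr1 X \<omega>) p v =
    frechet_derivative (\<lambda>y. form1_rep M (chart_at M p) \<omega> y (X p)) (at (snd (chart_at M p) p)) v +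
    \<omega> p (frechet_derivative (vec_rep M (chart_at M p) X) (at (snd (chart_at M p) p)) v)"
proof -
  define c where "c = chart_at M p"
  have c: "c \<in> charts M" "p \<in> fst c" using wf_chart_at [OF M] by (auto simp: c_def)
  let ?y = "snd c p"
  have y: "?y \<in> snd c ` fst c" using c by simp
  define V where "V = frechet_derivative (vec_rep M c X) (at ?y)"
  have dX: "(vec_rep M c X has_derivative V) (at ?y)"
    using has_derivative_vec_rep [OF assms(1), of p] by (simp add: V_def c_def)
  define A where "A b = frechet_derivative (\<lambda>y. form1_rep M c \<omega> y b) (at ?y)" for b
  have dA: "((\<lambda>y. form1_rep M c \<omega> y b) has_derivative A b) (at ?y)" for b
    using has_derivative_form1_rep [OF assms(2), of p b] by (simp add: A_def c_def)
  have lin: "linear (form1_rep M c \<omega> y)" if "y \<in> snd c ` fst c" for y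
    by (rule linear_form1_rep [OF forms1D(1) [OF assms(2)] c(1) that])
  have Xy: "vec_rep M c X ?y = X p" by (simp add: c_def vec_rep_chart_at)
  have "((\<lambda>y. \<Sum>b\<in>onb. (X p \<bullet> b) *\<^sub>R form1_rep M c \<omega> y b) has_derivative
      (\<lambda>v. \<Sum>b\<in>onb. (X p \<bullet> b) *\<^sub>R A b v)) (at ?y)"
    by (intro has_derivative_sum has_derivative_scaleR_right dA)
  then have "((\<lambda>y. form1_rep M c \<omega> y (X p)) has_derivative
      (\<lambda>v. \<Sum>b\<in>onb. (X p \<bullet> b) *\<^sub>R A b v)) (at ?y)"
    by (rule has_derivative_transform_within_open [OF _ open_chart_dom [OF c(1)] y])
      (rule linear_onb_expand [OF lin, symmetric])
  from frechet_derivative_at [OF this]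
  \<comment> \<open>The derivative with frozen vector is reassembled from the basis vectors, to be
    recognised in the full product rule below.\<close>
  have AX: "A (X p) v = (\<Sum>b\<in>onb. (X p \<bullet> b) *\<^sub>R A b v)" for v
    unfolding A_def by (simp add: fun_eq_iff)
  have "((\<lambda>y. \<Sum>b\<in>onb. (vec_rep M c X y \<bullet> b) *\<^sub>R form1_rep M c \<omega> y b) has_derivative
      (\<lambda>v. \<Sum>b\<in>onb. (vec_rep M c X ?y \<bullet> b) *\<^sub>R A b v + (V v \<bullet> b) *\<^sub>R form1_rep M c \<omega> ?y b)) (at ?y)"
    by (intro has_derivative_sum has_derivative_scaleR dA has_derivative_inner_left dX)
  then have "((contr1 X \<omega> \<circ> chart_inv c) has_derivative
      (\<lambda>v. \<Sum>b\<in>onb. (vec_rep M c X ?y \<bullet> b) *\<^sub>R A b v + (V v \<bullet> b) *\<^sub>R form1_rep M c \<omega> ?y b)) (at ?y)"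
    by (rule has_derivative_transform_within_open [OF _ open_chart_dom [OF c(1)] y])
      (simp only: comp_apply contr1_chart [OF c(1)] linear_onb_expand [OF lin, symmetric])
  from frechet_derivative_at [OF this]
  have "d0 M (contr1 X \<omega>) p v =
      (\<Sum>b\<in>onb. (vec_rep M c X ?y \<bullet> b) *\<^sub>R A b v + (V v \<bullet> b) *\<^sub>R form1_rep M c \<omega> ?y b)"
    unfolding d0_def c_def [symmetric] by (simp add: fun_eq_iff)
  also have "\<dots> = A (X p) v + form1_rep M c \<omega> ?y (V v)"
    by (simp add: sum.distrib AX Xy linear_onb_expand [OF lin [OF y], of "V v"])
  finally show ?thesis by (simp add: form1_rep_chart_at A_def V_def c_def)
qed

text \<open>Once the contraction is differentiated by the product rule, its frozen term cancels the
  second term of \<open>d1\<close>, and the coordinate definition of \<open>lie_deriv1\<close> is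
  left.\<close>

lemma cartan_formula:
  assumes "X \<in> vec_fields M" "\<omega> \<in> forms1 M"
  shows "lie_deriv1 M X \<omega> p v = d1 M \<omega> p (X p) v + d0 M (contr1 X \<omega>) p v"
  by (simp add: d0_contr1 [OF assms] lie_deriv1_def d1_def Let_def)

lemma d1_d0:
  assumes "f \<in> smooth_funs M"
  shows "d1 M (d0 M f) p u v = 0"
proof -
  define c where "c = chart_at M p"
  have c: "c \<in> charts M" "p \<in> fst c" using wf_chart_at [OF M] by (auto simp: c_def)
  let ?y = "snd c p"
  have y: "?y \<in> snd c ` fst c" using c by simp
  note S = open_chart_dom [OF c(1)]
  have s: "smooth_on (snd c ` fst c) (f \<circ> chart_inv c)"
    using assms c(1) by (simp add: smooth_funs_iff)
  have "frechet_derivative (\<lambda>y. form1_rep M c (d0 M f) y v) (at ?y) =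
      frechet_derivative (\<lambda>y. frechet_derivative (f \<circ> chart_inv c) (at y) v) (at ?y)" for v
    by (rule frechet_derivative_transform [OF S y]) (rule form1_rep_d0 [OF assms c(1)])
  then show ?thesis
    using frechet_derivative_symmetric [OF S y s, of u v]
    by (simp add: d1_def Let_def c_def [symmetric])
qed

lemma lie_deriv1_d0:
  assumes "X \<in> vec_fields M" "f \<in> smooth_funs M"
  shows "lie_deriv1 M X (d0 M f) = d0 M (contr1 X (d0 M f))"
  by (intro ext) (simp add: cartan_formula [OF assms(1) d0_forms1 [OF assms(2)]] d1_d0 [OF assms(2)])

lemma lie_deriv1_add:
  assumes "\<omega> \<in> forms1 M" "\<eta> \<in> forms1 M"
  shows "lie_deriv1 M X (\<omega> + \<eta>) = lie_deriv1 M X \<omega> + lie_deriv1 M X \<eta>"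
proof (intro ext)
  fix p v
  have "((\<lambda>y. form1_rep M (chart_at M p) \<omega> y v + form1_rep M (chart_at M p) \<eta> y v) has_derivative
    (\<lambda>u. frechet_derivative (\<lambda>y. form1_rep M (chart_at M p) \<omega> y v) (at (snd (chart_at M p) p)) u +
      frechet_derivative (\<lambda>y. form1_rep M (chart_at M p) \<eta> y v) (at (snd (chart_at M p) p)) u))
    (at (snd (chart_at M p) p))"
    by (intro has_derivative_add has_derivative_form1_rep assms)
  moreover have "form1_rep M (chart_at M p) (\<omega> + \<eta>) y v =
      form1_rep M (chart_at M p) \<omega> y v + form1_rep M (chart_at M p) \<eta> y v" for y
    by (simp add: form1_rep_def Let_def)
  ultimately show "lie_deriv1 M X (\<omega> + \<eta>) p v = (lie_deriv1 M X \<omega> + lie_deriv1 M X \<eta>) p v"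
    by (simp add: lie_deriv1_def Let_def frechet_derivative_at [symmetric])
qed

end

section \<open>Descent along surjective submersions\<close>

context
  fixes N :: "('n::{t2_space, second_countable_topology}, 'f::finite_dim_inner) manifold"
    and M :: "('m::{t2_space, second_countable_topology}, 'e::finite_dim_inner) manifold"
    and f :: "'n \<Rightarrow> 'm"
  assumes N: "smooth_manifold N" and M: "smooth_manifold M" and f: "surjective_submersion N M f"
begin

lemma submersion_smooth: "smooth_map N M f"
  using f by (simp add: surjective_submersion_def)

lemma submersion_surj: "\<exists>q. f q = m"
  using f by (metis surjective_submersion_def surjD)

lemma submersion_surj_tmap: "\<exists>u. tmap N M f q u = w"
  using f by (metis surjective_submersion_def surjD)

lemma submersion_chart_surj:
  assumes "c \<in> charts N" "d \<in> charts M" "q \<in> fst c" "f q \<in> fst d"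
  shows "surj (mderiv c d f q)"
proof (rule surjI)
  fix w
  obtain u where "tmap N M f q u = from_chart M d (f q) w"
    using submersion_surj_tmap by blast
  then show "mderiv c d f q (to_chart N c q (SOME u. tmap N M f q u = from_chart M d (f q) w)) = w"
    using to_chart_tmap [OF M submersion_smooth N assms] to_chart_from_chart [OF M assms(2,4)]
    by (metis (mono_tags, lifting) someI)
qed

text \<open>A member of the family from \<open>smooth_submersion_sections\<close>, with the free
  parameter set to 0. The section is expressed in a chart of \<open>N\<close>, so that its
  smoothness is a statement about vector spaces.\<close>

lemma chart_local_section:
  assumes "d \<in> charts M" "y0 \<in> snd d ` fst d"
  obtains V \<sigma> c where "open V" "y0 \<in> V" "smooth_on V \<sigma>" "c \<in> charts N"
    "\<forall>y\<in>V. \<sigma> y \<in> snd c ` (fst c \<inter> f -` fst d)"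
    "\<forall>y\<in>V. snd d (f (chart_inv c (\<sigma> y))) = y"
proof -
  note wfd = smooth_manifold_wf_chart [OF M assms(1)]
  obtain q0 where q0: "f q0 = chart_inv d y0" using submersion_surj by blast
  define c where "c = chart_at N q0"
  have c: "c \<in> charts N" "q0 \<in> fst c" using wf_chart_at [OF N] by (auto simp: c_def)
  note wfc = smooth_manifold_wf_chart [OF N c(1)]
  have fq0: "f q0 \<in> fst d" "snd d (f q0) = y0"
    using chart_inv_in [OF wfd assms(2)] chart_chart_inv [OF wfd assms(2)] q0 by auto
  let ?U = "snd c ` (fst c \<inter> f -` fst d)" and ?F = "snd d \<circ> f \<circ> chart_inv c"
  have U: "open ?U"
    using wfd by (intro open_chart_image [OF wfc] smooth_map_open_vimage [OF submersion_smooth])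
      (simp add: wf_chart_def)
  have F0: "?F (snd c q0) = y0" using fq0 by (simp add: chart_inv_chart [OF wfc c(2)])
  obtain W S R where W: "open W" "(0::'f, ?F (snd c q0)) \<in> W" "smooth_on W S"
    "\<And>z. z \<in> W \<Longrightarrow> S z \<in> ?U" "\<And>z. z \<in> W \<Longrightarrow> ?F (S z) = snd z"
  proof (rule smooth_submersion_sections [OF U _ smooth_map_rep [OF submersion_smooth c(1) assms(1)], of "snd c q0"])
    show "surj (frechet_derivative ?F (at (snd c q0)))"
      using submersion_chart_surj [OF c(1) assms(1) c(2) fq0(1)] by (simp add: mderiv_def)
  qed (use c fq0 in auto)
  define V where "V = (\<lambda>y. (0::'f, y)) -` W"
  have "open V" unfolding V_def by (intro open_vimage W(1) continuous_intros)
  have "smooth_on V (\<lambda>y. (0::'f, y))"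
    by (rule smooth_on_Pair [OF \<open>open V\<close> smooth_on_const smooth_on_bounded_linear
          [OF _ bounded_linear_ident]]) (rule \<open>open V\<close>)+
  from smooth_on_compose [OF \<open>open V\<close> W(1) _ this W(3)]
  have "smooth_on V (\<lambda>y. S (0, y))" by (auto simp: V_def)
  show thesis
    by (rule that [OF \<open>open V\<close> _ \<open>smooth_on V (\<lambda>y. S (0, y))\<close> c(1)]) (use W F0 in \<open>auto simp: V_def\<close>)
qed

text \<open>The last claim results from differentiating the section identity: the derivative of the
  section is a right inverse of the derivative of \<open>f\<close>.\<close>

lemma chart_local_section_derivative:
  assumes d: "d \<in> charts M" and "open V" "smooth_on V \<sigma>" and c: "c \<in> charts N"
    and \<sigma>: "\<forall>y\<in>V. \<sigma> y \<in> snd c ` (fst c \<inter> f -` fst d)"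
    and sec: "\<forall>y\<in>V. snd d (f (chart_inv c (\<sigma> y))) = y"
    and y: "y \<in> V"
  shows "chart_inv c (\<sigma> y) \<in> fst c" "f (chart_inv c (\<sigma> y)) \<in> fst d"
    "snd c (chart_inv c (\<sigma> y)) = \<sigma> y" "f (chart_inv c (\<sigma> y)) = chart_inv d y"
    "mderiv c d f (chart_inv c (\<sigma> y)) (frechet_derivative \<sigma> (at y) v) = v"
proof -
  note wfd = smooth_manifold_wf_chart [OF M d] and wfc = smooth_manifold_wf_chart [OF N c]
  let ?q = "chart_inv c (\<sigma> y)"
  show q: "?q \<in> fst c" "f ?q \<in> fst d" "snd c ?q = \<sigma> y"
    using bspec [OF \<sigma> y] by (auto simp: chart_inv_chart [OF wfc])
  show "f ?q = chart_inv d y"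
    using chart_inv_chart [OF wfd q(2)] bspec [OF sec y] by simp
  have "mdiff c d f ?q" by (rule smooth_map_mdiff [OF submersion_smooth c d q(1,2)])
  from mdiff_has_derivative [OF this]
  have "((\<lambda>z. snd d (f (chart_inv c z))) has_derivative mderiv c d f ?q) (at (\<sigma> y))"
    using q(3) by (simp add: comp_def)
  from has_derivative_compose [OF smooth_on_has_derivative [OF assms(3) y] this]
  have "((\<lambda>y. y) has_derivative (\<lambda>v. mderiv c d f ?q (frechet_derivative \<sigma> (at y) v))) (at y)"
    by (rule has_derivative_transform_within_open [OF _ assms(2) y]) (simp add: sec)
  with has_derivative_ident have "(\<lambda>v. mderiv c d f ?q (frechet_derivative \<sigma> (at y) v)) = (\<lambda>v. v)"
    by (rule has_derivative_unique [symmetric])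
  then show "mderiv c d f ?q (frechet_derivative \<sigma> (at y) v) = v" by meson
qed

text \<open>Every point and every tangent vector downstairs has a preimage. This makes the form
  described in \<open>gerbe_rho\<close> unique.\<close>

lemma pull1_inject: "pull1 N M f \<epsilon> = pull1 N M f \<epsilon>' \<Longrightarrow> \<epsilon> = \<epsilon>'"
proof (intro ext)
  fix m w assume eq: "pull1 N M f \<epsilon> = pull1 N M f \<epsilon>'"
  obtain q u where "f q = m" "tmap N M f q u = w"
    using submersion_surj submersion_surj_tmap by meson
  with fun_cong [OF fun_cong [OF eq], of q u] show "\<epsilon> m w = \<epsilon>' m w"
    by (simp add: pull1_def)
qed

text \<open>The form downstairs is defined pointwise through arbitrary preimages, on which
  \<open>desc\<close> says that it does not depend. The freedom of choice is then used for
  smoothness: near any point the preimages may be taken along a smooth section.\<close>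

lemma forms1_descend:
  assumes \<theta>: "\<theta> \<in> forms1 N"
    and desc: "\<And>q u q' u'. f q = f q' \<Longrightarrow> tmap N M f q u = tmap N M f q' u' \<Longrightarrow> \<theta> q u = \<theta> q' u'"
  shows "\<exists>\<epsilon>\<in>forms1 M. pull1 N M f \<epsilon> = \<theta>"
proof -
  obtain s where s: "\<And>m. f (s m) = m" using submersion_surj by metis
  \<comment> \<open>Choosing the lifts of tangent vectors linearly makes the resulting form linear
    at each point.\<close>
  have "\<exists>R. linear R \<and> tmap N M f (s m) \<circ> R = id" for m
    by (rule linear_surjective_right_inverse [OF linear_tmap [OF M submersion_smooth N]])
      (metis submersion_surj_tmap surjI)
  then obtain R where R: "\<And>m. linear (R m)" "\<And>m. tmap N M f (s m) \<circ> R m = id" by metis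
  define \<epsilon> where "\<epsilon> m w = \<theta> (s m) (R m w)" for m w
  have "tmap N M f (s m) (R m w) = w" for m w using R(2) by (metis comp_apply id_apply)
  then have pull: "\<epsilon> (f q) (tmap N M f q u) = \<theta> q u" for q u
    unfolding \<epsilon>_def by (intro desc) (simp_all add: s)
  have lin: "linear (\<epsilon> m)" for m
    using linear_compose [OF R(1) forms1D(1) [OF \<theta>]] by (simp add: \<epsilon>_def [abs_def] comp_def)
  have "smooth_on (snd d ` fst d) (\<lambda>y. form1_rep M d \<epsilon> y v)" if d: "d \<in> charts M" for d v
  proof (rule smooth_on_local)
    fix y0 assume "y0 \<in> snd d ` fst d"
    from chart_local_section [OF d this]
    obtain V \<sigma> c where V: "open V" "y0 \<in> V" and sec: "smooth_on V \<sigma>" "c \<in> charts N"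
      "\<forall>y\<in>V. \<sigma> y \<in> snd c ` (fst c \<inter> f -` fst d)"
      "\<forall>y\<in>V. snd d (f (chart_inv c (\<sigma> y))) = y" .
    note D = chart_local_section_derivative [OF d V(1) sec]
    \<comment> \<open>In charts, the descended form is the pullback of \<theta> along the
      section.\<close>
    have eq: "form1_rep N c \<theta> (\<sigma> y) (frechet_derivative \<sigma> (at y) v) = form1_rep M d \<epsilon> y v"
      if "y \<in> V" for y
    proof -
      let ?q = "chart_inv c (\<sigma> y)"
      have "form1_rep N c \<theta> (\<sigma> y) (frechet_derivative \<sigma> (at y) v) =
          \<epsilon> (f ?q) (tmap N M f ?q (from_chart N c ?q (frechet_derivative \<sigma> (at y) v)))"
        by (simp add: form1_rep_def Let_def pull)
      also have "\<dots> = \<epsilon> (f ?q) (from_chart M d (f ?q) v)"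
        using tmap_from_chart [OF M submersion_smooth N sec(2) d D(1,2)] D(5) that by simp
      finally show ?thesis using D(4) [OF that] that by (simp add: form1_rep_def Let_def)
    qed
    have \<sigma>S: "\<sigma> ` V \<subseteq> snd c ` fst c" using sec(3) by auto
    have "smooth_on V (\<lambda>y. form1_rep N c \<theta> (\<sigma> y) (frechet_derivative \<sigma> (at y) v))"
    proof (rule smooth_on_linear_apply [OF V(1), where A = "\<lambda>y. form1_rep N c \<theta> (\<sigma> y)"])
      show "linear (form1_rep N c \<theta> (\<sigma> y))" if "y \<in> V" for y
        by (rule linear_form1_rep [OF N forms1D(1) [OF \<theta>] sec(2)]) (use that \<sigma>S in auto)
      show "smooth_on V (\<lambda>y. form1_rep N c \<theta> (\<sigma> y) b)" for b
        by (rule smooth_on_compose [OF V(1) open_chart_dom [OF N sec(2)] \<sigma>S sec(1)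
              forms1D(2) [OF \<theta> sec(2)]])
    qed (rule smooth_on_frechet_derivative [OF sec(1)])
    then have "smooth_on V (\<lambda>y. form1_rep M d \<epsilon> y v)"
      by (rule smooth_on_eq [OF V(1)]) (rule eq)
    with V show "\<exists>T. open T \<and> y0 \<in> T \<and> smooth_on T (\<lambda>y. form1_rep M d \<epsilon> y v)" by blast
  qed
  with lin have "\<epsilon> \<in> forms1 M" by (simp add: forms1_def)
  moreover have "pull1 N M f \<epsilon> = \<theta>" by (simp add: pull1_def fun_eq_iff pull)
  ultimately show ?thesis by blast
qed

lemma vec_fields_descend:
  assumes X: "X \<in> vec_fields N"
    and desc: "\<And>q q'. f q = f q' \<Longrightarrow> tmap N M f q (X q) = tmap N M f q' (X q')"
  shows "\<exists>x\<in>vec_fields M. \<forall>q. tmap N M f q (X q) = x (f q)"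
proof -
  obtain s where s: "\<And>m. f (s m) = m" using submersion_surj by metis
  define x where "x m = tmap N M f (s m) (X (s m))" for m
  have x: "tmap N M f q (X q) = x (f q)" for q
    unfolding x_def by (rule desc) (simp add: s)
  have "smooth_on (snd d ` fst d) (vec_rep M d x)" if d: "d \<in> charts M" for d
  proof (rule smooth_on_local)
    fix y0 assume "y0 \<in> snd d ` fst d"
    from chart_local_section [OF d this]
    obtain V \<sigma> c where V: "open V" "y0 \<in> V" and sec: "smooth_on V \<sigma>" "c \<in> charts N"
      "\<forall>y\<in>V. \<sigma> y \<in> snd c ` (fst c \<inter> f -` fst d)"
      "\<forall>y\<in>V. snd d (f (chart_inv c (\<sigma> y))) = y" .
    note D = chart_local_section_derivative [OF d V(1) sec]
    let ?F = "snd d \<circ> f \<circ> chart_inv c" and ?U = "snd c ` (fst c \<inter> f -` fst d)"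
    note F = smooth_map_rep [OF submersion_smooth sec(2) d]
    have U: "open ?U"
      using smooth_manifold_wf_chart [OF M d]
      by (intro open_chart_image smooth_manifold_wf_chart [OF N sec(2)]
          smooth_map_open_vimage [OF submersion_smooth]) (simp add: wf_chart_def)
    \<comment> \<open>In charts, the descended field is the pushforward of \<open>X\<close> taken
      along the section, which is visibly smooth.\<close>
    have eq: "frechet_derivative ?F (at (\<sigma> y)) (vec_rep N c X (\<sigma> y)) = vec_rep M d x y"
      if y: "y \<in> V" for y
    proof -
      let ?q = "chart_inv c (\<sigma> y)"
      have "frechet_derivative ?F (at (\<sigma> y)) (vec_rep N c X (\<sigma> y)) =
          mderiv c d f ?q (to_chart N c ?q (X ?q))"
        using D(3) [OF y] y by (simp add: mderiv_def vec_rep_def)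
      also have "\<dots> = to_chart M d (f ?q) (tmap N M f ?q (X ?q))"
        by (rule to_chart_tmap [OF M submersion_smooth N sec(2) d D(1,2), symmetric]) (rule y)+
      finally show ?thesis using D(4) [OF y] y by (simp add: x vec_rep_def)
    qed
    have \<sigma>U: "\<sigma> ` V \<subseteq> ?U" using sec(3) by auto
    then have \<sigma>S: "\<sigma> ` V \<subseteq> snd c ` fst c" by auto
    have "smooth_on V (\<lambda>y. frechet_derivative ?F (at (\<sigma> y)) (vec_rep N c X (\<sigma> y)))"
    proof (rule smooth_on_linear_apply [OF V(1), where A = "\<lambda>y. frechet_derivative ?F (at (\<sigma> y))"])
      show "linear (frechet_derivative ?F (at (\<sigma> y)))" if "y \<in> V" for y
        by (rule smooth_on_linear [OF F]) (use that \<sigma>U in auto)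
      show "smooth_on V (\<lambda>y. frechet_derivative ?F (at (\<sigma> y)) b)" for b
        by (rule smooth_on_compose [OF V(1) U \<sigma>U sec(1) smooth_on_frechet_derivative [OF F]])
      show "smooth_on V (\<lambda>y. vec_rep N c X (\<sigma> y))"
        by (rule smooth_on_compose [OF V(1) open_chart_dom [OF N sec(2)] \<sigma>S sec(1)
              vec_fieldsD [OF X sec(2)]])
    qed
    then have "smooth_on V (vec_rep M d x)"
      by (rule smooth_on_eq [OF V(1)]) (rule eq)
    with V show "\<exists>T. open T \<and> y0 \<in> T \<and> smooth_on T (vec_rep M d x)" by blast
  qed
  then have "x \<in> vec_fields M" by (rule vec_fieldsI [OF M])
  with x show ?thesis by blast
qed

lemma smooth_funs_pullback:
  assumes h: "h \<in> smooth_funs M"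
  shows "h \<circ> f \<in> smooth_funs N"
  unfolding smooth_funs_iff [OF N]
proof
  fix c assume c: "c \<in> charts N"
  note wfc = smooth_manifold_wf_chart [OF N c]
  show "smooth_on (snd c ` fst c) (h \<circ> f \<circ> chart_inv c)"
  proof (rule smooth_on_local)
    fix y assume y: "y \<in> snd c ` fst c"
    define d where "d = chart_at M (f (chart_inv c y))"
    have d: "d \<in> charts M" "f (chart_inv c y) \<in> fst d"
      using wf_chart_at [OF M] by (auto simp: d_def)
    note wfd = smooth_manifold_wf_chart [OF M d(1)]
    let ?U = "snd c ` (fst c \<inter> f -` fst d)"
    have U: "open ?U"
      using wfd by (intro open_chart_image [OF wfc] smooth_map_open_vimage [OF submersion_smooth])
        (simp add: wf_chart_def)
    have "smooth_on ?U (\<lambda>z. (h \<circ> chart_inv d) ((snd d \<circ> f \<circ> chart_inv c) z))"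
      by (rule smooth_on_compose [OF U open_chart_dom [OF M d(1)] _ smooth_map_rep [OF submersion_smooth c d(1)]])
        (use h d in \<open>auto simp: smooth_funs_iff [OF M] chart_inv_chart [OF wfc] comp_def\<close>)
    then have "smooth_on ?U (h \<circ> f \<circ> chart_inv c)"
      by (rule smooth_on_eq [OF U]) (auto simp: chart_inv_chart [OF wfc] chart_inv_chart [OF wfd])
    moreover have "y \<in> ?U"
      using y d(2) by (simp add: chart_image_Int [OF wfc])
    ultimately show "\<exists>T. open T \<and> y \<in> T \<and> smooth_on T (h \<circ> f \<circ> chart_inv c)"
      using U by blast
  qed
qed

lemma d0_pullback:
  assumes h: "h \<in> smooth_funs M"
  shows "d0 N (h \<circ> f) q v = d0 M h (f q) (tmap N M f q v)"
  unfolding d0_eq tmap_eq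
  by (rule mdiff_compose(2) [OF smooth_manifold_wf_chart [OF N] smooth_manifold_wf_chart [OF M]
        smooth_map_mdiff_chart_at [OF M submersion_smooth N] smooth_funs_mdiff [OF h]])
    (auto simp: wf_chart_at [OF N] wf_chart_at [OF M])

end

section \<open>Representatives for the composite butterfly\<close>

lemma UN2_const:
  "x0 \<in> A \<Longrightarrow> y0 \<in> B \<Longrightarrow> (\<And>x y. x \<in> A \<Longrightarrow> y \<in> B \<Longrightarrow> F x y = Z) \<Longrightarrow>
    (\<Union>x\<in>A. \<Union>y\<in>B. F x y) = Z"
  by blast

text \<open>The map \<rho> as a relation: unlike the definite descriptions in
  \<open>gerbe_rho\<close>, it carries the existence and smoothness of both components. The form
  \<nu> is \<open>- \<epsilon>\<close>, whence the minus sign under the pullback.\<close>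

definition rho_graph ::
    "('m::topological_space, 'em::finite_dim_inner, 'x::topological_space, 'ex::finite_dim_inner,
      'p, 'ep) gerbe \<Rightarrow> ('x \<Rightarrow> 'ex \<Rightarrow> 'ex \<Rightarrow> real) \<Rightarrow> ('x, 'ex, 'p, 'ep) sym0 \<times> ('x \<Rightarrow> real) \<Rightarrow>
     ('m, 'em) courant0 \<Rightarrow> bool"
  where "rho_graph G B = (\<lambda>((X, P, \<alpha>), g) (x, \<nu>).
    x \<in> vec_fields (base G) \<and> (\<forall>q. tmap (objs G) (base G) (proj G) q (X q) = x (proj G q)) \<and>
    \<nu> \<in> forms1 (base G) \<and>
    pull1 (objs G) (base G) (proj G) (- \<nu>) = \<alpha> - contr2 X B - d0 (objs G) g)"

definition gerbe_total ::
    "('m, 'em, 'x::topological_space, 'ex::finite_dim_inner, 'p::topological_space,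
      'ep::finite_dim_inner) gerbe \<Rightarrow> ('p \<Rightarrow> 'ep \<Rightarrow> real) \<Rightarrow>
     (('x, 'ex, 'p, 'ep) sym0 \<times> ('x \<Rightarrow> real)) set"
  where "gerbe_total G \<gamma> = {((X, P, \<alpha>), g).
    (X, P, \<alpha>) \<in> sym0_carrier G \<gamma> \<and> g \<in> smooth_funs (objs G) \<and> delta0 G g = contr1 P \<gamma>}"

definition coset_shift ::
    "('m, 'em::real_normed_vector, 'x, 'ex, 'p, 'ep) gerbe \<Rightarrow> ('m \<Rightarrow> real) \<Rightarrow>
     (('x, 'ex::real_vector, 'p, 'ep::real_vector) sym0 \<times> ('x \<Rightarrow> real)) \<times> (('m \<Rightarrow> real) \<times> ('m, 'em) courant0)"
  where "coset_shift G h = ((0, h \<circ> proj G), (- h, (0, d0 (base G) h)))"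

definition coset ::
    "('m::topological_space, 'em::finite_dim_inner, 'x, 'ex, 'p, 'ep) gerbe \<Rightarrow>
     (('x, 'ex::real_vector, 'p, 'ep::real_vector) sym0 \<times> ('x \<Rightarrow> real)) \<times> (('m \<Rightarrow> real) \<times> ('m, 'em) courant0) \<Rightarrow>
     ((('x, 'ex, 'p, 'ep) sym0 \<times> ('x \<Rightarrow> real)) \<times> (('m \<Rightarrow> real) \<times> ('m, 'em) courant0)) set"
  where "coset G a = (\<lambda>h. a + coset_shift G h) ` smooth_funs (base G)"

definition sum_merge ::
    "('m, 'em, 'x, 'ex, 'p, 'ep) gerbe \<Rightarrow>
     (('x, 'ex, 'p, 'ep) sym0 \<times> ('x \<Rightarrow> real)) \<times> (('m \<Rightarrow> real) \<times> ('m, 'em) courant0) \<Rightarrow>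
     ('x, 'ex, 'p, 'ep) sym0 \<times> ('x \<Rightarrow> real)"
  where "sum_merge G = (\<lambda>((\<xi>, g), (f, w)). (\<xi>, g + (f \<circ> proj G)))"

definition fibre_sum ::
    "('m::topological_space, 'em::finite_dim_inner, 'x::topological_space, 'ex::finite_dim_inner,
      'p::topological_space, 'ep::finite_dim_inner) gerbe \<Rightarrow> ('p \<Rightarrow> 'ep \<Rightarrow> real) \<Rightarrow>
     ('x \<Rightarrow> 'ex \<Rightarrow> 'ex \<Rightarrow> real) \<Rightarrow>
     ((('x, 'ex, 'p, 'ep) sym0 \<times> ('x \<Rightarrow> real)) \<times> (('m \<Rightarrow> real) \<times> ('m, 'em) courant0)) set"
  where "fibre_sum G \<gamma> B =
    {(e, (f, w)). e \<in> gerbe_total G \<gamma> \<and> f \<in> smooth_funs (base G) \<and> rho_graph G B e w}"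

lemma gerbe_butterfly_simps:
  "vcarrier (total (gerbe_butterfly G \<gamma> B)) = gerbe_total G \<gamma>"
  "vadd (total (gerbe_butterfly G \<gamma> B)) = (+)"
  "vscale (total (gerbe_butterfly G \<gamma> B)) = (*\<^sub>R)"
  "vzero (total (gerbe_butterfly G \<gamma> B)) = 0"
  "brak (gerbe_butterfly G \<gamma> B) ((X, P, \<alpha>), g) ((Z, R, \<beta>), h) =
    (sym0_bracket G (X, P, \<alpha>) (Z, R, \<beta>),
     (1/2) *\<^sub>R (contr1 X (\<beta> + d0 (objs G) h) - contr1 Z (\<alpha> + d0 (objs G) g)))"
  "kap (gerbe_butterfly G \<gamma> B) a = (sym_bd G \<gamma> a, - vert G \<gamma> a)"
  "lam (gerbe_butterfly G \<gamma> B) f = (0, f \<circ> proj G)"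
  "sig (gerbe_butterfly G \<gamma> B) = fst"
  "rho (gerbe_butterfly G \<gamma> B) = gerbe_rho G B"
  by (simp_all add: gerbe_butterfly_def gerbe_total_def subspace_vspace_def)

text \<open>The summand with \<open>contr1 0\<close> is the bracket of \<partial>w with w', whose
  first argument has zero vector part. It disappears only once the function is known to be smooth,
  so that its differential is linear.\<close>

lemma shift_butterfly_simps:
  "vcarrier (total (shift_butterfly M chi \<tau>)) = smooth_funs M \<times> (vec_fields M \<times> forms1 M)"
  "vadd (total (shift_butterfly M chi \<tau>)) = (+)"
  "vscale (total (shift_butterfly M chi \<tau>)) = (*\<^sub>R)"
  "vzero (total (shift_butterfly M chi \<tau>)) = 0"
  "brak (shift_butterfly M chi \<tau>) (f, (x, \<mu>)) (f', (x', \<mu>')) =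
    ((1/2) *\<^sub>R contr1 x (d0 M f') - (1/2) *\<^sub>R contr1 x' (d0 M f) + (1/2) *\<^sub>R contr1 0 (d0 M f'),
     courant_bracket M chi (x, \<mu>) (x', \<mu>'))"
  "kap (shift_butterfly M chi \<tau>) h = (- h, (0, d0 M h))"
  "lam (shift_butterfly M chi \<tau>) f = (f, 0)"
  "sig (shift_butterfly M chi \<tau>) (f, w) = w"
  "rho (shift_butterfly M chi \<tau>) (f, (x, \<mu>)) = (x, d0 M f + (\<mu> + contr2 x \<tau>))"
  by (simp_all add: shift_butterfly_def strict_butterfly_def courant_lie2_def courant_shift_def
      dsum_vspace_def subspace_vspace_def vsub_def Let_def fun_eq_iff plus_prod_def scaleR_prod_def
      split_beta zero_prod_def prod_eq_iff)

lemma dsum_vspace_simps: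
  fixes V :: "'v::real_vector vspace" and W :: "'w::real_vector vspace"
  shows "vadd V = (+) \<Longrightarrow> vadd W = (+) \<Longrightarrow> vadd (dsum_vspace V W) = (+)"
    and "vscale V = (*\<^sub>R) \<Longrightarrow> vscale W = (*\<^sub>R) \<Longrightarrow> vscale (dsum_vspace V W) = (*\<^sub>R)"
  by (simp_all add: dsum_vspace_def fun_eq_iff plus_prod_def scaleR_prod_def split_beta)

text \<open>The componentwise bracket on pairs of representatives, before passing to cosets.\<close>

definition fibre_sum_bracket ::
    "('m::topological_space, 'em::finite_dim_inner, 'x::topological_space, 'ex::finite_dim_inner,
      'p::topological_space, 'ep::finite_dim_inner) gerbe \<Rightarrow> ('p \<Rightarrow> 'ep \<Rightarrow> real) \<Rightarrow>
     ('x \<Rightarrow> 'ex \<Rightarrow> 'ex \<Rightarrow> real) \<Rightarrow> ('m \<Rightarrow> 'em \<Rightarrow> 'em \<Rightarrow> 'em \<Rightarrow> real) \<Rightarrow>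
     ('m \<Rightarrow> 'em \<Rightarrow> 'em \<Rightarrow> real) \<Rightarrow>
     (('x, 'ex, 'p, 'ep) sym0 \<times> ('x \<Rightarrow> real)) \<times> (('m \<Rightarrow> real) \<times> ('m, 'em) courant0) \<Rightarrow>
     (('x, 'ex, 'p, 'ep) sym0 \<times> ('x \<Rightarrow> real)) \<times> (('m \<Rightarrow> real) \<times> ('m, 'em) courant0) \<Rightarrow>
     (('x, 'ex, 'p, 'ep) sym0 \<times> ('x \<Rightarrow> real)) \<times> (('m \<Rightarrow> real) \<times> ('m, 'em) courant0)"
  where "fibre_sum_bracket G \<gamma> B chi \<tau> a b =
    (brak (gerbe_butterfly G \<gamma> B) (fst a) (fst b), brak (shift_butterfly (base G) chi \<tau>) (snd a) (snd b))"

lemma pull1_diff: "pull1 N M f (\<omega> - \<eta>) = pull1 N M f \<omega> - pull1 N M f \<eta>"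
  by (simp add: pull1_def fun_eq_iff)

lemma sum_merge_shift: "sum_merge G (a + coset_shift G h) = sum_merge G a"
  by (auto simp: sum_merge_def coset_shift_def split_beta fun_eq_iff)

lemma sum_merge_add: "sum_merge G (a + b) = sum_merge G a + sum_merge G b"
  by (auto simp: sum_merge_def split_beta fun_eq_iff)

lemma sum_merge_scaleR: "sum_merge G (r *\<^sub>R a) = r *\<^sub>R sum_merge G a"
  by (auto simp: sum_merge_def split_beta fun_eq_iff scaleR_fun_def algebra_simps)

lemma contr1_add: "contr1 X (\<omega> + \<eta>) = contr1 X \<omega> + contr1 X \<eta>"
  by (simp add: fun_eq_iff contr1_def)

lemma contr1_diff: "contr1 X (\<omega> - \<eta>) = contr1 X \<omega> - contr1 X \<eta>"
  by (simp add: fun_eq_iff contr1_def)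

lemma delta1_eq: "delta1 G \<theta> p v = \<theta> (src G p) (tsrc G p v) - \<theta> (tgt G p) (ttgt G p v)"
  by (simp add: delta1_def pull1_def tsrc_def ttgt_def)

lemma coset_elem:
  assumes "a' \<in> coset G a"
  obtains h where "h \<in> smooth_funs (base G)" "a' = a + coset_shift G h"
  using assms unfolding coset_def by (rule imageE)

section \<open>Tangent vectors of a bundle gerbe\<close>

lemma tmap_compose:
  assumes "smooth_manifold N" "smooth_manifold M" "smooth_manifold L" "smooth_map N M f" "smooth_map M L g"
  shows "tmap N L (g \<circ> f) p v = tmap M L g (f p) (tmap N M f p v)"
proof -
  have "mderiv (chart_at N p) (chart_at L (g (f p))) (g \<circ> f) p v =
      mderiv (chart_at M (f p)) (chart_at L (g (f p))) g (f p)
        (mderiv (chart_at N p) (chart_at M (f p)) f p v)"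
    by (rule mdiff_compose(2) [OF smooth_manifold_wf_chart smooth_manifold_wf_chart
          smooth_map_mdiff_chart_at smooth_map_mdiff_chart_at]) (use assms wf_chart_at in auto)
  then show ?thesis by (simp add: tmap_eq)
qed

lemma chart_inv_prod_chart:
  assumes "wf_chart c" "wf_chart d" "y \<in> snd c ` fst c" "z \<in> snd d ` fst d"
  shows "chart_inv (prod_chart c d) (y, z) = (chart_inv c y, chart_inv d z)"
  unfolding chart_inv_def [of "prod_chart c d"]
proof (rule inv_into_f_eq)
  show "inj_on (snd (prod_chart c d)) (fst (prod_chart c d))"
    unfolding prod_chart_def fst_conv snd_conv
    by (intro map_prod_inj_on inj_on_inverseI [of _ "chart_inv c"] inj_on_inverseI [of _ "chart_inv d"]
        chart_inv_chart assms)
qed (use assms in \<open>auto simp: prod_chart_def chart_inv_in chart_chart_inv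
      chart_inv_chart [OF assms(1)] chart_inv_chart [OF assms(2)]\<close>)

context
  fixes G :: "('m::{t2_space, second_countable_topology}, 'em::finite_dim_inner,
      'x::{t2_space, second_countable_topology}, 'ex::finite_dim_inner,
      'p::{t2_space, second_countable_topology}, 'ep::finite_dim_inner) gerbe"
  assumes G: "bundle_gerbe G"
begin

lemma gerbe_manifolds:
  "smooth_manifold (base G)" "smooth_manifold (objs G)" "smooth_manifold (arrs G)"
  using G by (auto simp: bundle_gerbe_def lie_groupoid_def)

lemma gerbe_submersions:
  "surjective_submersion (objs G) (base G) (proj G)"
  "surjective_submersion (arrs G) (objs G) (src G)"
  "surjective_submersion (arrs G) (objs G) (tgt G)"
  using G by (auto simp: bundle_gerbe_def lie_groupoid_def)

lemma gerbe_smooth_maps: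
  "smooth_map (objs G) (base G) (proj G)" "smooth_map (arrs G) (objs G) (src G)"
  "smooth_map (arrs G) (objs G) (tgt G)"
  using gerbe_submersions by (auto simp: surjective_submersion_def)

lemma range_tgt_src: "range (\<lambda>p. (tgt G p, src G p)) = fibre_prod G"
  using G unfolding bundle_gerbe_def principal_circle_bundle_def by (elim conjE) assumption

lemma proj_src: "proj G (src G p) = proj G (tgt G p)"
proof -
  have "(tgt G p, src G p) \<in> fibre_prod G"
    unfolding range_tgt_src [symmetric] by (rule rangeI)
  then show ?thesis by (simp add: fibre_prod_def)
qed

lemma local_section_fibre_prod:
  assumes "b \<in> fibre_prod G"
  obtains U \<eta> where "open U" "b \<in> U"
    "smooth_map_sub (prod_manifold (objs G) (objs G)) (arrs G) (U \<inter> fibre_prod G) \<eta>"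
    "\<forall>b'\<in>U \<inter> fibre_prod G. (tgt G (\<eta> b'), src G (\<eta> b')) = b'"
proof -
  have "principal_circle_bundle G" using G unfolding bundle_gerbe_def by (elim conjE)
  then have "\<forall>b\<in>fibre_prod G. \<exists>U \<eta> \<zeta>. open U \<and> b \<in> U \<and>
       smooth_map_sub (prod_manifold (objs G) (objs G)) (arrs G) (U \<inter> fibre_prod G) \<eta> \<and>
       (\<forall>b'\<in>U \<inter> fibre_prod G. (tgt G (\<eta> b'), src G (\<eta> b')) = b') \<and>
       smooth_map_on (arrs G) (vec_manifold :: (complex, complex) manifold)
         {p. (tgt G p, src G p) \<in> U} \<zeta> \<and>
       (\<forall>p. (tgt G p, src G p) \<in> U \<longrightarrow>
          cmod (\<zeta> p) = 1 \<and> p = act G (\<zeta> p) (\<eta> (tgt G p, src G p)))"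
    unfolding principal_circle_bundle_def by (elim conjE) assumption
  from bspec [OF this assms] show thesis
    by (elim exE conjE) (rule that)
qed

text \<open>A tangent vector \<open>(u, u')\<close> to \<open>X \<times>\<^sub>M X\<close> is the velocity of a curve in \<open>X \<times>\<^sub>M X\<close>, which the
  local sections of \<open>P \<rightarrow> X \<times>\<^sub>M X\<close> lift to \<open>P\<close>. The second component of the curve is obtained
  from the first by a family of local sections of the projection.\<close>

lemma tangent_lift:
  assumes qq: "proj G q = proj G q'"
    and uu: "tmap (objs G) (base G) (proj G) q u = tmap (objs G) (base G) (proj G) q' u'"
  obtains p v where "tgt G p = q" "src G p = q'" "ttgt G p v = u" "tsrc G p v = u'"
proof -
  note man = gerbe_manifolds and sm = gerbe_smooth_maps
  let ?\<pi> = "proj G"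
  have "(q, q') \<in> fibre_prod G" using qq by (simp add: fibre_prod_def)
  then obtain U \<eta> where U: "open U" "(q, q') \<in> U"
    and \<eta>s: "smooth_map_sub (prod_manifold (objs G) (objs G)) (arrs G) (U \<inter> fibre_prod G) \<eta>"
    and \<eta>: "\<forall>b\<in>U \<inter> fibre_prod G. (tgt G (\<eta> b), src G (\<eta> b)) = b"
    by (rule local_section_fibre_prod)
  have "(q, q') \<in> U \<inter> fibre_prod G" using U \<open>(q, q') \<in> fibre_prod G\<close> by simp
  with \<eta>s have "\<exists>g. local_extension (prod_manifold (objs G) (objs G)) (arrs G) (U \<inter> fibre_prod G) \<eta> (q, q') g"
    unfolding smooth_map_sub_def by (rule bspec)
  then obtain g U' where U': "(q, q') \<in> U'"
    and g: "smooth_map_on (prod_manifold (objs G) (objs G)) (arrs G) U' g"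
    and g\<eta>: "\<forall>b\<in>U' \<inter> (U \<inter> fibre_prod G). g b = \<eta> b"
    unfolding local_extension_def by (elim exE conjE)
  \<comment> \<open>The extension \<open>g\<close> agrees with the section only on the fibre
    product, hence the hypothesis that \<open>x\<close> and \<open>y\<close> lie over the same
    point.\<close>
  have gts: "tgt G (g (x, y)) = x" "src G (g (x, y)) = y"
    if "(x, y) \<in> U" "(x, y) \<in> U'" "?\<pi> x = ?\<pi> y" for x y
  proof -
    have b: "(x, y) \<in> U \<inter> fibre_prod G" using that by (simp add: fibre_prod_def)
    then have "g (x, y) = \<eta> (x, y)" using g\<eta> that by simp
    then show "tgt G (g (x, y)) = x" "src G (g (x, y)) = y" using bspec [OF \<eta> b] by auto
  qed
  define c where "c = chart_at (objs G) q"
  define c' where "c' = chart_at (objs G) q'"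
  define d where "d = chart_at (base G) (?\<pi> q)"
  have c: "c \<in> charts (objs G)" "q \<in> fst c" and c': "c' \<in> charts (objs G)" "q' \<in> fst c'"
    and d: "d \<in> charts (base G)" "?\<pi> q \<in> fst d" "?\<pi> q' \<in> fst d"
    using wf_chart_at [OF man(2)] wf_chart_at [OF man(1)] qq by (auto simp: c_def c'_def d_def)
  note wfc = smooth_manifold_wf_chart [OF man(2) c(1)]
    and wfc' = smooth_manifold_wf_chart [OF man(2) c'(1)]
    and wfd = smooth_manifold_wf_chart [OF man(1) d(1)]
  have ci: "chart_inv c (snd c q) = q" "chart_inv c' (snd c' q') = q'"
    by (rule chart_inv_chart [OF wfc c(2)], rule chart_inv_chart [OF wfc' c'(2)])
  let ?F = "snd d \<circ> ?\<pi> \<circ> chart_inv c'" and ?V = "snd c' ` (fst c' \<inter> ?\<pi> -` fst d)"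
  have dF: "frechet_derivative ?F (at (snd c' q')) = tmap (objs G) (base G) ?\<pi> q'"
    using qq by (simp add: tmap_eq mderiv_def c'_def d_def)
  have F0: "?F (snd c' q') = snd d (?\<pi> q)" using qq ci by simp
  have V: "open ?V"
    using wfd by (intro open_chart_image [OF wfc'] smooth_map_open_vimage [OF sm(1)])
      (simp add: wf_chart_def)
  obtain W S R where W: "open W" "(0::'ex, ?F (snd c' q')) \<in> W" "smooth_on W S"
    "S (0, ?F (snd c' q')) = snd c' q'"
    "\<And>z. z \<in> W \<Longrightarrow> S z \<in> ?V" "\<And>z. z \<in> W \<Longrightarrow> ?F (S z) = snd z" "linear R"
    "(S has_derivative (\<lambda>z. fst z + R (snd z - frechet_derivative ?F (at (snd c' q')) (fst z))))
      (at (0, ?F (snd c' q')))"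
  proof (rule smooth_submersion_sections [OF V _ smooth_map_rep [OF sm(1) c'(1) d(1)], of "snd c' q'"])
    show "surj (frechet_derivative ?F (at (snd c' q')))"
      using gerbe_submersions(1) by (simp add: dF surjective_submersion_def)
  qed (use c' d in auto)
  define a where "a t = snd c q + t *\<^sub>R u" for t :: real
  define \<gamma>1 where "\<gamma>1 t = chart_inv c (a t)" for t
  \<comment> \<open>The parameters fed to the family of sections: the free direction moves with
    velocity \<open>u'\<close>, the base point follows the projection of the first curve. Thus both
    curves lie over the same curve in M.\<close>
  define z where "z t = (t *\<^sub>R u', snd d (?\<pi> (\<gamma>1 t)))" for t
  define a' where "a' t = S (z t)" for t
  define \<gamma>2 where "\<gamma>2 t = chart_inv c' (a' t)" for t
  have a0: "a 0 = snd c q" "\<gamma>1 0 = q" "z 0 = (0, ?F (snd c' q'))" "a' 0 = snd c' q'" "\<gamma>2 0 = q'"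
    using ci F0 W(4) by (simp_all add: a_def \<gamma>1_def z_def a'_def \<gamma>2_def)
  have da: "(a has_derivative (\<lambda>s. s *\<^sub>R u)) (at 0)"
    unfolding a_def by (auto intro!: derivative_eq_intros)
  have "mdiff c d ?\<pi> q" by (rule smooth_map_mdiff [OF sm(1) c(1) d(1) c(2) d(2)])
  from mdiff_has_derivative [OF this]
  have "((\<lambda>y. snd d (?\<pi> (chart_inv c y))) has_derivative tmap (objs G) (base G) ?\<pi> q) (at (a 0))"
    by (simp add: a0 comp_def tmap_eq c_def d_def)
  from has_derivative_compose [OF da this]
  have dz: "(z has_derivative (\<lambda>s. (s *\<^sub>R u', tmap (objs G) (base G) ?\<pi> q (s *\<^sub>R u)))) (at 0)"
    unfolding z_def \<gamma>1_def by (intro has_derivative_Pair) (auto intro!: derivative_eq_intros)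
  have lin: "linear (tmap (objs G) (base G) ?\<pi> r)" for r
    by (rule linear_tmap [OF man(1) sm(1) man(2)])
  \<comment> \<open>The derivative of \<open>S\<close> is \<open>u'\<close> plus a correction
    \<open>R\<close> applied to the difference of the two projected velocities; by \<open>uu\<close>
    this difference vanishes.\<close>
  have da': "(a' has_derivative (\<lambda>s. s *\<^sub>R u')) (at 0)"
    using has_derivative_compose [OF dz W(8) [folded a0(3)]]
    by (simp add: a'_def [abs_def] dF linear_scale [OF lin] uu linear_0 [OF W(7)])
  have cont: "isCont a 0" "isCont z 0" "isCont a' 0"
    using da dz da' by (auto intro: has_derivative_continuous)
  have c\<gamma>1: "isCont \<gamma>1 0"
    unfolding \<gamma>1_def using isCont_chart_inv [OF wfc, of "snd c q"] c(2)
    by (intro isCont_o2 [OF cont(1)]) (simp add: a0)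
  have c\<gamma>2: "isCont \<gamma>2 0"
    unfolding \<gamma>2_def using isCont_chart_inv [OF wfc', of "snd c' q'"] c'(2)
    by (intro isCont_o2 [OF cont(3)]) (simp add: a0)
  have ev: "\<forall>\<^sub>F t in nhds 0. f t \<in> A" if "isCont f 0" "open A" "f 0 \<in> A" for f :: "real \<Rightarrow> 'z::topological_space" and A
    using that by (simp add: continuous_at_open eventually_nhds)
  have ev1: "\<forall>\<^sub>F t in nhds 0. a t \<in> snd c ` fst c"
    by (rule ev [OF cont(1)]) (use wfc c(2) a0 in \<open>auto simp: wf_chart_def\<close>)
  have ev2: "\<forall>\<^sub>F t in nhds 0. \<gamma>1 t \<in> ?\<pi> -` fst d"
    by (rule ev [OF c\<gamma>1 smooth_map_open_vimage [OF sm(1)]]) (use wfd d a0 in \<open>auto simp: wf_chart_def\<close>)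
  have ev3: "\<forall>\<^sub>F t in nhds 0. z t \<in> W"
    by (rule ev [OF cont(2) W(1)]) (use W(2) a0(3) in simp)
  have c\<Gamma>: "isCont (\<lambda>t. (\<gamma>1 t, \<gamma>2 t)) 0"
    using c\<gamma>1 c\<gamma>2 by (simp add: continuous_Pair)
  have ev4: "\<forall>\<^sub>F t in nhds 0. (\<gamma>1 t, \<gamma>2 t) \<in> U \<inter> U'"
    by (rule ev [OF c\<Gamma>]) (use U U' g a0 in \<open>auto simp: smooth_map_on_def\<close>)
  define p where "p = g (q, q')"
  have p: "tgt G p = q" "src G p = q'" using gts U(2) U' qq by (auto simp: p_def)
  define e where "e = chart_at (arrs G) p"
  have e: "e \<in> charts (arrs G)" "p \<in> fst e" using wf_chart_at [OF man(3)] by (auto simp: e_def)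
  have wfe: "wf_chart e" by (rule smooth_manifold_wf_chart [OF man(3) e(1)])
  let ?cc = "prod_chart c c'"
  have cc: "?cc \<in> charts (prod_manifold (objs G) (objs G))"
    using c(1) c'(1) by (auto simp: prod_manifold_def simp del: split_paired_Ex)
  have cc': "(q, q') \<in> fst ?cc" "snd ?cc (q, q') = (snd c q, snd c' q')"
    using c c' by (auto simp: prod_chart_def)
  have mg: "mdiff ?cc e g (q, q')"
    by (rule smooth_map_on_mdiff [OF g cc e(1) U' cc'(1)]) (use e in \<open>simp add: p_def\<close>)
  have ev5: "\<forall>\<^sub>F t in nhds 0. g (\<gamma>1 t, \<gamma>2 t) \<in> fst e"
  proof (rule ev)
    show "isCont (\<lambda>t. g (\<gamma>1 t, \<gamma>2 t)) 0"
      by (rule isCont_o2 [OF c\<Gamma>]) (use mg a0 in \<open>simp add: mdiff_def\<close>)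
  qed (use wfe e a0 in \<open>auto simp: wf_chart_def p_def\<close>)
  define L where "L = mderiv ?cc e g (q, q')"
  define r where "r t = snd e (g (chart_inv ?cc (a t, a' t)))" for t
  have "((\<lambda>t. (a t, a' t)) has_derivative (\<lambda>s. (s *\<^sub>R u, s *\<^sub>R u'))) (at 0)"
    by (rule has_derivative_Pair [OF da da'])
  from has_derivative_compose [OF this, of "\<lambda>y. snd e (g (chart_inv ?cc y))" L] mdiff_has_derivative [OF mg]
  have dr: "(r has_derivative (\<lambda>s. L (s *\<^sub>R u, s *\<^sub>R u'))) (at 0)"
    by (simp add: a0 cc'(2) L_def r_def [abs_def] comp_def)
  \<comment> \<open>For small \<open>t\<close> the pair of curves stays in all charts and in the
    fibre product, so \<open>g\<close> lifts it to a curve in P.\<close>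
  have ev6: "\<forall>\<^sub>F t in nhds 0. chart_inv e (r t) = g (\<gamma>1 t, \<gamma>2 t) \<and>
      tgt G (g (\<gamma>1 t, \<gamma>2 t)) = \<gamma>1 t \<and> src G (g (\<gamma>1 t, \<gamma>2 t)) = \<gamma>2 t \<and>
      snd c (\<gamma>1 t) = a t \<and> snd c' (\<gamma>2 t) = a' t"
    using ev1 ev2 ev3 ev4 ev5
  proof eventually_elim
    case (elim t)
    have a'V: "a' t \<in> ?V" using W(5) [OF elim(3)] by (simp add: a'_def)
    then have a'S: "a' t \<in> snd c' ` fst c'" and \<gamma>2d: "?\<pi> (\<gamma>2 t) \<in> fst d"
      by (auto simp: \<gamma>2_def chart_inv_chart [OF wfc'])
    have "snd d (?\<pi> (\<gamma>2 t)) = snd d (?\<pi> (\<gamma>1 t))"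
      using W(6) [OF elim(3)] by (simp add: z_def a'_def \<gamma>2_def)
    then have "?\<pi> (\<gamma>1 t) = ?\<pi> (\<gamma>2 t)"
      using chart_inv_chart [OF wfd \<gamma>2d] chart_inv_chart [OF wfd, of "?\<pi> (\<gamma>1 t)"] elim(2) by simp
    moreover have "chart_inv ?cc (a t, a' t) = (\<gamma>1 t, \<gamma>2 t)"
      using chart_inv_prod_chart [OF wfc wfc' elim(1) a'S] by (simp add: \<gamma>1_def \<gamma>2_def)
    ultimately show ?case
      using gts [of "\<gamma>1 t" "\<gamma>2 t"] elim chart_inv_chart [OF wfe elim(5)]
        chart_chart_inv [OF wfc elim(1)] chart_chart_inv [OF wfc' a'S]
      by (simp add: r_def \<gamma>1_def \<gamma>2_def)
  qed
  have r0: "r 0 = snd e p"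
    using chart_inv_prod_chart [OF wfc wfc', of "snd c q" "snd c' q'"] c c'
    by (simp add: r_def a0 ci p_def)
  \<comment> \<open>\<open>L (u, u')\<close> is the velocity of the lifted curve. If
    \<open>h\<close> carries that curve to a known curve \<open>b\<close>, uniqueness of derivatives
    identifies its image with the velocity of \<open>b\<close>; this is used for target and
    source.\<close>
  have key: "mderiv e k h p (L (w1, w2)) = w"
    if "mdiff e k h p" "(b has_derivative (\<lambda>s. s *\<^sub>R w)) (at 0)"
      "\<forall>\<^sub>F t in nhds 0. snd k (h (chart_inv e (r t))) = b t" "w1 = u" "w2 = u'"
    for k :: "('x, 'ex) chart" and h b w w1 w2
  proof -
    have "((\<lambda>y. snd k (h (chart_inv e y))) has_derivative mderiv e k h p) (at (r 0))"
      using mdiff_has_derivative [OF that(1)] by (simp add: r0 comp_def)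
    from has_derivative_compose [OF dr this]
    have "((\<lambda>t. snd k (h (chart_inv e (r t)))) has_derivative
        (\<lambda>s. mderiv e k h p (L (s *\<^sub>R u, s *\<^sub>R u')))) (at 0)" .
    then have "(b has_derivative (\<lambda>s. mderiv e k h p (L (s *\<^sub>R u, s *\<^sub>R u')))) (at 0)"
      by (rule has_derivative_transform_eventually)
        (use that(3) in \<open>auto dest: eventually_nhds_x_imp_x simp: eventually_nhds_conv_at\<close>)
    from has_derivative_unique [OF this that(2)]
    have "mderiv e k h p (L (1 *\<^sub>R u, 1 *\<^sub>R u')) = 1 *\<^sub>R w" by meson
    with that show ?thesis by simp
  qed
  have "ttgt G p (L (u, u')) = u"
  proof -
    have "mderiv e c (tgt G) p (L (u, u')) = u"
    proof (rule key [OF _ da])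
      show "mdiff e c (tgt G) p"
        by (rule smooth_map_mdiff [OF sm(3) e(1) c(1) e(2)]) (use p c in simp)
      show "\<forall>\<^sub>F t in nhds 0. snd c (tgt G (chart_inv e (r t))) = a t"
        using ev6 by eventually_elim simp
    qed auto
    then show ?thesis by (simp add: ttgt_def tmap_eq p e_def c_def)
  qed
  moreover have "tsrc G p (L (u, u')) = u'"
  proof -
    have "mderiv e c' (src G) p (L (u, u')) = u'"
    proof (rule key [OF _ da'])
      show "mdiff e c' (src G) p"
        by (rule smooth_map_mdiff [OF sm(2) e(1) c'(1) e(2)]) (use p c' in simp)
      show "\<forall>\<^sub>F t in nhds 0. snd c' (src G (chart_inv e (r t))) = a' t"
        using ev6 by eventually_elim simp
    qed auto
    then show ?thesis by (simp add: tsrc_def tmap_eq p e_def c'_def)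
  qed
  ultimately show thesis using that p by blast
qed

text \<open>Two tangent vectors of X with the same image in M are target and source of one tangent
  vector of P, on which \<open>delta1 G \<theta>\<close> is the difference of the two values of
  \<theta>.\<close>

lemma delta1_zero_descends:
  assumes "\<theta> \<in> forms1 (objs G)" "delta1 G \<theta> = 0"
  shows "\<exists>\<epsilon>\<in>forms1 (base G). pull1 (objs G) (base G) (proj G) \<epsilon> = \<theta>"
proof (rule forms1_descend [OF gerbe_manifolds(2,1) gerbe_submersions(1) assms(1)])
  fix q u q' u'
  assume "proj G q = proj G q'"
    "tmap (objs G) (base G) (proj G) q u = tmap (objs G) (base G) (proj G) q' u'"
  then obtain p v where "tgt G p = q" "src G p = q'" "ttgt G p v = u" "tsrc G p v = u'"
    by (rule tangent_lift)
  with delta1_eq [of G \<theta> p v] show "\<theta> q u = \<theta> q' u'" by (simp add: assms(2))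
qed

text \<open>Source and target have the same composite with the projection. Applying the differential
  of this identity to \<open>P p\<close> compares \<open>X\<close> at the two ends of
  \<open>p\<close>.\<close>

lemma multiplicative_projects:
  assumes "multiplicative G X P"
  shows "\<exists>x\<in>vec_fields (base G). \<forall>q. tmap (objs G) (base G) (proj G) q (X q) = x (proj G q)"
proof (rule vec_fields_descend [OF gerbe_manifolds(2,1) gerbe_submersions(1)])
  show "X \<in> vec_fields (objs G)" using assms by (simp add: multiplicative_def)
  fix q q' assume "proj G q = proj G q'"
  then have "(q, q') \<in> range (\<lambda>p. (tgt G p, src G p))"
    unfolding range_tgt_src by (simp add: fibre_prod_def)
  then obtain p where p: "tgt G p = q" "src G p = q'" by auto
  have "proj G \<circ> src G = proj G \<circ> tgt G" using proj_src by (simp add: fun_eq_iff)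
  then have "tmap (arrs G) (base G) (proj G \<circ> src G) p (P p) = tmap (arrs G) (base G) (proj G \<circ> tgt G) p (P p)"
    by simp
  then have "tmap (objs G) (base G) (proj G) q' (tsrc G p (P p)) =
      tmap (objs G) (base G) (proj G) q (ttgt G p (P p))"
    by (simp add: tmap_compose [OF gerbe_manifolds(3,2,1) _ gerbe_smooth_maps(1)] gerbe_smooth_maps p
        tsrc_def ttgt_def)
  then show "tmap (objs G) (base G) (proj G) q (X q) = tmap (objs G) (base G) (proj G) q' (X q')"
    using assms p by (simp add: multiplicative_def)
qed

lemma delta1_d0:
  assumes "g \<in> smooth_funs (objs G)"
  shows "delta1 G (d0 (objs G) g) = d0 (arrs G) (delta0 G g)"
proof -
  note s = gerbe_manifolds(3,2) gerbe_submersions(2) and t = gerbe_manifolds(3,2) gerbe_submersions(3)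
  show ?thesis
    by (intro ext) (simp add: delta0_def d0_diff [OF gerbe_manifolds(3)] smooth_funs_pullback [OF s assms]
        smooth_funs_pullback [OF t assms] d0_pullback [OF s assms] d0_pullback [OF t assms]
        delta1_eq tsrc_def ttgt_def)
qed

text \<open>\<open>\<delta>\<alpha> = L_P \<gamma> = \<iota>_P d\<gamma> + d \<iota>_P
  \<gamma>\<close>. Here \<open>d\<gamma> = \<delta>B\<close>, and contracting with \<open>P\<close>
  becomes contracting \<open>B\<close> with \<open>X\<close> because \<open>P\<close> is related to
  \<open>X\<close> by source and target; moreover \<open>\<iota>_P \<gamma> = \<delta>g\<close>, and
  \<delta> commutes with d.\<close>

lemma delta1_rho_form:
  assumes \<gamma>: "\<gamma> \<in> forms1 (arrs G)" and "curving G \<gamma> B"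
    and "(X, P, \<alpha>) \<in> sym0_carrier G \<gamma>" "g \<in> smooth_funs (objs G)" "delta0 G g = contr1 P \<gamma>"
  shows "delta1 G (\<alpha> - contr2 X B - d0 (objs G) g) = 0"
proof (intro ext)
  fix p v
  have mult: "multiplicative G X P" and L: "lie_deriv1 (arrs G) P \<gamma> = delta1 G \<alpha>"
    using assms(3) by (auto simp: sym0_carrier_def)
  have P: "P \<in> vec_fields (arrs G)" and st: "tsrc G p (P p) = X (src G p)" "ttgt G p (P p) = X (tgt G p)"
    using mult by (auto simp: multiplicative_def)
  have "delta1 G \<alpha> p v = d1 (arrs G) \<gamma> p (P p) v + d0 (arrs G) (contr1 P \<gamma>) p v"
    unfolding L [symmetric] by (rule cartan_formula [OF gerbe_manifolds(3) P \<gamma>])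
  also have "d1 (arrs G) \<gamma> p (P p) v = delta2 G B p (P p) v"
    using assms(2) by (simp add: curving_def)
  also have "\<dots> = delta1 G (contr2 X B) p v"
    using st by (simp add: delta2_def pull2_def delta1_eq contr2_def tsrc_def ttgt_def)
  also have "d0 (arrs G) (contr1 P \<gamma>) p v = delta1 G (d0 (objs G) g) p v"
    by (simp add: delta1_d0 [OF assms(4)] assms(5))
  finally show "delta1 G (\<alpha> - contr2 X B - d0 (objs G) g) p v = (0 :: 'p \<Rightarrow> 'ep \<Rightarrow> real) p v"
    by (simp add: delta1_eq)
qed

section \<open>The coset description of the composite\<close>

lemmas proj_submersion = gerbe_manifolds(2,1) gerbe_submersions(1)

lemma pull1_d0:
  assumes "h \<in> smooth_funs (base G)"
  shows "pull1 (objs G) (base G) (proj G) (d0 (base G) h) = d0 (objs G) (h \<circ> proj G)"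
  by (simp add: fun_eq_iff pull1_def d0_pullback [OF proj_submersion assms])

text \<open>Both descriptions in \<open>gerbe_rho\<close> have at most one solution, since the
  projection is surjective on points and on tangent vectors.\<close>

lemma rho_graph_rho:
  assumes "rho_graph G B e w"
  shows "gerbe_rho G B e = w"
proof -
  obtain X P \<alpha> g x \<nu> where e: "e = ((X, P, \<alpha>), g)" and w: "w = (x, \<nu>)"
    by (metis surj_pair)
  have x: "x \<in> vec_fields (base G)" "\<And>q. tmap (objs G) (base G) (proj G) q (X q) = x (proj G q)"
    and \<nu>: "\<nu> \<in> forms1 (base G)" "pull1 (objs G) (base G) (proj G) (- \<nu>) = \<alpha> - contr2 X B - d0 (objs G) g"
    using assms by (auto simp: rho_graph_def e w)
  have "(THE y. y \<in> vec_fields (base G) \<and>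
      (\<forall>q. tmap (objs G) (base G) (proj G) q (X q) = y (proj G q))) = x"
  proof (rule the_equality)
    fix y assume "y \<in> vec_fields (base G) \<and> (\<forall>q. tmap (objs G) (base G) (proj G) q (X q) = y (proj G q))"
    with x(2) have "y (proj G q) = x (proj G q)" for q by simp
    then show "y = x" using submersion_surj [OF proj_submersion] by (metis ext)
  qed (use x in simp)
  moreover have "(THE \<epsilon>. \<epsilon> \<in> forms1 (base G) \<and>
      pull1 (objs G) (base G) (proj G) \<epsilon> = \<alpha> - contr2 X B - d0 (objs G) g) = - \<nu>"
  proof (rule the_equality)
    fix \<epsilon> assume "\<epsilon> \<in> forms1 (base G) \<and>
      pull1 (objs G) (base G) (proj G) \<epsilon> = \<alpha> - contr2 X B - d0 (objs G) g"
    then have "pull1 (objs G) (base G) (proj G) \<epsilon> = pull1 (objs G) (base G) (proj G) (- \<nu>)"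
      using \<nu>(2) by simp
    then show "\<epsilon> = - \<nu>" by (rule pull1_inject [OF proj_submersion])
  qed (use \<nu> forms1_minus [OF gerbe_manifolds(1)] in simp)
  ultimately show ?thesis by (simp add: gerbe_rho_def e w)
qed

lemma rho_graph_codomain: "rho_graph G B e w \<Longrightarrow> w \<in> vec_fields (base G) \<times> forms1 (base G)"
  by (auto simp: rho_graph_def split: prod.splits)

text \<open>This makes \<rho> meaningful on the whole butterfly: the vector field descends by
  multiplicativity, the form because \<delta> kills it.\<close>

lemma rho_graph_exists:
  assumes "\<gamma> \<in> forms1 (arrs G)" "curving G \<gamma> B" "e \<in> gerbe_total G \<gamma>"
  shows "\<exists>w. rho_graph G B e w"
proof -
  obtain X P \<alpha> g where e: "e = ((X, P, \<alpha>), g)" by (metis surj_pair)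
  have *: "(X, P, \<alpha>) \<in> sym0_carrier G \<gamma>" "g \<in> smooth_funs (objs G)" "delta0 G g = contr1 P \<gamma>"
    using assms(3) by (auto simp: gerbe_total_def e)
  then have mult: "multiplicative G X P" and \<alpha>: "\<alpha> \<in> forms1 (objs G)"
    by (auto simp: sym0_carrier_def)
  obtain x where x: "x \<in> vec_fields (base G)"
    "\<forall>q. tmap (objs G) (base G) (proj G) q (X q) = x (proj G q)"
    using multiplicative_projects [OF mult] by blast
  have "\<alpha> - contr2 X B - d0 (objs G) g \<in> forms1 (objs G)"
    using mult assms(2)
    by (intro forms1_diff [OF gerbe_manifolds(2)] \<alpha> contr2_forms1 [OF gerbe_manifolds(2)] d0_forms1 [OF gerbe_manifolds(2)] *)
      (auto simp: multiplicative_def curving_def)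
  from delta1_zero_descends [OF this delta1_rho_form [OF assms(1,2) *]]
  obtain \<epsilon> where "\<epsilon> \<in> forms1 (base G)"
    "pull1 (objs G) (base G) (proj G) \<epsilon> = \<alpha> - contr2 X B - d0 (objs G) g" by blast
  then have "rho_graph G B e (x, - \<epsilon>)"
    using x forms1_minus [OF gerbe_manifolds(1)] by (simp add: rho_graph_def e)
  then show ?thesis by blast
qed

lemma rho_graph_add_function:
  assumes "rho_graph G B (\<xi>, g) (x, \<nu>)" "g \<in> smooth_funs (objs G)" "h \<in> smooth_funs (base G)"
  shows "rho_graph G B (\<xi>, g + (h \<circ> proj G)) (x, \<nu> + d0 (base G) h)"
proof -
  have "pull1 (objs G) (base G) (proj G) (- (\<nu> + d0 (base G) h)) =
      pull1 (objs G) (base G) (proj G) (- \<nu>) - d0 (objs G) (h \<circ> proj G)"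
    by (simp add: pull1_diff pull1_d0 [OF assms(3)])
  moreover have "d0 (objs G) (g + (h \<circ> proj G)) = d0 (objs G) g + d0 (objs G) (h \<circ> proj G)"
    by (rule d0_add [OF gerbe_manifolds(2) assms(2) smooth_funs_pullback [OF proj_submersion assms(3)]])
  ultimately show ?thesis
    using assms(1) forms1_add [OF gerbe_manifolds(1) _ d0_forms1 [OF gerbe_manifolds(1) assms(3)]]
    by (cases \<xi>) (auto simp: rho_graph_def diff_diff_eq)
qed

text \<open>The form \<nu> is \<open>- \<epsilon>\<close>, and \<epsilon> loses the contraction of
  \<tau>; so \<nu> gains it, with the sign that \<open>courant_shift\<close> has.\<close>

lemma rho_graph_change_curving:
  assumes "rho_graph G B e (x, \<nu>)" "\<tau> \<in> forms2 (base G)"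
  shows "rho_graph G (B + pull2 (objs G) (base G) (proj G) \<tau>) e (x, \<nu> + contr2 x \<tau>)"
proof -
  obtain X P \<alpha> g where e: "e = ((X, P, \<alpha>), g)" by (metis surj_pair)
  have x: "x \<in> vec_fields (base G)" "\<And>q. tmap (objs G) (base G) (proj G) q (X q) = x (proj G q)"
    using assms by (auto simp: rho_graph_def e)
  have "pull1 (objs G) (base G) (proj G) (contr2 x \<tau>) = contr2 X (pull2 (objs G) (base G) (proj G) \<tau>)"
    by (simp add: fun_eq_iff pull1_def pull2_def contr2_def x(2))
  then have "pull1 (objs G) (base G) (proj G) (- (\<nu> + contr2 x \<tau>)) =
      pull1 (objs G) (base G) (proj G) (- \<nu>) - contr2 X (pull2 (objs G) (base G) (proj G) \<tau>)"
    by (simp add: pull1_diff)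
  moreover have "contr2 X (B + pull2 (objs G) (base G) (proj G) \<tau>) =
      contr2 X B + contr2 X (pull2 (objs G) (base G) (proj G) \<tau>)"
    by (simp add: fun_eq_iff contr2_def)
  ultimately show ?thesis
    using assms(1) forms1_add [OF gerbe_manifolds(1) _ contr2_forms1 [OF gerbe_manifolds(1) x(1) assms(2)]]
    by (auto simp: rho_graph_def e diff_diff_eq add.commute)
qed

lemma coset_shift_add:
  assumes "h \<in> smooth_funs (base G)" "k \<in> smooth_funs (base G)"
  shows "coset_shift G (h + k) = coset_shift G h + coset_shift G k"
  by (simp add: coset_shift_def d0_add [OF gerbe_manifolds(1) assms] fun_eq_iff)

lemma coset_shift_scaleR:
  assumes "h \<in> smooth_funs (base G)"
  shows "coset_shift G (r *\<^sub>R h) = r *\<^sub>R coset_shift G h"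
proof -
  have "(r *\<^sub>R h) \<circ> proj G = r *\<^sub>R (h \<circ> proj G)"
    by (simp add: fun_eq_iff scaleR_fun_def)
  then show ?thesis by (simp add: coset_shift_def d0_scaleR [OF gerbe_manifolds(1) assms])
qed

lemma coset_shift_zero: "coset_shift G 0 = 0"
  using coset_shift_scaleR [OF smooth_funs_zero [OF gerbe_manifolds(1)], of 0] by simp

lemma mem_coset: "a \<in> coset G a"
  unfolding coset_def
  by (rule image_eqI [of _ _ 0]) (simp_all add: coset_shift_zero smooth_funs_zero [OF gerbe_manifolds(1)])

lemma coset_absorb:
  assumes h: "h \<in> smooth_funs (base G)"
  shows "coset G (a + coset_shift G h) = coset G a"
proof -
  have "a + coset_shift G h + coset_shift G k \<in> coset G a" if "k \<in> smooth_funs (base G)" for k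
    unfolding coset_def
    by (rule image_eqI [of _ _ "h + k"])
      (simp_all add: coset_shift_add [OF h that] smooth_funs_add [OF gerbe_manifolds(1) h that] add.assoc)
  moreover have "a + coset_shift G k \<in> coset G (a + coset_shift G h)" if "k \<in> smooth_funs (base G)" for k
  proof -
    have "k - h \<in> smooth_funs (base G)" by (rule smooth_funs_diff [OF gerbe_manifolds(1) that h])
    moreover have "coset_shift G k = coset_shift G h + coset_shift G (k - h)"
      using coset_shift_add [OF h calculation] by simp
    ultimately show ?thesis
      unfolding coset_def by (intro image_eqI [of _ _ "k - h"]) (simp_all only: add.assoc)
  qed
  ultimately show ?thesis unfolding coset_def by blast
qed

lemma coset_eqI:
  assumes "b \<in> coset G a"
  shows "coset G b = coset G a"
proof -
  obtain h where "h \<in> smooth_funs (base G)" "b = a + coset_shift G h"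
    using assms unfolding coset_def by (rule imageE)
  then show ?thesis by (simp only: coset_absorb)
qed

lemma comp_coset_eq:
  "comp_coset (courant_lie2 (base G) chi) (gerbe_butterfly G \<gamma> B) (shift_butterfly (base G) chi \<tau>) =
    coset G"
  by (simp add: fun_eq_iff comp_coset_def coset_def coset_shift_def gerbe_butterfly_simps
      shift_butterfly_simps dsum_vspace_simps courant_lie2_def Let_def subspace_vspace_def)

text \<open>\<open>sum_merge\<close> is constant on cosets, so the image of a coset is a singleton
  and \<open>the_elem\<close> reads off the induced map.\<close>

lemma the_sum_merge_coset: "the_elem (sum_merge G ` coset G a) = sum_merge G a"
proof -
  have "sum_merge G ` coset G a = {sum_merge G a}"
    unfolding coset_def image_image sum_merge_shift
    by (rule image_constant [OF smooth_funs_zero [OF gerbe_manifolds(1)]])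
  then show ?thesis by simp
qed

text \<open>An equation with \<open>gerbe_rho\<close> says something about its components only if
  the described objects exist; \<open>rho_graph_exists\<close> provides this for the passage from
  the equation to the relation.\<close>

lemma fibre_sum_eq:
  assumes "\<gamma> \<in> forms1 (arrs G)" "curving G \<gamma> B"
  shows "{(e, e') \<in> vcarrier (dsum_vspace (total (gerbe_butterfly G \<gamma> B)) (total (shift_butterfly (base G) chi \<tau>))).
      rho (gerbe_butterfly G \<gamma> B) e = sig (shift_butterfly (base G) chi \<tau>) e'} = fibre_sum G \<gamma> B"
proof -
  have *: "w \<in> vec_fields (base G) \<times> forms1 (base G) \<and> gerbe_rho G B e = w \<longleftrightarrow> rho_graph G B e w"
    if e: "e \<in> gerbe_total G \<gamma>" for e w
  proof
    assume *: "rho_graph G B e w"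
    show "w \<in> vec_fields (base G) \<times> forms1 (base G) \<and> gerbe_rho G B e = w"
      by (rule conjI [OF rho_graph_codomain [OF *] rho_graph_rho [OF *]])
  next
    assume w: "w \<in> vec_fields (base G) \<times> forms1 (base G) \<and> gerbe_rho G B e = w"
    obtain w' where w': "rho_graph G B e w'" using rho_graph_exists [OF assms e] by blast
    with rho_graph_rho [OF w'] w show "rho_graph G B e w" by simp
  qed
  show ?thesis (is "?L = ?R")
  proof (rule set_eqI)
    fix z :: "(('x, 'ex, 'p, 'ep) sym0 \<times> ('x \<Rightarrow> real)) \<times> (('m \<Rightarrow> real) \<times> ('m, 'em) courant0)"
    obtain e f w where z: "z = (e, (f, w))" by (rule prod_cases3)
    have "z \<in> ?L \<longleftrightarrow> e \<in> gerbe_total G \<gamma> \<and> f \<in> smooth_funs (base G) \<and>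
        w \<in> vec_fields (base G) \<times> forms1 (base G) \<and> gerbe_rho G B e = w"
      by (simp only: z dsum_vspace_def vspace.simps gerbe_butterfly_simps shift_butterfly_simps
          mem_Collect_eq prod.case mem_Sigma_iff conj_assoc)
    moreover have "z \<in> ?R \<longleftrightarrow> e \<in> gerbe_total G \<gamma> \<and> f \<in> smooth_funs (base G) \<and> rho_graph G B e w"
      by (simp only: z fibre_sum_def mem_Collect_eq prod.case)
    ultimately show "z \<in> ?L \<longleftrightarrow> z \<in> ?R" using * [of e w] by blast
  qed
qed

section \<open>Compatibility of the brackets\<close>

lemma contr1_zero_d0: "f \<in> smooth_funs (base G) \<Longrightarrow> contr1 0 (d0 (base G) f) = 0"
  using linear_0 [OF linear_d0 [OF gerbe_manifolds(1)]] by (simp add: fun_eq_iff contr1_def)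

lemma contr1_d0_pullback:
  assumes "rho_graph G B ((X, P, \<alpha>), g) (x, \<nu>)" "k \<in> smooth_funs (base G)"
  shows "contr1 X (d0 (objs G) (k \<circ> proj G)) = contr1 x (d0 (base G) k) \<circ> proj G"
  using assms(1) by (simp add: fun_eq_iff contr1_def d0_pullback [OF proj_submersion assms(2)] rho_graph_def)

text \<open>The Lie derivatives of the exact parts contribute d of A - C, where A and C are the two
  contractions, and the correction term removes half of it. The term with \<open>chi\<close>
  involves only \<open>x\<close> and \<open>x'\<close>.\<close>

lemma courant_bracket_exact:
  assumes x: "x \<in> vec_fields (base G)" "x' \<in> vec_fields (base G)"
    and \<nu>: "\<nu> \<in> forms1 (base G)" "\<nu>' \<in> forms1 (base G)"
    and h: "h \<in> smooth_funs (base G)" "k \<in> smooth_funs (base G)"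
  shows "courant_bracket (base G) chi (x, \<nu> + d0 (base G) h) (x', \<nu>' + d0 (base G) k) =
    courant_bracket (base G) chi (x, \<nu>) (x', \<nu>') +
    (0, d0 (base G) ((1/2) *\<^sub>R (contr1 x (d0 (base G) k) - contr1 x' (d0 (base G) h))))"
proof -
  let ?M = "base G"
  define A where "A = contr1 x (d0 ?M k)"
  define C where "C = contr1 x' (d0 ?M h)"
  define D where "D = contr1 x \<nu>' - contr1 x' \<nu>"
  note d = d0_forms1 [OF gerbe_manifolds(1)] and c = contr1_smooth [OF gerbe_manifolds(1)]
  have AC: "A \<in> smooth_funs ?M" "C \<in> smooth_funs ?M" "D \<in> smooth_funs ?M"
    unfolding A_def C_def D_def by (intro c x \<nu> d h smooth_funs_diff [OF gerbe_manifolds(1)])+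
  have AC': "A - C \<in> smooth_funs ?M" by (rule smooth_funs_diff [OF gerbe_manifolds(1) AC(1,2)])
  have L: "lie_deriv1 ?M x (\<nu>' + d0 ?M k) = lie_deriv1 ?M x \<nu>' + d0 ?M A"
    "lie_deriv1 ?M x' (\<nu> + d0 ?M h) = lie_deriv1 ?M x' \<nu> + d0 ?M C"
    unfolding A_def C_def
    by (simp_all add: lie_deriv1_add [OF gerbe_manifolds(1)] \<nu> d h lie_deriv1_d0 [OF gerbe_manifolds(1)] x)
  have "contr1 x (\<nu>' + d0 ?M k) - contr1 x' (\<nu> + d0 ?M h) = D + (A - C)"
    by (simp add: contr1_add A_def C_def D_def)
  then have E: "d0 ?M (contr1 x (\<nu>' + d0 ?M k) - contr1 x' (\<nu> + d0 ?M h)) = d0 ?M D + d0 ?M (A - C)"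
    by (simp add: d0_add [OF gerbe_manifolds(1) AC(3) AC'])
  have F: "d0 ?M (A - C) = d0 ?M A - d0 ?M C" by (rule d0_diff [OF gerbe_manifolds(1) AC(1,2)])
  have H: "d0 ?M ((1/2) *\<^sub>R (A - C)) = (1/2) *\<^sub>R (d0 ?M A - d0 ?M C)"
    by (simp only: d0_scaleR [OF gerbe_manifolds(1) AC'] F)
  show ?thesis
    unfolding courant_bracket_def prod.case L E F H A_def [symmetric] C_def [symmetric] D_def [symmetric]
    by (simp add: fun_eq_iff scaleR_fun_def field_simps)
qed

text \<open>With K half the difference of the contractions of \<open>dk\<close> with
  \<open>x\<close> and of \<open>dh\<close> with \<open>x'\<close>, the three parts of the bracket
  change by the pullback of K, by - K and by dK. Together this is exactly
  \<open>coset_shift G K\<close>.\<close>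

lemma fibre_sum_bracket_shift:
  assumes a: "a \<in> fibre_sum G \<gamma> B" and b: "b \<in> fibre_sum G \<gamma> B"
    and h: "h \<in> smooth_funs (base G)" and k: "k \<in> smooth_funs (base G)"
  shows "fibre_sum_bracket G \<gamma> B chi \<tau> (a + coset_shift G h) (b + coset_shift G k) \<in>
    coset G (fibre_sum_bracket G \<gamma> B chi \<tau> a b)"
proof -
  let ?M = "base G"
  obtain e f x \<nu> where ae: "a = (e, (f, (x, \<nu>)))" by (rule prod_cases4)
  obtain X P \<alpha> g where e: "e = ((X, P, \<alpha>), g)" by (metis surj_pair)
  note a' = ae [unfolded e]
  obtain e' f' x' \<nu>' where be: "b = (e', (f', (x', \<nu>')))" by (rule prod_cases4)
  obtain Z R \<beta> g' where e': "e' = ((Z, R, \<beta>), g')" by (metis surj_pair)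
  note b' = be [unfolded e']
  have A: "g \<in> smooth_funs (objs G)" "f \<in> smooth_funs ?M" "rho_graph G B ((X, P, \<alpha>), g) (x, \<nu>)"
    "x \<in> vec_fields ?M" "\<nu> \<in> forms1 ?M"
    using a by (auto simp: a' fibre_sum_def gerbe_total_def rho_graph_def)
  have B: "g' \<in> smooth_funs (objs G)" "f' \<in> smooth_funs ?M" "rho_graph G B ((Z, R, \<beta>), g') (x', \<nu>')"
    "x' \<in> vec_fields ?M" "\<nu>' \<in> forms1 ?M"
    using b by (auto simp: b' fibre_sum_def gerbe_total_def rho_graph_def)
  define K where "K = (1/2) *\<^sub>R (contr1 x (d0 ?M k) - contr1 x' (d0 ?M h))"
  have K: "K \<in> smooth_funs ?M"
    unfolding K_def
    by (intro smooth_funs_scaleR smooth_funs_diff contr1_smooth d0_forms1 gerbe_manifolds(1) A B h k)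
  have d0h: "d0 (objs G) (g + (h \<circ> proj G)) = d0 (objs G) g + d0 (objs G) (h \<circ> proj G)"
    by (rule d0_add [OF gerbe_manifolds(2) A(1) smooth_funs_pullback [OF proj_submersion h]])
  have d0k: "d0 (objs G) (g' + (k \<circ> proj G)) = d0 (objs G) g' + d0 (objs G) (k \<circ> proj G)"
    by (rule d0_add [OF gerbe_manifolds(2) B(1) smooth_funs_pullback [OF proj_submersion k]])
  have "fibre_sum_bracket G \<gamma> B chi \<tau> (a + coset_shift G h) (b + coset_shift G k) =
      fibre_sum_bracket G \<gamma> B chi \<tau> a b + coset_shift G K"
  proof -
    have 1: "a + coset_shift G h = (((X, P, \<alpha>), g + (h \<circ> proj G)), (f - h, (x, \<nu> + d0 ?M h)))"
      "b + coset_shift G k = (((Z, R, \<beta>), g' + (k \<circ> proj G)), (f' - k, (x', \<nu>' + d0 ?M k)))"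
      by (simp_all add: a' b' coset_shift_def zero_prod_def)
    have 2: "(1/2) *\<^sub>R (contr1 X (\<beta> + d0 (objs G) (g' + (k \<circ> proj G))) - contr1 Z (\<alpha> + d0 (objs G) (g + (h \<circ> proj G)))) =
       (1/2) *\<^sub>R (contr1 X (\<beta> + d0 (objs G) g') - contr1 Z (\<alpha> + d0 (objs G) g)) + (K \<circ> proj G)"
      unfolding d0h d0k K_def
      by (simp add: contr1_add contr1_d0_pullback [OF A(3) k] contr1_d0_pullback [OF B(3) h]
          fun_eq_iff scaleR_fun_def field_simps)
    have 3: "(1/2) *\<^sub>R contr1 x (d0 ?M (f' - k)) - (1/2) *\<^sub>R contr1 x' (d0 ?M (f - h)) =
       (1/2) *\<^sub>R contr1 x (d0 ?M f') - (1/2) *\<^sub>R contr1 x' (d0 ?M f) - K"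
      unfolding K_def
      by (simp add: d0_diff [OF gerbe_manifolds(1)] B(2) k A(2) h contr1_diff fun_eq_iff scaleR_fun_def field_simps)
    show ?thesis
      unfolding 1 fibre_sum_bracket_def fst_conv snd_conv gerbe_butterfly_simps shift_butterfly_simps 2
        courant_bracket_exact [OF A(4) B(4) A(5) B(5) h k] K_def [symmetric] 3
        contr1_zero_d0 [OF smooth_funs_diff [OF gerbe_manifolds(1) B(2) k]]
      unfolding a' b' fst_conv snd_conv gerbe_butterfly_simps shift_butterfly_simps
        contr1_zero_d0 [OF B(2)] coset_shift_def
      by simp
  qed
  then show ?thesis using K by (simp add: coset_def)
qed

text \<open>The bracket is affine in \<open>dg\<close> and \<open>dg'\<close>, and the contribution
  of a pulled-back \<open>f\<close> is the pullback of the function part of the strict butterfly's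
  bracket. A curving enters only \<open>rho\<close>, so \<open>B'\<close> is arbitrary here.\<close>

lemma sum_merge_fibre_sum_bracket:
  assumes a: "a \<in> fibre_sum G \<gamma> B" and b: "b \<in> fibre_sum G \<gamma> B"
  shows "sum_merge G (fibre_sum_bracket G \<gamma> B chi \<tau> a b) = brak (gerbe_butterfly G \<gamma> B') (sum_merge G a) (sum_merge G b)"
proof -
  let ?M = "base G"
  obtain e f x \<nu> where ae: "a = (e, (f, (x, \<nu>)))" by (rule prod_cases4)
  obtain X P \<alpha> g where e: "e = ((X, P, \<alpha>), g)" by (metis surj_pair)
  note a' = ae [unfolded e]
  obtain e' f' x' \<nu>' where be: "b = (e', (f', (x', \<nu>')))" by (rule prod_cases4)
  obtain Z R \<beta> g' where e': "e' = ((Z, R, \<beta>), g')" by (metis surj_pair)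
  note b' = be [unfolded e']
  have A: "g \<in> smooth_funs (objs G)" "f \<in> smooth_funs ?M" "rho_graph G B ((X, P, \<alpha>), g) (x, \<nu>)"
    using a by (auto simp: a' fibre_sum_def gerbe_total_def)
  have B: "g' \<in> smooth_funs (objs G)" "f' \<in> smooth_funs ?M" "rho_graph G B ((Z, R, \<beta>), g') (x', \<nu>')"
    using b by (auto simp: b' fibre_sum_def gerbe_total_def)
  have d0f: "d0 (objs G) (g + (f \<circ> proj G)) = d0 (objs G) g + d0 (objs G) (f \<circ> proj G)"
    by (rule d0_add [OF gerbe_manifolds(2) A(1) smooth_funs_pullback [OF proj_submersion A(2)]])
  have d0f': "d0 (objs G) (g' + (f' \<circ> proj G)) = d0 (objs G) g' + d0 (objs G) (f' \<circ> proj G)"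
    by (rule d0_add [OF gerbe_manifolds(2) B(1) smooth_funs_pullback [OF proj_submersion B(2)]])
  show ?thesis
    unfolding a' b' fibre_sum_bracket_def sum_merge_def fst_conv snd_conv prod.case gerbe_butterfly_simps
      shift_butterfly_simps d0f d0f' contr1_zero_d0 [OF B(2)]
    by (simp add: contr1_add contr1_d0_pullback [OF A(3) B(2)] contr1_d0_pullback [OF B(3) A(2)]
        fun_eq_iff scaleR_fun_def field_simps)
qed

lemma sum_merge_fibre_sum_inj:
  assumes a: "a \<in> fibre_sum G \<gamma> B" and b: "b \<in> fibre_sum G \<gamma> B" and eq: "sum_merge G a = sum_merge G b"
  shows "coset G a = coset G b"
proof -
  let ?M = "base G"
  obtain e f x \<nu> where "a = (e, (f, (x, \<nu>)))" by (rule prod_cases4)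
  moreover obtain \<xi> g where "e = (\<xi>, g)" by (rule prod.exhaust)
  ultimately have a': "a = ((\<xi>, g), (f, (x, \<nu>)))" by simp
  obtain e' f' w' where "b = (e', (f', w'))" by (rule prod_cases3)
  moreover obtain \<xi>' g' where "e' = (\<xi>', g')" by (rule prod.exhaust)
  ultimately have b': "b = ((\<xi>', g'), (f', w'))" by simp
  have A: "g \<in> smooth_funs (objs G)" "f \<in> smooth_funs ?M" "rho_graph G B (\<xi>, g) (x, \<nu>)"
    using a by (auto simp: a' fibre_sum_def gerbe_total_def)
  have B: "f' \<in> smooth_funs ?M" "rho_graph G B (\<xi>', g') w'"
    using b by (auto simp: b' fibre_sum_def)
  have e: "\<xi>' = \<xi>" "g + (f \<circ> proj G) = g' + (f' \<circ> proj G)"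
    using eq by (auto simp: sum_merge_def a' b')
  define h where "h = f - f'"
  have h: "h \<in> smooth_funs ?M" unfolding h_def by (rule smooth_funs_diff [OF gerbe_manifolds(1) A(2) B(1)])
  have "g' q = g q + f (proj G q) - f' (proj G q)" for q
    using fun_cong [OF e(2), of q] by simp
  then have g': "g' = g + (h \<circ> proj G)" by (simp add: h_def fun_eq_iff)
  \<comment> \<open>The last components are values of \<rho> at functions differing by the pullback
    of \<open>h\<close>, so they differ by \<open>dh\<close>.\<close>
  have "w' = (x, \<nu> + d0 ?M h)"
    using rho_graph_rho [OF rho_graph_add_function [OF A(3,1) h]] rho_graph_rho [OF B(2)]
    by (simp add: e(1) g')
  then have "b = a + coset_shift G h"
    by (simp add: a' b' e(1) g' coset_shift_def h_def)
  then show ?thesis using coset_absorb [OF h] by simp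
qed

lemma sum_merge_fibre_sum_image:
  assumes "\<gamma> \<in> forms1 (arrs G)" "curving G \<gamma> B"
  shows "sum_merge G ` fibre_sum G \<gamma> B = gerbe_total G \<gamma>"
proof
  have "delta0 G (h \<circ> proj G) = 0" for h
    using proj_src by (simp add: delta0_def fun_eq_iff)
  moreover have "delta0 G (g + h) = delta0 G g + delta0 G h" for g h
    by (simp add: delta0_def fun_eq_iff)
  ultimately show "sum_merge G ` fibre_sum G \<gamma> B \<subseteq> gerbe_total G \<gamma>"
    using smooth_funs_pullback [OF proj_submersion] smooth_funs_add [OF gerbe_manifolds(2)]
    by (auto simp: fibre_sum_def gerbe_total_def sum_merge_def)
  show "gerbe_total G \<gamma> \<subseteq> sum_merge G ` fibre_sum G \<gamma> B"
  proof
    fix e assume e: "e \<in> gerbe_total G \<gamma>"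
    then obtain w where "rho_graph G B e w" using rho_graph_exists [OF assms] by blast
    \<comment> \<open>Every element is hit by its own pair with function part 0, provided that it
      has a value under \<rho>.\<close>
    with e have "(e, (0, w)) \<in> fibre_sum G \<gamma> B"
      using smooth_funs_zero [OF gerbe_manifolds(1)] by (simp add: fibre_sum_def)
    moreover have "sum_merge G (e, (0, w)) = e"
      by (simp add: sum_merge_def split_beta comp_def prod_eq_iff fun_eq_iff)
    ultimately show "e \<in> sum_merge G ` fibre_sum G \<gamma> B" by (metis imageI)
  qed
qed

text \<open>Shifting replaces \<open>f\<close> by \<open>f - h\<close> and \<nu> by
  \<open>\<nu> + dh\<close>, so that \<open>df + \<nu>\<close> is unchanged; the remaining term in
  \<tau> is the effect of the new curving.\<close>

lemma rho_fibre_sum_shift: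
  assumes "a \<in> fibre_sum G \<gamma> B" "h \<in> smooth_funs (base G)" and \<tau>: "\<tau> \<in> forms2 (base G)"
  shows "rho (shift_butterfly (base G) chi \<tau>) (snd (a + coset_shift G h)) =
    gerbe_rho G (B + pull2 (objs G) (base G) (proj G) \<tau>) (sum_merge G a)"
proof -
  let ?M = "base G"
  obtain e f x \<nu> where "a = (e, (f, (x, \<nu>)))" by (rule prod_cases4)
  moreover obtain \<xi> g where "e = (\<xi>, g)" by (rule prod.exhaust)
  ultimately have a': "a = ((\<xi>, g), (f, (x, \<nu>)))" by simp
  have A: "g \<in> smooth_funs (objs G)" "f \<in> smooth_funs ?M" "rho_graph G B (\<xi>, g) (x, \<nu>)"
    using assms(1) by (auto simp: a' fibre_sum_def gerbe_total_def)
  have "gerbe_rho G (B + pull2 (objs G) ?M (proj G) \<tau>) (sum_merge G a) = (x, \<nu> + d0 ?M f + contr2 x \<tau>)"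
    using rho_graph_rho [OF rho_graph_change_curving [OF rho_graph_add_function [OF A(3,1,2)] \<tau>]]
    by (simp add: sum_merge_def a')
  then show ?thesis
    by (simp add: a' coset_shift_def shift_butterfly_simps d0_diff [OF gerbe_manifolds(1) A(2) assms(2)] algebra_simps)
qed

section \<open>The operations of the composite, evaluated on representatives\<close>

context
  fixes \<gamma> :: "'p \<Rightarrow> 'ep \<Rightarrow> real" and B :: "'x \<Rightarrow> 'ex \<Rightarrow> 'ex \<Rightarrow> real"
    and chi :: "'m \<Rightarrow> 'em \<Rightarrow> 'em \<Rightarrow> 'em \<Rightarrow> real" and \<tau> :: "'m \<Rightarrow> 'em \<Rightarrow> 'em \<Rightarrow> real"
  assumes \<gamma>: "\<gamma> \<in> forms1 (arrs G)" and B: "curving G \<gamma> B"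
    and \<tau>: "\<tau> \<in> forms2 (base G)"
begin

abbreviation (input) composite where
  "composite \<equiv> butterfly_comp (courant_lie2 (base G) chi) (shift_butterfly (base G) chi \<tau>)
    (gerbe_butterfly G \<gamma> B)"

lemma dsum_total_simps:
  "vadd (dsum_vspace (total (gerbe_butterfly G \<gamma> B)) (total (shift_butterfly (base G) chi \<tau>))) = (+)"
  "vscale (dsum_vspace (total (gerbe_butterfly G \<gamma> B)) (total (shift_butterfly (base G) chi \<tau>))) = (*\<^sub>R)"
  by (rule dsum_vspace_simps; rule gerbe_butterfly_simps shift_butterfly_simps)+

lemma composite_carrier: "vcarrier (total composite) = coset G ` fibre_sum G \<gamma> B"
  by (simp only: butterfly_comp_def Let_def comp_coset_eq fibre_sum_eq [OF \<gamma> B]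
      butterfly.simps vspace.simps)

text \<open>The sum of two cosets is a union over all pairs of representatives. Changing
  representatives alters the sum by a shift, so all the united cosets coincide, and
  \<open>mem_coset\<close> shows that the union is not empty.\<close>

lemma composite_vadd: "vadd (total composite) (coset G a) (coset G b) = coset G (a + b)"
proof -
  have "(\<Union>a'\<in>coset G a. \<Union>b'\<in>coset G b. coset G (a' + b')) = coset G (a + b)"
  proof (rule UN2_const [OF mem_coset mem_coset])
    fix a' b' assume a': "a' \<in> coset G a" and b': "b' \<in> coset G b"
    obtain h where h: "h \<in> smooth_funs (base G)" "a' = a + coset_shift G h"
      using a' by (rule coset_elem)
    obtain k where k: "k \<in> smooth_funs (base G)" "b' = b + coset_shift G k"
      using b' by (rule coset_elem)
    have "a' + b' = a + b + coset_shift G (h + k)"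
      by (simp only: h(2) k(2) coset_shift_add [OF h(1) k(1)] ac_simps)
    then show "coset G (a' + b') = coset G (a + b)"
      by (simp only: coset_absorb [OF smooth_funs_add [OF gerbe_manifolds(1) h(1) k(1)]])
  qed
  then show ?thesis
    by (simp only: butterfly_comp_def Let_def comp_coset_eq dsum_total_simps
        butterfly.simps vspace.simps)
qed

lemma composite_vscale: "vscale (total composite) r (coset G a) = coset G (r *\<^sub>R a)"
proof -
  have "coset G (r *\<^sub>R a') = coset G (r *\<^sub>R a)" if a': "a' \<in> coset G a" for a'
  proof -
    obtain h where h: "h \<in> smooth_funs (base G)" "a' = a + coset_shift G h"
      using a' by (rule coset_elem)
    have "r *\<^sub>R a' = r *\<^sub>R a + coset_shift G (r *\<^sub>R h)"
      by (simp only: h(2) coset_shift_scaleR [OF h(1)] scaleR_add_right)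
    then show ?thesis
      by (simp only: coset_absorb [OF smooth_funs_scaleR [OF gerbe_manifolds(1) h(1)]])
  qed
  then have "(\<Union>a'\<in>coset G a. coset G (r *\<^sub>R a')) = coset G (r *\<^sub>R a)"
    using mem_coset [of a] by blast
  then show ?thesis
    by (simp only: butterfly_comp_def Let_def comp_coset_eq dsum_total_simps
        butterfly.simps vspace.simps)
qed

lemma composite_brak:
  assumes a: "a \<in> fibre_sum G \<gamma> B" and b: "b \<in> fibre_sum G \<gamma> B"
  shows "brak composite (coset G a) (coset G b) = coset G (fibre_sum_bracket G \<gamma> B chi \<tau> a b)"
proof -
  have "(\<Union>a'\<in>coset G a. \<Union>b'\<in>coset G b. coset G (fibre_sum_bracket G \<gamma> B chi \<tau> a' b')) =
      coset G (fibre_sum_bracket G \<gamma> B chi \<tau> a b)"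
  proof (rule UN2_const [OF mem_coset mem_coset])
    fix a' b' assume a': "a' \<in> coset G a" and b': "b' \<in> coset G b"
    obtain h where h: "h \<in> smooth_funs (base G)" "a' = a + coset_shift G h"
      using a' by (rule coset_elem)
    obtain k where k: "k \<in> smooth_funs (base G)" "b' = b + coset_shift G k"
      using b' by (rule coset_elem)
    show "coset G (fibre_sum_bracket G \<gamma> B chi \<tau> a' b') = coset G (fibre_sum_bracket G \<gamma> B chi \<tau> a b)"
      unfolding h(2) k(2) by (rule coset_eqI [OF fibre_sum_bracket_shift [OF a b h(1) k(1)]])
  qed
  then show ?thesis
    by (simp only: butterfly_comp_def Let_def comp_coset_eq fibre_sum_bracket_def
        butterfly.simps case_prod_unfold)
qed

lemma composite_kap: "kap composite v = coset G (kap (gerbe_butterfly G \<gamma> B) v, 0)"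
  and composite_lam: "lam composite u = coset G (0, lam (shift_butterfly (base G) chi \<tau>) u)"
  by (simp_all only: butterfly_comp_def Let_def comp_coset_eq gerbe_butterfly_simps
        shift_butterfly_simps butterfly.simps)

text \<open>The shift has zero component in the symmetry part, so the first projection is the same
  on all representatives and the description has a unique solution.\<close>

lemma composite_sig: "sig composite (coset G a) = fst (fst a)"
proof -
  have *: "fst (fst a') = fst (fst a)" if a': "a' \<in> coset G a" for a'
  proof -
    obtain h where h: "a' = a + coset_shift G h"
      using a' by (rule coset_elem)
    show ?thesis unfolding h coset_shift_def by (simp only: fst_add fst_conv add_0_right)
  qed
  have "(THE x. \<exists>a'\<in>coset G a. x = fst (fst a')) = fst (fst a)"
  proof (rule the_equality)
    show "\<exists>a'\<in>coset G a. fst (fst a) = fst (fst a')"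
      by (rule bexI [OF refl mem_coset])
    show "x = fst (fst a)" if "\<exists>a'\<in>coset G a. x = fst (fst a')" for x
      using that by (elim bexE) (simp only: *)
  qed
  then show ?thesis
    by (simp only: butterfly_comp_def Let_def gerbe_butterfly_simps butterfly.simps case_prod_unfold)
qed

lemma composite_rho:
  assumes a: "a \<in> fibre_sum G \<gamma> B"
  shows "rho composite (coset G a) =
    gerbe_rho G (B + pull2 (objs G) (base G) (proj G) \<tau>) (sum_merge G a)" (is "_ = ?y")
proof -
  have *: "rho (shift_butterfly (base G) chi \<tau>) (snd a') = ?y" if a': "a' \<in> coset G a" for a'
  proof -
    obtain h where h: "h \<in> smooth_funs (base G)" "a' = a + coset_shift G h"
      using a' by (rule coset_elem)
    show ?thesis unfolding h(2) by (rule rho_fibre_sum_shift [OF a h(1) \<tau>])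
  qed
  have "(THE y. \<exists>a'\<in>coset G a. y = rho (shift_butterfly (base G) chi \<tau>) (snd a')) = ?y"
  proof (rule the_equality)
    show "\<exists>a'\<in>coset G a. ?y = rho (shift_butterfly (base G) chi \<tau>) (snd a')"
      by (rule bexI [of _ a]) (simp_all only: * mem_coset)
    show "y = ?y" if "\<exists>a'\<in>coset G a. y = rho (shift_butterfly (base G) chi \<tau>) (snd a')" for y
      using that by (elim bexE) (simp only: *)
  qed
  then show ?thesis
    by (simp only: butterfly_comp_def Let_def butterfly.simps case_prod_unfold)
qed

lemma composite_iso:
  "butterfly_iso (sym_lie2 G \<gamma>) (courant_lie2 (base G) (chi + d2 (base G) \<tau>)) composite
    (gerbe_butterfly G \<gamma> (B + pull2 (objs G) (base G) (proj G) \<tau>)) (\<lambda>A. the_elem (sum_merge G ` A))"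
  \<comment> \<open>The carrier is an image under \<open>coset G\<close>; \<open>ball_simps\<close>
    moves every quantifier from cosets to representatives.\<close>
  unfolding butterfly_iso_def composite_carrier ball_simps gerbe_butterfly_simps
proof (intro conjI ballI allI)
  let ?\<Phi> = "\<lambda>A. the_elem (sum_merge G ` A)"
  show "bij_betw ?\<Phi> (coset G ` fibre_sum G \<gamma> B) (gerbe_total G \<gamma>)"
  proof (rule bij_betw_imageI)
    show "inj_on ?\<Phi> (coset G ` fibre_sum G \<gamma> B)"
    proof (rule inj_onI, elim imageE)
      fix A A' a a'
      assume eq: "?\<Phi> A = ?\<Phi> A'" and A: "A = coset G a" "A' = coset G a'"
        and a: "a \<in> fibre_sum G \<gamma> B" and a': "a' \<in> fibre_sum G \<gamma> B"
      show "A = A'"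
        using eq unfolding A the_sum_merge_coset by (rule sum_merge_fibre_sum_inj [OF a a'])
    qed
    show "?\<Phi> ` coset G ` fibre_sum G \<gamma> B = gerbe_total G \<gamma>"
      unfolding image_image the_sum_merge_coset by (rule sum_merge_fibre_sum_image [OF \<gamma> B])
  qed
  show "?\<Phi> (vadd (total composite) (coset G a) (coset G b)) = ?\<Phi> (coset G a) + ?\<Phi> (coset G b)" for a b
    by (simp only: composite_vadd the_sum_merge_coset sum_merge_add)
  show "?\<Phi> (vscale (total composite) r (coset G a)) = r *\<^sub>R ?\<Phi> (coset G a)" for r a
    by (simp only: composite_vscale the_sum_merge_coset sum_merge_scaleR)
  show "?\<Phi> (brak composite (coset G a) (coset G b)) =
      brak (gerbe_butterfly G \<gamma> (B + pull2 (objs G) (base G) (proj G) \<tau>)) (?\<Phi> (coset G a)) (?\<Phi> (coset G b))"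
    if "a \<in> fibre_sum G \<gamma> B" "b \<in> fibre_sum G \<gamma> B" for a b
    by (simp only: composite_brak [OF that] the_sum_merge_coset sum_merge_fibre_sum_bracket [OF that])
  show "?\<Phi> (kap composite v) = (sym_bd G \<gamma> v, - vert G \<gamma> v)" for v
    unfolding composite_kap the_sum_merge_coset gerbe_butterfly_simps
    by (simp add: sum_merge_def zero_prod_def fun_eq_iff)
  show "?\<Phi> (lam composite f) = (0, f \<circ> proj G)" for f
    unfolding composite_lam the_sum_merge_coset shift_butterfly_simps
    by (simp add: sum_merge_def zero_prod_def fun_eq_iff)
  show "fst (?\<Phi> (coset G a)) = sig composite (coset G a)" for a
    unfolding composite_sig the_sum_merge_coset by (simp add: sum_merge_def case_prod_unfold)
  show "gerbe_rho G (B + pull2 (objs G) (base G) (proj G) \<tau>) (?\<Phi> (coset G a)) = rho composite (coset G a)"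
    if "a \<in> fibre_sum G \<gamma> B" for a
    by (simp only: composite_rho [OF that] the_sum_merge_coset)
qed

end

end

theorem proposition3p8:
  fixes G :: "('m::{t2_space, second_countable_topology}, 'em::finite_dim_inner,
      'x::{t2_space, second_countable_topology}, 'ex::finite_dim_inner,
      'p::{t2_space, second_countable_topology}, 'ep::finite_dim_inner) gerbe"
    and \<gamma> :: "'p \<Rightarrow> 'ep \<Rightarrow> real"
    and B B' :: "'x \<Rightarrow> 'ex \<Rightarrow> 'ex \<Rightarrow> real"
    and chi :: "'m \<Rightarrow> 'em \<Rightarrow> 'em \<Rightarrow> 'em \<Rightarrow> real"
    and \<tau> :: "'m \<Rightarrow> 'em \<Rightarrow> 'em \<Rightarrow> real"
  assumes "bundle_gerbe G"
    and "gerbe_connection G \<gamma>"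
    and "curving G \<gamma> B"
    and "three_curvature G B chi"
    and "\<tau> \<in> forms2 (base G)"
    and "B' = B + pull2 (objs G) (base G) (proj G) \<tau>"
  shows "\<exists>\<Phi>. butterfly_iso (sym_lie2 G \<gamma>) (courant_lie2 (base G) (chi + d2 (base G) \<tau>))
    (butterfly_comp (courant_lie2 (base G) chi)
      (shift_butterfly (base G) chi \<tau>) (gerbe_butterfly G \<gamma> B))
    (gerbe_butterfly G \<gamma> B') \<Phi>"
proof -
  have "\<gamma> \<in> forms1 (arrs G)" using assms(2) unfolding gerbe_connection_def by (elim conjE)
  then show ?thesis
    unfolding assms(6) by (intro exI) (rule composite_iso [OF assms(1) _ assms(3,5)])
qed

end
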